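(* Let $R$ be a finite dimensional algebra over an algebraically closed field $k$, and let $(\theta,\leq)$ be a stratifying system of size $t$ in $\mathrm{mod}\,R$ such that $\infty_\theta=\{i_0\}$ (i.e. $\theta(i_0)$ is the only member of $\theta$ of infinite projective dimension). Define $s:=\max\{\mathrm{pd}\,\theta(j) : j\in[1,t],\ j\neq i_0\}$ if $t>1$, and $s:=0$ otherwise. Then (a) $\mathrm{pfd}\,\mathcal{F}(\theta)\leq s$; (b) $\Psi\mathrm{d}(\mathcal{F}(\theta))\leq 1+s+\Psi(\Omega^{s+1}\theta(i_0))$.
   Context: $\mathrm{mod}\,R$ is the category of finitely generated left $R$-modules; all modules are in $\mathrm{mod}\,R$; $\mathrm{pd}$ is projective dimension (with $\mathrm{pd}\,0=0$); $\Omega M$ is the first syzygy of $M$ (kernel of a projective cover), $\Omega^m$ its iterates; $\coprod$ denotes direct sum. $[1,t]=\{1,\dots,t\}$ with its natural total order $\leq$. A stratifying system $(\theta,\leq)$ of size $t$ in $\mathrm{mod}\,R$ is a set $\theta=\{\theta(i): i\in[1,t]\}$ of indecomposable $R$-modules such that $\mathrm{Hom}_R(\theta(j),\theta(i))=0$ for $j>i$ and $\mathrm{Ext}^1_R(\theta(j),\theta(i))=0$ for $j\geq i$. Put $\infty_\theta:=\{i\in[1,t]: \mathrm{pd}\,\theta(i)=\infty\}$. $\mathcal{F}(\theta)$ is the full subcategory of $\mathrm{mod}\,R$ whose objects are $0$ and the modules $M\ne 0$ having a finite chain of submodules $0=M_0\subseteq M_1\subseteq\cdots\subseteq M_m=M$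 with each $M_i/M_{i-1}$ isomorphic to some object of $\theta$. For a class $\mathcal{X}$ of modules, $\mathrm{pfd}\,\mathcal{X}:=\sup\{\mathrm{pd}\,X : X\in\mathcal{X},\ \mathrm{pd}\,X<\infty\}$ and $\Psi\mathrm{d}(\mathcal{X}):=\sup\{\Psi(X): X\in\mathcal{X}\}$. Igusa–Todorov function $\Psi:\mathrm{mod}\,R\to\mathbb{N}$: let $\mathcal{K}$ be the quotient of the free abelian group on the symbols $[M]$, $M\in\mathrm{mod}\,R$, by the relations $[C]=[A]+[B]$ if $C\simeq A\coprod B$, and $[P]=0$ if $P$ is projective. The syzygy induces a $\mathbb{Z}$-endomorphism $\Omega:\mathcal{K}\to\mathcal{K}$, $\Omega[M]:=[\Omega M]$. For a module $M$, let $\langle M\rangle\subseteq\mathcal{K}$ be the subgroup generated by the classes of the indecomposable direct summands of $M$. Let $\Phi(M)$ be the smallest non-negative integer such that $\Omega:\Omega^m\langle M\rangle\to\Omega^{m+1}\langle M\rangle$ is an isomorphism for all $m\geq\Phi(M)$ (it exists by Fitting's lemma). Let $\mathcal{C}_M$ be the set of direct summands of $\Omega^{\Phi(M)}(M)$. Then $\Psi(M):=\Phi(M)+\mathrm{pfd}\,\mathcal{C}_M$. *)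

theory Defs
  imports
    "HOL-Algebra.Free_Abelian_Groups"
    "HOL-Computational_Algebra.Polynomial"
    "HOL-Library.Function_Algebras"
    "HOL-Library.Product_Plus"
    "HOL-Library.Extended_Nat"
    "HOL-Library.FuncSet"
begin

section \<open>Finite dimensional algebras\<close>

locale finite_dimensional_algebra = vector_space scale
  for scale :: "'k::field \<Rightarrow> 'r::ring_1 \<Rightarrow> 'r" +
  assumes scale_mult_left: "scale c x * y = scale c (x * y)"
    and scale_mult_right: "x * scale c y = scale c (x * y)"
    and finite_dimensional: "\<exists>B. finite B \<and> span B = UNIV"


section \<open>Left modules over a ring\<close>

text \<open>
  A left module over \<open>'r\<close> is carried by a subgroup of an ambient abelian group \<open>'m\<close> (whose addition
  it inherits) together with an action of \<open>'r\<close>; the values of the action off the carrier are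
  irrelevant.
\<close>

record ('r, 'm) lmod =
  carr :: "'m set"
  act :: "'r \<Rightarrow> 'm \<Rightarrow> 'm"

definition left_module :: "('r::ring_1, 'm::ab_group_add) lmod \<Rightarrow> bool" where
  "left_module M \<longleftrightarrow>
     0 \<in> carr M \<and>
     (\<forall>x\<in>carr M. \<forall>y\<in>carr M. x + y \<in> carr M) \<and>
     (\<forall>r. \<forall>x\<in>carr M. act M r x \<in> carr M) \<and>
     (\<forall>r. \<forall>x\<in>carr M. \<forall>y\<in>carr M. act M r (x + y) = act M r x + act M r y) \<and>
     (\<forall>r s. \<forall>x\<in>carr M. act M (r + s) x = act M r x + act M s x) \<and>
     (\<forall>r s. \<forall>x\<in>carr M. act M (r * s) x = act M r (act M s x)) \<and>
     (\<forall>x\<in>carr M. act M 1 x = x)"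

text \<open>Closure under negation need not be required, since \<open>-x = (-1) x\<close>.\<close>

lemma left_module_uminus_closed:
  assumes M: "left_module M" and x: "x \<in> carr M"
  shows "- x \<in> carr M"
proof -
  have add: "\<And>r s. act M (r + s) x = act M r x + act M s x"
    and one: "act M 1 x = x" and closed: "act M (- 1) x \<in> carr M"
    using M x by (auto simp: left_module_def)
  have "act M 0 x = 0"
    using add[of 0 0] by simp
  hence "act M (- 1) x + x = 0"
    using add[of "- 1" 1] one by simp
  hence "act M (- 1) x = - x"
    by (simp add: eq_neg_iff_add_eq_0)
  thus ?thesis using closed by simp
qed

definition submodule :: "('r::ring_1, 'm::ab_group_add) lmod \<Rightarrow> 'm set \<Rightarrow> bool" where
  "submodule M S \<longleftrightarrow>
     S \<subseteq> carr M \<and> 0 \<in> S \<and> (\<forall>x\<in>S. \<forall>y\<in>S. x + y \<in> S) \<and> (\<forall>r. \<forall>x\<in>S. act M r x \<in> S)"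

definition finitely_generated :: "('r::ring_1, 'm::ab_group_add) lmod \<Rightarrow> bool" where
  "finitely_generated M \<longleftrightarrow>
     (\<exists>B\<subseteq>carr M. finite B \<and> (\<forall>S. submodule M S \<and> B \<subseteq> S \<longrightarrow> S = carr M))"

definition zero_module :: "('r::ring_1, 'm::ab_group_add) lmod \<Rightarrow> bool" where
  "zero_module M \<longleftrightarrow> carr M = {0}"

text \<open>Homomorphisms are extensional, so that equality in \<open>Hom\<close> is equality on the carrier.\<close>

definition Hom ::
  "('r::ring_1, 'm::ab_group_add) lmod \<Rightarrow> ('r, 'n::ab_group_add) lmod \<Rightarrow> ('m \<Rightarrow> 'n) set" where
  "Hom M N =
     {f \<in> carr M \<rightarrow>\<^sub>E carr N.
        (\<forall>x\<in>carr M. \<forall>y\<in>carr M. f (x + y) = f x + f y) \<and>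
        (\<forall>r. \<forall>x\<in>carr M. f (act M r x) = act N r (f x))}"

definition Hom_group ::
  "('r::ring_1, 'm::ab_group_add) lmod \<Rightarrow> ('r, 'n::ab_group_add) lmod \<Rightarrow> ('m \<Rightarrow> 'n) monoid" where
  "Hom_group M N =
     \<lparr>carrier = Hom M N, monoid.mult = (\<lambda>f g. \<lambda>x\<in>carr M. f x + g x), one = (\<lambda>x\<in>carr M. 0)\<rparr>"

definition Ker :: "('r::ring_1, 'm::ab_group_add) lmod \<Rightarrow> ('m \<Rightarrow> 'n::ab_group_add) \<Rightarrow> 'm set" where
  "Ker M f = {x \<in> carr M. f x = 0}"

definition mod_iso ::
  "('r::ring_1, 'm::ab_group_add) lmod \<Rightarrow> ('r, 'n::ab_group_add) lmod \<Rightarrow> bool"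
  (infix \<open>\<cong>\<^sub>R\<close> 50) where
  "M \<cong>\<^sub>R N \<longleftrightarrow> (\<exists>f\<in>Hom M N. bij_betw f (carr M) (carr N))"

definition direct_sum ::
  "('r::ring_1, 'm::ab_group_add) lmod \<Rightarrow> ('r, 'n::ab_group_add) lmod \<Rightarrow> ('r, 'm \<times> 'n) lmod"
  (infixr \<open>\<oplus>\<^sub>R\<close> 65) where
  "A \<oplus>\<^sub>R B = \<lparr>carr = carr A \<times> carr B, act = (\<lambda>r (x, y). (act A r x, act B r y))\<rparr>"

text \<open>
  \<open>quotient_iso M S N\<close> says \<open>M/S \<cong> N\<close>. The set \<open>(+) x ` S\<close> is the coset \<open>x + S\<close>; the isomorphism \<open>h\<close>
  is a map on cosets, because the type of sets of elements of \<open>'m\<close> is not itself an abelian group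
  and so cannot serve as the ambient group of a module.
\<close>

definition quotient_iso ::
  "('r::ring_1, 'm::ab_group_add) lmod \<Rightarrow> 'm set \<Rightarrow> ('r, 'n::ab_group_add) lmod \<Rightarrow> bool" where
  "quotient_iso M S N \<longleftrightarrow>
     (\<exists>h. bij_betw h ((\<lambda>x. (+) x ` S) ` carr M) (carr N) \<and>
          (\<forall>x\<in>carr M. \<forall>y\<in>carr M. h ((+) (x + y) ` S) = h ((+) x ` S) + h ((+) y ` S)) \<and>
          (\<forall>r. \<forall>x\<in>carr M. h ((+) (act M r x) ` S) = act N r (h ((+) x ` S))))"


section \<open>The category of finitely generated modules\<close>

text \<open>
  To quantify over all modules one has to fix the ambient group. If \<open>'r\<close> is a finite dimensional
  algebra over \<open>'k\<close>, every finitely generated module is a finite dimensional \<open>'k\<close>-space, hence is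
  isomorphic to one carried by coordinate vectors, i.e. to a module inside \<open>nat \<Rightarrow> 'k\<close>. The module
  action is not related to the pointwise \<open>'k\<close>-action on \<open>nat \<Rightarrow> 'k\<close>, of which only the additive
  group is used.
\<close>

type_synonym ('r, 'k) rmod = "('r, nat \<Rightarrow> 'k) lmod"

definition mod_R :: "('r::ring_1, 'k::field) rmod set" where
  "mod_R = {M. left_module M \<and> finitely_generated M}"

definition direct_summand :: "('r::ring_1, 'k::field) rmod \<Rightarrow> ('r, 'k) rmod \<Rightarrow> bool" where
  "direct_summand N M \<longleftrightarrow> N \<in> mod_R \<and> (\<exists>L :: ('r, 'k) rmod. L \<in> mod_R \<and> M \<cong>\<^sub>R N \<oplus>\<^sub>R L)"

definition indecomposable :: "('r::ring_1, 'k::field) rmod \<Rightarrow> bool" where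
  "indecomposable M \<longleftrightarrow>
     M \<in> mod_R \<and> \<not> zero_module M \<and>
     (\<forall>(A :: ('r, 'k) rmod) (B :: ('r, 'k) rmod). A \<in> mod_R \<and> B \<in> mod_R \<and>
        M \<cong>\<^sub>R A \<oplus>\<^sub>R B \<longrightarrow> zero_module A \<or> zero_module B)"

definition projective :: "('r::ring_1, 'k::field) rmod \<Rightarrow> bool" where
  "projective P \<longleftrightarrow>
     P \<in> mod_R \<and>
     (\<forall>(M :: ('r, 'k) rmod) (N :: ('r, 'k) rmod). M \<in> mod_R \<and> N \<in> mod_R \<longrightarrow>
        (\<forall>g\<in>Hom M N. \<forall>f\<in>Hom P N. g ` carr M = carr N \<longrightarrow>
          (\<exists>h\<in>Hom P M. \<forall>x\<in>carr P. g (h x) = f x)))"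

text \<open>A projective cover is an epimorphism from a projective module with superfluous kernel.\<close>

definition projective_cover ::
  "('r::ring_1, 'k::field) rmod \<Rightarrow> ((nat \<Rightarrow> 'k) \<Rightarrow> (nat \<Rightarrow> 'k)) \<Rightarrow> ('r, 'k) rmod \<Rightarrow> bool" where
  "projective_cover P f M \<longleftrightarrow>
     projective P \<and> f \<in> Hom P M \<and> f ` carr P = carr M \<and>
     (\<forall>L. submodule P L \<and> {x + y | x y. x \<in> L \<and> y \<in> Ker P f} = carr P \<longrightarrow> L = carr P)"

text \<open>The syzygy is determined up to isomorphism only; \<open>\<Omega>\<close> picks one.\<close>

definition syzygy :: "('r::ring_1, 'k::field) rmod \<Rightarrow> ('r, 'k) rmod" (\<open>\<Omega>\<close>) where
  "\<Omega> M = (SOME K. \<exists>P f. projective_cover P f M \<and> K = P\<lparr>carr := Ker P f\<rparr>)"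

text \<open>
  The resolution \<open>\<dots> \<rightarrow> P 2 \<rightarrow> P 1 \<rightarrow> P 0 \<rightarrow> M \<rightarrow> 0\<close> has augmentation \<open>e : P 0 \<rightarrow> M\<close> and
  differentials \<open>d n : P (n + 1) \<rightarrow> P n\<close>.
\<close>

definition proj_resolution ::
  "(nat \<Rightarrow> ('r::ring_1, 'k::field) rmod) \<Rightarrow> (nat \<Rightarrow> (nat \<Rightarrow> 'k) \<Rightarrow> (nat \<Rightarrow> 'k)) \<Rightarrow>
   ((nat \<Rightarrow> 'k) \<Rightarrow> (nat \<Rightarrow> 'k)) \<Rightarrow> ('r, 'k) rmod \<Rightarrow> bool" where
  "proj_resolution P d e M \<longleftrightarrow>
     (\<forall>n. projective (P n)) \<and>
     e \<in> Hom (P 0) M \<and> e ` carr (P 0) = carr M \<and>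
     (\<forall>n. d n \<in> Hom (P (Suc n)) (P n)) \<and>
     d 0 ` carr (P 1) = Ker (P 0) e \<and>
     (\<forall>n. d (Suc n) ` carr (P (Suc (Suc n))) = Ker (P (Suc n)) (d n))"

text \<open>The infimum of the empty set is \<open>\<infinity>\<close>. The zero module gets dimension 0.\<close>

definition pd :: "('r::ring_1, 'k::field) rmod \<Rightarrow> enat" where
  "pd M = Inf {enat n | n. \<exists>P d e. proj_resolution P d e M \<and> (\<forall>i>n. zero_module (P i))}"

text \<open>
  \<open>Ext1 M N\<close> is the first cohomology group of \<open>Hom (P \<bullet>) N\<close> for a projective resolution
  \<open>P\<close> of \<open>M\<close>: cocycles \<open>P 1 \<rightarrow> N\<close> modulo the maps factoring through \<open>d 0 : P 1 \<rightarrow> P 0\<close>.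
\<close>

definition cocycles1 ::
  "(nat \<Rightarrow> ('r::ring_1, 'k::field) rmod) \<Rightarrow> (nat \<Rightarrow> (nat \<Rightarrow> 'k) \<Rightarrow> (nat \<Rightarrow> 'k)) \<Rightarrow>
   ('r, 'k) rmod \<Rightarrow> ((nat \<Rightarrow> 'k) \<Rightarrow> (nat \<Rightarrow> 'k)) set" where
  "cocycles1 P d N = {f \<in> Hom (P 1) N. \<forall>x\<in>carr (P 2). f (d 1 x) = 0}"

definition coboundaries1 ::
  "(nat \<Rightarrow> ('r::ring_1, 'k::field) rmod) \<Rightarrow> (nat \<Rightarrow> (nat \<Rightarrow> 'k) \<Rightarrow> (nat \<Rightarrow> 'k)) \<Rightarrow>
   ('r, 'k) rmod \<Rightarrow> ((nat \<Rightarrow> 'k) \<Rightarrow> (nat \<Rightarrow> 'k)) set" where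
  "coboundaries1 P d N = (\<lambda>g. compose (carr (P 1)) g (d 0)) ` Hom (P 0) N"

definition Ext1 ::
  "('r::ring_1, 'k::field) rmod \<Rightarrow> ('r, 'k) rmod \<Rightarrow> ((nat \<Rightarrow> 'k) \<Rightarrow> (nat \<Rightarrow> 'k)) set monoid" where
  "Ext1 M N =
     (let (P, d) = (SOME (P, d). \<exists>e. proj_resolution P d e M)
      in (Hom_group (P 1) N)\<lparr>carrier := cocycles1 P d N\<rparr> Mod coboundaries1 P d N)"

text \<open>The supremum of the empty set of \<open>enat\<close> is \<open>0\<close>.\<close>

definition pfd :: "('r::ring_1, 'k::field) rmod set \<Rightarrow> enat" where
  "pfd \<C> = Sup {pd M | M. M \<in> \<C> \<and> pd M < \<infinity>}"


section \<open>The Igusa--Todorov function\<close>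

abbreviation free_mod :: "(('r::ring_1, 'k::field) rmod \<Rightarrow>\<^sub>0 int) monoid" where
  "free_mod \<equiv> free_Abelian_group mod_R"

definition IT_relations :: "(('r::ring_1, 'k::field) rmod \<Rightarrow>\<^sub>0 int) set" where
  "IT_relations =
     generate free_mod
       ({frag_of C - (frag_of A + frag_of B) | A B C.
           A \<in> mod_R \<and> B \<in> mod_R \<and> C \<in> mod_R \<and> C \<cong>\<^sub>R A \<oplus>\<^sub>R B} \<union>
        {frag_of P | P. projective P})"

definition IT_group :: "(('r::ring_1, 'k::field) rmod \<Rightarrow>\<^sub>0 int) set monoid" where
  "IT_group = free_mod Mod IT_relations"

definition IT_class :: "('r::ring_1, 'k::field) rmod \<Rightarrow> (('r, 'k) rmod \<Rightarrow>\<^sub>0 int) set" where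
  "IT_class M = IT_relations #>\<^bsub>free_mod\<^esub> frag_of M"

text \<open>
  The endomorphism of the quotient group induced by \<open>[M] \<mapsto> [\<Omega> M]\<close>. All elements \<open>c\<close> of a coset
  \<open>\<xi>\<close> give the same coset of \<open>frag_extend (frag_of \<circ> \<Omega>) c\<close>, and their union is that coset.
\<close>

definition IT_Omega ::
  "(('r::ring_1, 'k::field) rmod \<Rightarrow>\<^sub>0 int) set \<Rightarrow> (('r, 'k) rmod \<Rightarrow>\<^sub>0 int) set" where
  "IT_Omega \<xi> = (\<Union>c\<in>\<xi>. IT_relations #>\<^bsub>free_mod\<^esub> frag_extend (\<lambda>M. frag_of (\<Omega> M)) c)"

definition IT_span :: "('r::ring_1, 'k::field) rmod \<Rightarrow> (('r, 'k) rmod \<Rightarrow>\<^sub>0 int) set set" where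
  "IT_span M = generate IT_group {IT_class N | N. indecomposable N \<and> direct_summand N M}"

definition IT_Phi :: "('r::ring_1, 'k::field) rmod \<Rightarrow> nat" (\<open>\<Phi>\<close>) where
  "\<Phi> M =
     (LEAST n. \<forall>m\<ge>n.
        IT_Omega \<in> iso (IT_group\<lparr>carrier := (IT_Omega ^^ m) ` IT_span M\<rparr>)
                       (IT_group\<lparr>carrier := (IT_Omega ^^ Suc m) ` IT_span M\<rparr>))"

definition IT_Psi :: "('r::ring_1, 'k::field) rmod \<Rightarrow> enat" (\<open>\<Psi>\<close>) where
  "\<Psi> M = enat (\<Phi> M) + pfd {N. direct_summand N ((\<Omega> ^^ \<Phi> M) M)}"

definition Psi_dim :: "('r::ring_1, 'k::field) rmod set \<Rightarrow> enat" (\<open>\<Psi>d\<close>) where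
  "\<Psi>d \<C> = Sup (\<Psi> ` \<C>)"


section \<open>Stratifying systems\<close>

definition stratifying_system :: "nat \<Rightarrow> (nat \<Rightarrow> ('r::ring_1, 'k::field) rmod) \<Rightarrow> bool" where
  "stratifying_system t \<theta> \<longleftrightarrow>
     (\<forall>i\<in>{1..t}. indecomposable (\<theta> i)) \<and>
     (\<forall>i\<in>{1..t}. \<forall>j\<in>{1..t}. j > i \<longrightarrow> trivial_group (Hom_group (\<theta> j) (\<theta> i))) \<and>
     (\<forall>i\<in>{1..t}. \<forall>j\<in>{1..t}. j \<ge> i \<longrightarrow> trivial_group (Ext1 (\<theta> j) (\<theta> i)))"

definition infinite_pd_indices :: "nat \<Rightarrow> (nat \<Rightarrow> ('r::ring_1, 'k::field) rmod) \<Rightarrow> nat set" where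
  "infinite_pd_indices t \<theta> = {i \<in> {1..t}. pd (\<theta> i) = \<infinity>}"

definition filtered_modules ::
  "nat \<Rightarrow> (nat \<Rightarrow> ('r::ring_1, 'k::field) rmod) \<Rightarrow> ('r, 'k) rmod set" (\<open>\<F>\<close>) where
  "\<F> t \<theta> =
     {M \<in> mod_R.
        zero_module M \<or>
        (\<exists>m C. C 0 = {0} \<and> C m = carr M \<and>
           (\<forall>i\<le>m. submodule M (C i)) \<and>
           (\<forall>i<m. C i \<subseteq> C (Suc i) \<and>
              (\<exists>j\<in>{1..t}. quotient_iso (M\<lparr>carr := C (Suc i)\<rparr>) (C i) (\<theta> j))))}"

end

theory Submission
  imports Defs
begin

text \<open>
  Only the vanishing of \<open>Ext\<^sup>1(\<theta>(j), \<theta>(i))\<close> for \<open>j \<ge> i\<close> is needed. It allows two adjacent factors of a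
  filtration to be exchanged when the larger index lies on top, so the factors of a filtered module
  \<open>M\<close> can be sorted with the large indices at the bottom; the copies of \<open>\<theta>(i\<^sub>0)\<close> in the middle then
  split off as a direct sum \<open>\<theta>(i\<^sub>0)\<^sup>m\<close>. The bottom and the top part have projective dimension at most
  \<open>s\<close>, and the horseshoe lemma shows that \<open>\<Omega>\<^sup>s\<^sup>+\<^sup>1 M\<close> is stably isomorphic to the \<open>m\<close>-th power of
  \<open>Y = \<Omega>\<^sup>s\<^sup>+\<^sup>1 \<theta>(i\<^sub>0)\<close>. If \<open>M\<close> has finite projective dimension, then \<open>m = 0\<close>, which gives the
  bound on the projective dimension. By the Krull--Schmidt property every indecomposable summand of
  a module stably generated by \<open>Y\<close> is projective or a summand of \<open>Y\<close>; so \<open>\<Omega>\<^sup>s\<^sup>+\<^sup>1\<close> maps \<open>\<langle>M\<rangle>\<close> into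
  \<open>\<langle>Y\<rangle>\<close>, and the bound on \<open>\<Psi>\<close> follows.
\<close>

section \<open>Linear maps\<close>

text \<open>Syzygies respect direct sums and short exact sequences only up to projective summands,
  since \<open>\<Omega>\<close> is a mere choice and the horseshoe resolution need not be minimal.
  Hence syzygies are compared modulo projectives, and \<open>pd M \<le> n\<close> is read as
  projectivity of the \<open>n\<close>-th syzygy, which is invariant under such comparisons. The
  constant \<open>1 + s\<close> arises at the bottom of the filtration: removing a top part of
  projective dimension at most \<open>s\<close> is harmless from the \<open>s\<close>-th syzygy on,
  as epimorphisms onto projectives split, but removing such a bottom part costs one more syzygy, as
  a projective submodule need not split off. The bound on the projective dimension is still
  \<open>s\<close>, because for \<open>m = 0\<close> all factors of the filtration have projective
  dimension at most \<open>s\<close>. The multiplicity \<open>m\<close> must not enter the bound on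
  \<Psi>. Therefore the syzygy of \<open>M\<close> is recorded only as a member of the additive
  closure of \<open>Y\<close> and the projectives, and \<open>\<Psi> M \<le> n + \<Psi> Y\<close> is
  derived from that membership alone.\<close>

definition lin ::
  "('r::ring_1, 'm::ab_group_add) lmod \<Rightarrow> ('r, 'm) lmod \<Rightarrow> ('m \<Rightarrow> 'm) \<Rightarrow> bool" where
  "lin M N f \<longleftrightarrow> (\<forall>x\<in>carr M. f x \<in> carr N) \<and>
     (\<forall>x\<in>carr M. \<forall>y\<in>carr M. f (x + y) = f x + f y) \<and>
     (\<forall>r. \<forall>x\<in>carr M. f (act M r x) = act N r (f x))"

lemma lmD:
  assumes "left_module M"
  shows lm_zero: "0 \<in> carr M"
    and lm_add: "x \<in> carr M \<Longrightarrow> y \<in> carr M \<Longrightarrow> x + y \<in> carr M"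
    and lm_act: "x \<in> carr M \<Longrightarrow> act M r x \<in> carr M"
    and act_add: "x \<in> carr M \<Longrightarrow> y \<in> carr M \<Longrightarrow> act M r (x + y) = act M r x + act M r y"
    and act_radd: "x \<in> carr M \<Longrightarrow> act M (r + s) x = act M r x + act M s x"
    and act_mult: "x \<in> carr M \<Longrightarrow> act M (r * s) x = act M r (act M s x)"
    and act_one: "x \<in> carr M \<Longrightarrow> act M 1 x = x"
  using assms by (auto simp: left_module_def)

lemma lm_uminus: "left_module M \<Longrightarrow> x \<in> carr M \<Longrightarrow> - x \<in> carr M"
  by (rule left_module_uminus_closed)

lemma lm_diff: "left_module M \<Longrightarrow> x \<in> carr M \<Longrightarrow> y \<in> carr M \<Longrightarrow> x - y \<in> carr M"
  using lm_add[of M x "- y"] lm_uminus[of M y] by simp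

lemmas lm_closed = lm_zero lm_add lm_act lm_uminus lm_diff

lemma act_zero: "left_module M \<Longrightarrow> act M r 0 = 0"
  using act_add[of M 0 0 r] lm_zero[of M] by simp

lemma act_uminus: "left_module M \<Longrightarrow> x \<in> carr M \<Longrightarrow> act M r (- x) = - act M r x"
  using act_add[of M x "- x" r] lm_uminus[of M x]
  by (simp add: act_zero eq_neg_iff_add_eq_0 add.commute)

lemma act_diff:
  "left_module M \<Longrightarrow> x \<in> carr M \<Longrightarrow> y \<in> carr M \<Longrightarrow> act M r (x - y) = act M r x - act M r y"
  using act_add[of M x "- y" r] lm_uminus[of M y] by (simp add: act_uminus)

lemma linD:
  assumes "lin M N f"
  shows lin_closed: "x \<in> carr M \<Longrightarrow> f x \<in> carr N"
    and lin_add: "x \<in> carr M \<Longrightarrow> y \<in> carr M \<Longrightarrow> f (x + y) = f x + f y"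
    and lin_act: "x \<in> carr M \<Longrightarrow> f (act M r x) = act N r (f x)"
  using assms by (auto simp: lin_def)

lemma linI:
  assumes "\<And>x. x \<in> carr M \<Longrightarrow> f x \<in> carr N"
    and "\<And>x y. x \<in> carr M \<Longrightarrow> y \<in> carr M \<Longrightarrow> f (x + y) = f x + f y"
    and "\<And>r x. x \<in> carr M \<Longrightarrow> f (act M r x) = act N r (f x)"
  shows "lin M N f"
  using assms by (auto simp: lin_def)

lemma lin_0: "left_module M \<Longrightarrow> lin M N f \<Longrightarrow> f 0 = 0"
  using lin_add[of M N f 0 0] lm_zero[of M] by simp

lemma lin_uminus: "left_module M \<Longrightarrow> lin M N f \<Longrightarrow> x \<in> carr M \<Longrightarrow> f (- x) = - f x"
  using lin_add[of M N f x "- x"] lm_uminus[of M x] lin_0[of M N f]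
  by (simp add: eq_neg_iff_add_eq_0 add.commute)

lemma lin_diff:
  "left_module M \<Longrightarrow> lin M N f \<Longrightarrow> x \<in> carr M \<Longrightarrow> y \<in> carr M \<Longrightarrow> f (x - y) = f x - f y"
  using lin_add[of M N f x "- y"] lm_uminus[of M y] by (simp add: lin_uminus)

lemma lin_comp: "lin M N f \<Longrightarrow> lin N L g \<Longrightarrow> lin M L (\<lambda>x. g (f x))"
  by (auto simp: lin_def)

lemma lin_ident: "lin M M (\<lambda>x. x)"
  by (auto simp: lin_def)

lemma lin_zero: "left_module N \<Longrightarrow> lin M N (\<lambda>x. 0)"
  by (auto simp: lin_def lm_zero act_zero)

lemma lin_plus:
  "left_module N \<Longrightarrow> lin M N f \<Longrightarrow> lin M N g \<Longrightarrow> lin M N (\<lambda>x. f x + g x)"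
  by (auto simp: lin_def lm_add act_add algebra_simps)

lemma lin_minus:
  "left_module N \<Longrightarrow> lin M N f \<Longrightarrow> lin M N g \<Longrightarrow> lin M N (\<lambda>x. f x - g x)"
  by (auto simp: lin_def lm_diff act_diff algebra_simps)

lemma lin_funpow: "lin M M f \<Longrightarrow> lin M M (f ^^ n)"
  by (induction n) (auto simp: lin_def)

lemma lin_injI:
  assumes "left_module M" "lin M N f" "\<And>x. x \<in> carr M \<Longrightarrow> f x = 0 \<Longrightarrow> x = 0"
  shows "inj_on f (carr M)"
proof (rule inj_onI)
  fix x y assume "x \<in> carr M" "y \<in> carr M" "f x = f y"
  then have "f (x - y) = 0" "x - y \<in> carr M"
    using assms by (auto simp: lin_diff lm_diff)
  then have "x - y = 0" using assms(3) by blast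
  then show "x = y" by simp
qed

lemma lin_injD:
  "left_module M \<Longrightarrow> lin M N f \<Longrightarrow> inj_on f (carr M) \<Longrightarrow> x \<in> carr M \<Longrightarrow> f x = 0 \<Longrightarrow> x = 0"
  using lin_0[of M N f] lm_zero[of M] by (metis inj_onD)

lemma lin_inverse:
  assumes M: "left_module M" and f: "lin M N f" "bij_betw f (carr M) (carr N)"
  obtains g where "lin N M g" "bij_betw g (carr N) (carr M)"
    "\<And>x. x \<in> carr M \<Longrightarrow> g (f x) = x" "\<And>y. y \<in> carr N \<Longrightarrow> f (g y) = y"
proof
  let ?g = "inv_into (carr M) f"
  show gf: "?g (f x) = x" if "x \<in> carr M" for x
    using f(2) that by (simp add: bij_betw_inv_into_left)
  show fg: "f (?g y) = y" if "y \<in> carr N" for y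
    using f(2) that by (simp add: bij_betw_inv_into_right)
  show b: "bij_betw ?g (carr N) (carr M)"
    using f(2) by (rule bij_betw_inv_into)
  have cl: "?g y \<in> carr M" if "y \<in> carr N" for y
    using b that bij_betwE by blast
  show "lin N M ?g"
  proof (rule linI)
    fix x y assume xy: "x \<in> carr N" "y \<in> carr N"
    then have "f (?g x + ?g y) = x + y"
      using f(1) cl fg by (simp add: lin_add)
    then show "?g (x + y) = ?g x + ?g y"
      using gf[of "?g x + ?g y"] cl xy lm_add[OF M] by simp
  next
    fix r x assume x: "x \<in> carr N"
    then have "f (act M r (?g x)) = act N r x"
      using f(1) cl fg by (simp add: lin_act)
    then show "?g (act N r x) = act M r (?g x)"
      using gf[of "act M r (?g x)"] cl x lm_act[OF M] by metis
  qed (rule cl)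
qed

lemma Hom_lin: "f \<in> Hom M N \<Longrightarrow> lin M N f"
  by (auto simp: Hom_def lin_def)

text \<open>\<open>Hom\<close> consists of extensional functions, whereas \<open>lin\<close> ignores
  values off the carrier, so that composites, sums and inclusions of submodules stay
  \<open>lin\<close> as they are. Restriction is applied only where an element of \<open>Hom\<close>
  is demanded.\<close>

lemma lin_restrict:
  "left_module M \<Longrightarrow> lin M N f \<Longrightarrow> restrict f (carr M) \<in> Hom M N"
  by (auto simp: Hom_def lin_def lm_add lm_act)

lemma mod_iso_iff:
  "left_module M \<Longrightarrow> M \<cong>\<^sub>R N \<longleftrightarrow> (\<exists>f. lin M N f \<and> bij_betw f (carr M) (carr N))"
proof
  assume "left_module M" "\<exists>f. lin M N f \<and> bij_betw f (carr M) (carr N)"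
  then obtain f where "lin M N f" "bij_betw f (carr M) (carr N)" by blast
  then show "M \<cong>\<^sub>R N"
    unfolding mod_iso_def using lin_restrict[OF \<open>left_module M\<close>]
    by (intro bexI[of _ "restrict f (carr M)"]) (simp_all add: bij_betw_restrict_eq)
qed (auto simp: mod_iso_def intro: Hom_lin)

lemma mod_isoI:
  assumes "left_module M" "lin M N f" "\<And>x. x \<in> carr M \<Longrightarrow> f x = 0 \<Longrightarrow> x = 0"
    "\<And>y. y \<in> carr N \<Longrightarrow> \<exists>x\<in>carr M. f x = y"
  shows "M \<cong>\<^sub>R N"
proof -
  have "bij_betw f (carr M) (carr N)"
    using lin_injI[OF assms(1-3)] assms(2,4) by (fastforce simp: bij_betw_def lin_def)
  then show ?thesis using assms(1,2) mod_iso_iff by blast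
qed

lemma mod_isoI_inverse:
  assumes "left_module M" "lin M N f" "lin N M g"
    "\<And>x. x \<in> carr M \<Longrightarrow> g (f x) = x" "\<And>y. y \<in> carr N \<Longrightarrow> f (g y) = y"
  shows "M \<cong>\<^sub>R N"
proof -
  have "bij_betw f (carr M) (carr N)"
    using assms by (intro bij_betw_byWitness[where f' = g]) (auto simp: lin_def)
  then show ?thesis using assms(1,2) mod_iso_iff by blast
qed

lemma mod_isoE:
  assumes "M \<cong>\<^sub>R N" "left_module M"
  obtains f g where "lin M N f" "lin N M g" "bij_betw f (carr M) (carr N)"
    "bij_betw g (carr N) (carr M)"
    "\<And>x. x \<in> carr M \<Longrightarrow> g (f x) = x" "\<And>y. y \<in> carr N \<Longrightarrow> f (g y) = y"
proof -
  obtain f where f: "lin M N f" "bij_betw f (carr M) (carr N)"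
    using assms mod_iso_iff[OF assms(2), of N] by blast
  show thesis
    by (rule lin_inverse[OF assms(2) f]) (rule that[OF f(1) _ f(2)])
qed

lemma mod_iso_refl: "left_module M \<Longrightarrow> M \<cong>\<^sub>R M"
  using mod_iso_iff lin_ident bij_betw_id unfolding id_def by blast

lemma mod_iso_sym:
  fixes M N :: "('r::ring_1, 'm::ab_group_add) lmod"
  assumes "left_module M" "left_module N" "M \<cong>\<^sub>R N" shows "N \<cong>\<^sub>R M"
proof -
  obtain g where "lin N M g" "bij_betw g (carr N) (carr M)"
    using mod_isoE[OF assms(3,1)] by metis
  then show ?thesis using mod_iso_iff[OF assms(2), of M] by blast
qed

lemma mod_iso_trans:
  fixes M N L :: "('r::ring_1, 'm::ab_group_add) lmod"
  shows "left_module M \<Longrightarrow> M \<cong>\<^sub>R N \<Longrightarrow> N \<cong>\<^sub>R L \<Longrightarrow> left_module N \<Longrightarrow> M \<cong>\<^sub>R L"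
  unfolding mod_iso_iff using lin_comp[of M N _ L] bij_betw_trans[of _ "carr M" "carr N" _ "carr L"]
  unfolding comp_def by blast

section \<open>Submodules\<close>

lemma submodule_carr: "left_module M \<Longrightarrow> submodule M (carr M)"
  by (auto simp: submodule_def lm_closed)

lemma submodule_left_module: "left_module M \<Longrightarrow> submodule M S \<Longrightarrow> left_module (M\<lparr>carr := S\<rparr>)"
  unfolding left_module_def submodule_def by (simp add: subset_iff)

lemma submodule_Ker: "left_module M \<Longrightarrow> left_module N \<Longrightarrow> lin M N f \<Longrightarrow> submodule M (Ker M f)"
  by (auto simp: submodule_def Ker_def lm_closed lin_add lin_act lin_0 act_zero)

lemma submodule_image:
  assumes "left_module M" "lin M N f" "submodule M S"
  shows "submodule N (f ` S)"
proof -
  have S: "S \<subseteq> carr M" "0 \<in> S" "\<And>x y. x \<in> S \<Longrightarrow> y \<in> S \<Longrightarrow> x + y \<in> S" "\<And>r x. x \<in> S \<Longrightarrow> act M r x \<in> S"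
    using assms(3) by (auto simp: submodule_def)
  have "f x + f y \<in> f ` S" if "x \<in> S" "y \<in> S" for x y
    using imageI[OF S(3)[OF that], of f] lin_add[OF assms(2), of x y] S(1) that
    by (metis subsetD)
  moreover have "act N r (f x) \<in> f ` S" if "x \<in> S" for r x
    using imageI[OF S(4)[OF that], of f] lin_act[OF assms(2), of x r] S(1) that
    by (metis subsetD)
  moreover have "0 \<in> f ` S" using S(2) lin_0[OF assms(1,2)] by (metis imageI)
  ultimately show ?thesis
    using S(1) assms(2) by (auto simp: submodule_def lin_closed subset_iff)
qed

lemma submodule_preimage:
  "left_module M \<Longrightarrow> lin M N f \<Longrightarrow> submodule N S \<Longrightarrow> submodule M {x \<in> carr M. f x \<in> S}"
  by (auto simp: submodule_def lm_closed lin_add lin_act lin_0)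

lemma submodule_Inter:
  "\<A> \<noteq> {} \<Longrightarrow> (\<And>S. S \<in> \<A> \<Longrightarrow> submodule M S) \<Longrightarrow> submodule M (\<Inter>\<A>)"
  by (auto simp: submodule_def; blast)

lemma submodule_Int: "submodule M S \<Longrightarrow> submodule M T \<Longrightarrow> submodule M (S \<inter> T)"
  by (auto simp: submodule_def)

lemma submodule_diff:
  "left_module M \<Longrightarrow> submodule M S \<Longrightarrow> x \<in> S \<Longrightarrow> y \<in> S \<Longrightarrow> x - y \<in> S"
  using lm_diff[OF submodule_left_module] by fastforce

lemma submodule_sub_iff:
  "submodule M T \<Longrightarrow> submodule (M\<lparr>carr := T\<rparr>) S \<longleftrightarrow> submodule M S \<and> S \<subseteq> T"
  by (auto simp: submodule_def)

lemma lin_sub: "S \<subseteq> carr M \<Longrightarrow> lin M N f \<Longrightarrow> lin (M\<lparr>carr := S\<rparr>) N f"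
  unfolding lin_def by (simp add: subset_iff)

lemma lin_into_sub: "lin M N f \<Longrightarrow> f ` carr M \<subseteq> S \<Longrightarrow> lin M (N\<lparr>carr := S\<rparr>) f"
  by (auto simp: lin_def)

lemma lin_from_sub: "lin M (N\<lparr>carr := S\<rparr>) f \<Longrightarrow> S \<subseteq> carr N \<Longrightarrow> lin M N f"
  by (auto simp: lin_def)

lemma zero_module_iff: "left_module M \<Longrightarrow> zero_module M \<longleftrightarrow> (\<forall>x\<in>carr M. x = 0)"
  using lm_zero[of M] by (auto simp: zero_module_def)

section \<open>Chain conditions\<close>

text \<open>The measure replaces the dimension over the ground field; it yields both chain conditions.\<close>

definition finite_length :: "('r::ring_1, 'm::ab_group_add) lmod \<Rightarrow> bool" where
  "finite_length M \<longleftrightarrow>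
     (\<exists>\<mu>::'m set \<Rightarrow> nat. \<forall>S T. submodule M S \<and> submodule M T \<and> S \<subset> T \<longrightarrow> \<mu> S < \<mu> T)"

lemma finite_length_sub:
  assumes "finite_length M" "submodule M S"
  shows "finite_length (M\<lparr>carr := S\<rparr>)"
proof -
  obtain \<mu> where "\<And>U T. submodule M U \<Longrightarrow> submodule M T \<Longrightarrow> U \<subset> T \<Longrightarrow> (\<mu> U::nat) < \<mu> T"
    using assms(1) unfolding finite_length_def by blast
  then show ?thesis unfolding finite_length_def
    by (intro exI[of _ \<mu>]) (simp add: submodule_sub_iff[OF assms(2)])
qed

text \<open>The measure of \<open>S\<close> is the sum of a measure of its part in the kernel and
  one of its image. If both parts agree for \<open>S \<subset> T\<close>, an element of
  \<open>T\<close> differs from some element of \<open>S\<close> by an element of the common kernel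
  part, so \<open>S = T\<close>; hence at least one summand grows strictly.\<close>

lemma finite_length_extension:
  assumes M: "left_module M" and g: "lin M N g"
    and K: "finite_length (M\<lparr>carr := Ker M g\<rparr>)" and N: "finite_length N" "left_module N"
  shows "finite_length M"
proof -
  obtain \<mu> where \<mu>: "\<And>S T. submodule (M\<lparr>carr := Ker M g\<rparr>) S \<Longrightarrow> submodule (M\<lparr>carr := Ker M g\<rparr>) T
      \<Longrightarrow> S \<subset> T \<Longrightarrow> (\<mu> S::nat) < \<mu> T"
    using K unfolding finite_length_def by blast
  obtain \<nu> where \<nu>: "\<And>S T. submodule N S \<Longrightarrow> submodule N T \<Longrightarrow> S \<subset> T \<Longrightarrow> (\<nu> S::nat) < \<nu> T"
    using N unfolding finite_length_def by blast
  have sK: "submodule M (Ker M g)" using M N g submodule_Ker by blast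
  have "\<mu> (S \<inter> Ker M g) + \<nu> (g ` S) < \<mu> (T \<inter> Ker M g) + \<nu> (g ` T)"
    if ST: "submodule M S" "submodule M T" "S \<subset> T" for S T
  proof -
    have 1: "submodule (M\<lparr>carr := Ker M g\<rparr>) (S \<inter> Ker M g)"
      "submodule (M\<lparr>carr := Ker M g\<rparr>) (T \<inter> Ker M g)"
      using sK ST by (auto simp: submodule_sub_iff submodule_Int)
    have 2: "submodule N (g ` S)" "submodule N (g ` T)"
      using ST M g by (auto intro: submodule_image)
    have neq: "\<not> (S \<inter> Ker M g = T \<inter> Ker M g \<and> g ` S = g ` T)"
    proof
      assume eq: "S \<inter> Ker M g = T \<inter> Ker M g \<and> g ` S = g ` T"
      obtain x where x: "x \<in> T" "x \<notin> S" using ST by blast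
      then obtain y where y: "y \<in> S" "g y = g x" using eq by (metis imageE imageI)
      have c: "x \<in> carr M" "y \<in> carr M" using x y ST by (auto simp: submodule_def)
      have "x - y \<in> T" using x y ST M submodule_diff by blast
      moreover have "x - y \<in> Ker M g" using c y M g by (auto simp: Ker_def lin_diff lm_diff)
      ultimately have "x - y \<in> S" using eq by blast
      then have "(x - y) + y \<in> S" using y ST(1) unfolding submodule_def by blast
      then show False using x by simp
    qed
    have a: "S \<inter> Ker M g = T \<inter> Ker M g \<or> \<mu> (S \<inter> Ker M g) < \<mu> (T \<inter> Ker M g)"
      using \<mu>[OF 1] ST(3) by blast
    have b: "g ` S = g ` T \<or> \<nu> (g ` S) < \<nu> (g ` T)"
      using \<nu>[OF 2] ST(3) by blast
    show ?thesis using a b neq by (auto simp: add_less_le_mono add_le_less_mono)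
  qed
  then show ?thesis unfolding finite_length_def
    by (intro exI[of _ "\<lambda>S. \<mu> (S \<inter> Ker M g) + \<nu> (g ` S)"]) blast
qed

lemma finite_length_epi:
  assumes M: "left_module M" "finite_length M" and g: "lin M N g" "g ` carr M = carr N"
  shows "finite_length N"
proof -
  obtain \<mu> where \<mu>: "\<And>S T. submodule M S \<Longrightarrow> submodule M T \<Longrightarrow> S \<subset> T \<Longrightarrow> (\<mu> S::nat) < \<mu> T"
    using M unfolding finite_length_def by blast
  have "\<mu> {x \<in> carr M. g x \<in> S} < \<mu> {x \<in> carr M. g x \<in> T}"
    if ST: "submodule N S" "submodule N T" "S \<subset> T" for S T
  proof (rule \<mu>)
    obtain y where y: "y \<in> T" "y \<notin> S" "y \<in> carr N" using ST by (auto simp: submodule_def)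
    then obtain x where "x \<in> carr M" "g x = y" using g by (metis imageE)
    then show "{x \<in> carr M. g x \<in> S} \<subset> {x \<in> carr M. g x \<in> T}" using ST y by blast
  qed (use ST M g submodule_preimage in blast)+
  then show ?thesis unfolding finite_length_def
    by (intro exI[of _ "\<lambda>S. \<mu> {x \<in> carr M. g x \<in> S}"]) blast
qed

text \<open>The kernel of an injective map is zero and has no strict inclusion of submodules, so the
  extension argument applies with an arbitrary measure there.\<close>

lemma finite_length_mono:
  assumes M: "left_module M" and N: "left_module N" "finite_length N"
    and g: "lin M N g" "inj_on g (carr M)"
  shows "finite_length M"
proof -
  have "Ker M g = {0}"
    using M g lin_injD[of M N g] lin_0[of M N g] lm_zero[of M] by (auto simp: Ker_def)
  then have "\<not> (submodule (M\<lparr>carr := Ker M g\<rparr>) S \<and> submodule (M\<lparr>carr := Ker M g\<rparr>) T \<and> S \<subset> T)"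
    for S T
    unfolding submodule_def by auto
  then have "finite_length (M\<lparr>carr := Ker M g\<rparr>)" unfolding finite_length_def by blast
  then show ?thesis using finite_length_extension M N g by blast
qed

lemma finite_length_minimal:
  assumes "finite_length M" "submodule M S" "Q S"
  obtains T where "submodule M T" "Q T" "\<And>U. submodule M U \<Longrightarrow> Q U \<Longrightarrow> U \<subseteq> T \<Longrightarrow> U = T"
proof -
  obtain \<mu> where \<mu>: "\<And>S T. submodule M S \<Longrightarrow> submodule M T \<Longrightarrow> S \<subset> T \<Longrightarrow> (\<mu> S::nat) < \<mu> T"
    using assms unfolding finite_length_def by blast
  define T where "T = arg_min \<mu> (\<lambda>T. submodule M T \<and> Q T)"
  have T: "submodule M T \<and> Q T" and le: "\<And>U. submodule M U \<and> Q U \<Longrightarrow> \<mu> T \<le> \<mu> U"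
    unfolding T_def using arg_min_nat_lemma[of "\<lambda>T. submodule M T \<and> Q T" S \<mu>] assms by auto
  show thesis using T le \<mu> that by (meson leD psubsetI)
qed

lemma finite_length_maximal:
  assumes M: "left_module M" "finite_length M" and S: "submodule M S" "Q S"
  obtains T where "submodule M T" "Q T" "\<And>U. submodule M U \<Longrightarrow> Q U \<Longrightarrow> T \<subseteq> U \<Longrightarrow> U = T"
proof -
  obtain \<mu> where \<mu>: "\<And>S T. submodule M S \<Longrightarrow> submodule M T \<Longrightarrow> S \<subset> T \<Longrightarrow> (\<mu> S::nat) < \<mu> T"
    using M unfolding finite_length_def by blast
  define b where "b = \<mu> (carr M)"
  have bd: "\<mu> U \<le> b" if "submodule M U" for U
  proof (cases "U = carr M")
    case False
    then have "U \<subset> carr M" using that by (auto simp: submodule_def)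
    then show ?thesis using \<mu>[OF that submodule_carr[OF M(1)]] b_def by simp
  qed (simp add: b_def)
  \<comment> \<open>Every measure is at most \<open>b\<close>, so minimising
    \<open>b - \<mu> U\<close> maximises \<open>\<mu> U\<close>; truncated subtraction loses
    nothing.\<close>
  define T where "T = arg_min (\<lambda>U. b - \<mu> U) (\<lambda>T. submodule M T \<and> Q T)"
  have T: "submodule M T \<and> Q T" and le: "\<And>U. submodule M U \<and> Q U \<Longrightarrow> b - \<mu> T \<le> b - \<mu> U"
    unfolding T_def using arg_min_nat_lemma[of "\<lambda>T. submodule M T \<and> Q T" S "\<lambda>U. b - \<mu> U"] S by auto
  have "U = T" if U: "submodule M U" "Q U" "T \<subseteq> U" for U
  proof (rule ccontr)
    assume "U \<noteq> T"
    then have "\<mu> T < \<mu> U" using U T \<mu> by blast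
    then show False using le[of U] bd[of U] U by auto
  qed
  then show thesis using T that by blast
qed

text \<open>A maximal member among the submodules generated by finite sets must be everything:
  adjoining one more element would produce a larger one.\<close>

lemma finite_length_finitely_generated:
  assumes M: "left_module M" "finite_length M"
  shows "finitely_generated M"
proof -
  define gen where "gen B = \<Inter>{S. submodule M S \<and> B \<subseteq> S}" for B
  have gen: "submodule M (gen B)" "B \<subseteq> gen B" if "B \<subseteq> carr M" for B
    unfolding gen_def using that submodule_carr[OF M(1)] by (auto intro!: submodule_Inter)
  have "submodule M (gen {})" by (simp add: gen)
  then obtain T where T: "submodule M T" "\<exists>B\<subseteq>carr M. finite B \<and> T = gen B"
    and max: "\<And>U. submodule M U \<Longrightarrow> (\<exists>B\<subseteq>carr M. finite B \<and> U = gen B) \<Longrightarrow> T \<subseteq> U \<Longrightarrow> U = T"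
    using finite_length_maximal[OF M, of "gen {}" "\<lambda>T. \<exists>B\<subseteq>carr M. finite B \<and> T = gen B"]
    by (metis empty_subsetI finite.emptyI)
  obtain B where B: "B \<subseteq> carr M" "finite B" "T = gen B" using T by blast
  have "T = carr M"
  proof (rule ccontr)
    assume "T \<noteq> carr M"
    then obtain x where x: "x \<in> carr M" "x \<notin> T" using T(1) by (auto simp: submodule_def)
    have i: "insert x B \<subseteq> carr M" using B x by blast
    have "T \<subseteq> gen (insert x B)" unfolding B(3) gen_def by (rule Inter_anti_mono) blast
    moreover have "\<exists>B'\<subseteq>carr M. finite B' \<and> gen (insert x B) = gen B'"
      using i B(2) by blast
    ultimately have "gen (insert x B) = T" using gen(1)[OF i] by (intro max)
    then show False using gen(2)[of "insert x B"] B x by auto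
  qed
  then have "\<forall>S. submodule M S \<and> B \<subseteq> S \<longrightarrow> S = carr M"
    using B by (auto simp: gen_def submodule_def)
  then show ?thesis unfolding finitely_generated_def using B by blast
qed

text \<open>The kernels of the powers of \<open>f\<close> become stationary at some
  \<open>n\<close>. An element of \<open>Ker f\<close> has the form \<open>f^n y\<close> by
  surjectivity, so \<open>y\<close> lies in the kernel of \<open>f^(n+1)\<close>, which is that of
  \<open>f^n\<close>; the element is therefore zero.\<close>

lemma finite_length_surj_inj:
  assumes M: "left_module M" "finite_length M" and f: "lin M M f" "f ` carr M = carr M"
  shows "inj_on f (carr M)"
proof -
  have "submodule M (Ker M (f ^^ 0))" using M f lin_funpow submodule_Ker by blast
  then obtain n where
    max: "\<And>m. Ker M (f ^^ n) \<subseteq> Ker M (f ^^ m) \<Longrightarrow> Ker M (f ^^ m) = Ker M (f ^^ n)"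
    using finite_length_maximal[OF M, of "Ker M (f ^^ 0)" "\<lambda>T. \<exists>n. T = Ker M (f ^^ n)"]
      lin_funpow[OF f(1)] submodule_Ker[OF M(1) M(1)] by (metis (no_types, lifting))
  have "Ker M (f ^^ n) \<subseteq> Ker M (f ^^ Suc n)" using lin_0[OF M(1) f(1)] by (auto simp: Ker_def)
  then have eq: "Ker M (f ^^ Suc n) = Ker M (f ^^ n)" by (rule max)
  have surj: "(f ^^ n) ` carr M = carr M"
  proof (induction n)
    case (Suc n)
    have "(f ^^ Suc n) ` carr M = f ` (f ^^ n) ` carr M" by (simp add: image_comp)
    then show ?case using Suc f(2) by simp
  qed simp
  show ?thesis
  proof (rule lin_injI[OF M(1) f(1)])
    fix x assume x: "x \<in> carr M" "f x = 0"
    then obtain y where y: "y \<in> carr M" "(f ^^ n) y = x" using surj by (metis imageE)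
    then have "y \<in> Ker M (f ^^ Suc n)" using x by (auto simp: Ker_def)
    then show "x = 0" using eq y by (auto simp: Ker_def)
  qed
qed

text \<open>\<open>Ker f^(2n) = Ker f^n\<close> makes the kernel and the image of \<open>f^n\<close>
  intersect trivially; equality of the images of \<open>f^(2n)\<close> and \<open>f^n\<close> allows
  every \<open>x\<close> to be moved into the kernel by subtracting an element of the image.\<close>

lemma finite_length_Fitting:
  assumes M: "left_module M" "finite_length M" and f: "lin M M f"
  obtains n where "n > 0" "\<And>x. x \<in> carr M \<Longrightarrow> \<exists>y z. y \<in> Ker M (f ^^ n) \<and> z \<in> (f ^^ n) ` carr M \<and>
    x = y + z"
    "Ker M (f ^^ n) \<inter> (f ^^ n) ` carr M = {0}"
proof -
  have lf: "lin M M (f ^^ n)" for n by (rule lin_funpow[OF f])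
  have sK: "submodule M (Ker M (f ^^ n))" for n using M lf submodule_Ker by blast
  have sI: "submodule M ((f ^^ n) ` carr M)" for n
    using M(1) lf submodule_image submodule_carr by blast
  obtain a where "\<And>m. Ker M (f ^^ a) \<subseteq> Ker M (f ^^ m) \<Longrightarrow> Ker M (f ^^ m) = Ker M (f ^^ a)"
    using finite_length_maximal[OF M, of "Ker M (f ^^ 0)" "\<lambda>T. \<exists>n. T = Ker M (f ^^ n)"] sK
    by (metis (no_types, lifting))
  moreover have Kmono: "Ker M (f ^^ m) \<subseteq> Ker M (f ^^ (m + d))" for m d
    using lin_0[OF M(1) f] by (induction d) (auto simp: Ker_def)
  ultimately have a: "Ker M (f ^^ (a + d)) = Ker M (f ^^ a)" for d by blast
  obtain b where "\<And>m. (f ^^ m) ` carr M \<subseteq> (f ^^ b) ` carr M \<Longrightarrow> (f ^^ m) ` carr M = (f ^^ b) ` carr M"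
    using finite_length_minimal[OF M(2), of "(f ^^ 0) ` carr M" "\<lambda>T. \<exists>n. T = (f ^^ n) ` carr M"] sI
    by (metis (no_types, lifting))
  moreover have "(f ^^ (m + d)) ` carr M \<subseteq> (f ^^ m) ` carr M" for m d
    using lin_closed[OF lf] by (auto simp: funpow_add)
  ultimately have b: "(f ^^ (b + d)) ` carr M = (f ^^ b) ` carr M" for d by blast
  \<comment> \<open>This lies past both stationary points \<open>a\<close> and \<open>b\<close>; the
    successor makes \<open>n\<close> positive, so that one factor \<open>f\<close> can later be
    split off from \<open>f ^^ n\<close>.\<close>
  define n where "n = Suc (a + b)"
  have K2: "Ker M (f ^^ (n + n)) = Ker M (f ^^ n)"
    using a[of "Suc b"] a[of "Suc b + n"] by (simp add: n_def add_ac)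
  have I2: "(f ^^ (n + n)) ` carr M = (f ^^ n) ` carr M"
    using b[of "Suc a"] b[of "Suc a + n"] by (simp add: n_def add_ac)
  show thesis
  proof
    show "n > 0" by (simp add: n_def)
    show "Ker M (f ^^ n) \<inter> (f ^^ n) ` carr M = {0}"
    proof -
      have "x = 0" if x: "x \<in> Ker M (f ^^ n)" "x \<in> (f ^^ n) ` carr M" for x
      proof -
        obtain y where y: "y \<in> carr M" "x = (f ^^ n) y" using x by blast
        then have "y \<in> Ker M (f ^^ (n + n))" using x by (auto simp: Ker_def funpow_add)
        then show ?thesis using K2 y by (auto simp: Ker_def)
      qed
      then show ?thesis using sK[of n] sI[of n] by (auto simp: submodule_def)
    qed
    fix x assume x: "x \<in> carr M"
    then have "(f ^^ n) x \<in> (f ^^ (n + n)) ` carr M" using I2 by blast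
    then obtain y where y: "y \<in> carr M" "(f ^^ n) x = (f ^^ n) ((f ^^ n) y)"
      by (auto simp: funpow_add)
    then have "x - (f ^^ n) y \<in> Ker M (f ^^ n)"
      using x M lf[of n] by (auto simp: Ker_def lin_diff lin_closed lm_diff)
    then show "\<exists>y z. y \<in> Ker M (f ^^ n) \<and> z \<in> (f ^^ n) ` carr M \<and> x = y + z"
      using y by (intro exI[of _ "x - (f ^^ n) y"] exI[of _ "(f ^^ n) y"]) auto
  qed
qed

section \<open>Direct sums and retracts\<close>

text \<open>Interleaving identifies pairs of sequences with sequences, so that direct sums stay inside
  the ambient group.\<close>

definition vpair :: "(nat \<Rightarrow> 'k) \<Rightarrow> (nat \<Rightarrow> 'k) \<Rightarrow> nat \<Rightarrow> 'k" where
  "vpair a b = (\<lambda>n. if even n then a (n div 2) else b (n div 2))"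

definition vfst :: "(nat \<Rightarrow> 'k) \<Rightarrow> nat \<Rightarrow> 'k" where "vfst x = (\<lambda>n. x (2 * n))"

definition vsnd :: "(nat \<Rightarrow> 'k) \<Rightarrow> nat \<Rightarrow> 'k" where "vsnd x = (\<lambda>n. x (Suc (2 * n)))"

lemma vpair_simps [simp]:
  "vfst (vpair a b) = a" "vsnd (vpair a b) = b" "vpair (vfst x) (vsnd x) = x"
  by (auto simp: vpair_def vfst_def vsnd_def fun_eq_iff)

lemma vpair_add [simp]:
  fixes x y :: "nat \<Rightarrow> 'k::field"
  shows "vfst (x + y) = vfst x + vfst y" "vsnd (x + y) = vsnd x + vsnd y"
    "vfst 0 = 0" "vsnd 0 = 0"
    "vpair (a + b) (c + d) = vpair a c + (vpair b d :: nat \<Rightarrow> 'k)"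
    "vpair 0 0 = (0 :: nat \<Rightarrow> 'k)"
  by (auto simp: vpair_def vfst_def vsnd_def fun_eq_iff)

lemma vpair_eq_0_iff [simp]:
  fixes a b :: "nat \<Rightarrow> 'k::field"
  shows "vpair a b = 0 \<longleftrightarrow> a = 0 \<and> b = 0"
  by (metis vpair_simps(1,2) vpair_add(3,4,6))

lemma vpair_eqI: "vfst x = vfst y \<Longrightarrow> vsnd x = vsnd y \<Longrightarrow> x = y"
  by (metis vpair_simps(3))

definition ds :: "('r::ring_1, 'k::field) rmod \<Rightarrow> ('r, 'k) rmod \<Rightarrow> ('r, 'k) rmod" where
  "ds A B = \<lparr>carr = {x. vfst x \<in> carr A \<and> vsnd x \<in> carr B},
             act = (\<lambda>r x. vpair (act A r (vfst x)) (act B r (vsnd x)))\<rparr>"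

lemma ds_simps [simp]:
  "x \<in> carr (ds A B) \<longleftrightarrow> vfst x \<in> carr A \<and> vsnd x \<in> carr B"
  "act (ds A B) r x = vpair (act A r (vfst x)) (act B r (vsnd x))"
  by (simp_all add: ds_def)

lemma left_module_ds:
  assumes "left_module A" "left_module B"
  shows "left_module (ds A B)"
  unfolding left_module_def using assms by (simp add: lmD)

lemma lin_vfst: "lin (ds A B) A vfst" and lin_vsnd: "lin (ds A B) B vsnd"
  by (auto simp: lin_def)

lemma lin_vpair: "lin M A f \<Longrightarrow> lin M B g \<Longrightarrow> lin M (ds A B) (\<lambda>x. vpair (f x) (g x))"
  by (auto simp: lin_def)

lemma lin_inl: "left_module B \<Longrightarrow> lin A (ds A B) (\<lambda>x. vpair x 0)"
  and lin_inr: "left_module A \<Longrightarrow> lin B (ds A B) (\<lambda>x. vpair 0 x)"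
  by (auto intro!: lin_vpair lin_ident lin_zero)

lemma lin_copair:
  "left_module M \<Longrightarrow> lin A M f \<Longrightarrow> lin B M g \<Longrightarrow> lin (ds A B) M (\<lambda>x. f (vfst x) + g (vsnd x))"
  by (intro lin_plus lin_comp[OF lin_vfst] lin_comp[OF lin_vsnd]) auto

text \<open>The bridge to the given notions: \<open>direct_summand\<close>,
  \<open>indecomposable\<close> and \<open>IT_relations\<close> speak of sums carried by pairs,
  while all constructions use the interleaved sum, which is again an \<open>rmod\<close>.\<close>

lemma mod_iso_direct_sum:
  fixes A B C :: "('r::ring_1, 'k::field) rmod"
  assumes C: "left_module C"
  shows "C \<cong>\<^sub>R A \<oplus>\<^sub>R B \<longleftrightarrow> C \<cong>\<^sub>R ds A B"
proof
  assume "C \<cong>\<^sub>R A \<oplus>\<^sub>R B"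
  then obtain f where f: "f \<in> Hom C (A \<oplus>\<^sub>R B)" "bij_betw f (carr C) (carr A \<times> carr B)"
    by (auto simp: mod_iso_def direct_sum_def)
  have "bij_betw (\<lambda>y. vpair (fst y) (snd y)) (carr A \<times> carr B) (carr (ds A B))"
    by (rule bij_betw_byWitness[where f' = "\<lambda>x. (vfst x, vsnd x)"]) auto
  with f(2) have "bij_betw (\<lambda>x. vpair (fst (f x)) (snd (f x))) (carr C) (carr (ds A B))"
    using bij_betw_trans unfolding comp_def by blast
  moreover have "lin C (ds A B) (\<lambda>x. vpair (fst (f x)) (snd (f x)))"
    using f(1) by (fastforce simp: lin_def Hom_def direct_sum_def split: prod.splits)
  ultimately show "C \<cong>\<^sub>R ds A B" using mod_iso_iff[OF C] by blast
next
  assume "C \<cong>\<^sub>R ds A B"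
  then obtain f where f: "lin C (ds A B) f" "bij_betw f (carr C) (carr (ds A B))"
    using mod_iso_iff[OF C] by blast
  let ?g = "\<lambda>x. (vfst (f x), vsnd (f x))"
  have "bij_betw (\<lambda>x. (vfst x, vsnd x)) (carr (ds A B)) (carr A \<times> carr B)"
    by (rule bij_betw_byWitness[where f' = "\<lambda>y. vpair (fst y) (snd y)"]) auto
  with f(2) have "bij_betw ?g (carr C) (carr A \<times> carr B)"
    using bij_betw_trans unfolding comp_def by blast
  moreover have "restrict ?g (carr C) \<in> Hom C (A \<oplus>\<^sub>R B)"
    using f(1) lm_add[OF C] lm_act[OF C] by (auto simp: lin_def Hom_def direct_sum_def)
  ultimately show "C \<cong>\<^sub>R A \<oplus>\<^sub>R B"
    unfolding mod_iso_def by (intro bexI[of _ "restrict ?g (carr C)"])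
      (auto simp: direct_sum_def bij_betw_restrict_eq)
qed

lemma ds_cong:
  fixes A A' B B' :: "('r::ring_1, 'k::field) rmod"
  assumes "left_module A" "left_module B" "A \<cong>\<^sub>R A'" "B \<cong>\<^sub>R B'" "left_module A'" "left_module B'"
  shows "ds A B \<cong>\<^sub>R ds A' B'"
proof -
  obtain f g where 1: "lin A A' f" "lin A' A g" "\<And>x. x \<in> carr A \<Longrightarrow> g (f x) = x"
    "\<And>y. y \<in> carr A' \<Longrightarrow> f (g y) = y"
    using mod_isoE[OF assms(3,1)] by metis
  obtain h k where 2: "lin B B' h" "lin B' B k" "\<And>x. x \<in> carr B \<Longrightarrow> k (h x) = x"
    "\<And>y. y \<in> carr B' \<Longrightarrow> h (k y) = y"
    using mod_isoE[OF assms(4,2)] by metis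
  show ?thesis
    using left_module_ds[OF assms(1,2)]
    by (rule mod_isoI_inverse[where f = "\<lambda>x. vpair (f (vfst x)) (h (vsnd x))"
        and g = "\<lambda>x. vpair (g (vfst x)) (k (vsnd x))"])
      (use 1 2 in \<open>auto intro!: lin_vpair intro: lin_comp[OF lin_vfst] lin_comp[OF lin_vsnd]\<close>)
qed

lemma ds_commute: "left_module A \<Longrightarrow> left_module B \<Longrightarrow> ds A B \<cong>\<^sub>R ds B A"
  by (rule mod_isoI_inverse[where f = "\<lambda>x. vpair (vsnd x) (vfst x)" and g =
    "\<lambda>x. vpair (vsnd x) (vfst x)"])
    (auto intro!: left_module_ds lin_vpair lin_vfst lin_vsnd)

lemma ds_assoc:
  assumes "left_module A" "left_module B" "left_module C"
  shows "ds (ds A B) C \<cong>\<^sub>R ds A (ds B C)"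
  by (rule mod_isoI_inverse[where f = "\<lambda>x. vpair (vfst (vfst x)) (vpair (vsnd (vfst x)) (vsnd x))"
      and g = "\<lambda>x. vpair (vpair (vfst x) (vfst (vsnd x))) (vsnd (vsnd x))"])
    (use assms in \<open>auto intro!: left_module_ds simp: lin_def\<close>)

lemma ds_exchange:
  assumes "left_module A" "left_module B" "left_module C" "left_module D"
  shows "ds (ds A B) (ds C D) \<cong>\<^sub>R ds (ds A C) (ds B D)"
proof (rule mod_isoI_inverse)
  let ?f = "\<lambda>x. vpair (vpair (vfst (vfst x)) (vfst (vsnd x))) (vpair (vsnd (vfst x)) (vsnd (vsnd
    x)))"
  show "lin (ds (ds A B) (ds C D)) (ds (ds A C) (ds B D)) ?f"
    "lin (ds (ds A C) (ds B D)) (ds (ds A B) (ds C D)) ?f"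
    by (auto simp: lin_def)
qed (use assms in \<open>auto intro!: left_module_ds\<close>)

lemma ds_zero:
  assumes "left_module A" "left_module Z" "zero_module Z"
  shows "ds A Z \<cong>\<^sub>R A"
proof (rule mod_isoI[OF left_module_ds[OF assms(1,2)] lin_vfst])
  fix x assume "x \<in> carr (ds A Z)" "vfst x = 0"
  then have "vfst x = vfst 0" "vsnd x = vsnd 0" using assms(3) by (auto simp: zero_module_def)
  then show "x = 0" by (rule vpair_eqI)
next
  fix y assume "y \<in> carr A"
  then show "\<exists>x\<in>carr (ds A Z). vfst x = y"
    using lm_zero[OF assms(2)] by (intro bexI[of _ "vpair y 0"]) auto
qed

definition zero_mod :: "('r::ring_1, 'k::field) rmod" where
  "zero_mod = \<lparr>carr = {0}, act = (\<lambda>r x. 0)\<rparr>"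

lemma zero_mod: "left_module zero_mod" "zero_module zero_mod"
  by (auto simp: zero_mod_def left_module_def zero_module_def)

lemma finite_length_zero: "zero_module M \<Longrightarrow> finite_length M"
  unfolding finite_length_def zero_module_def submodule_def
  by (intro exI[of _ "\<lambda>_. 0"]) (metis psubsetE empty_subsetI insert_subset subset_antisym)

fun pow_mod :: "('r::ring_1, 'k::field) rmod \<Rightarrow> nat \<Rightarrow> ('r, 'k) rmod" where
  "pow_mod M 0 = zero_mod"
| "pow_mod M (Suc n) = ds M (pow_mod M n)"

lemma mod_R_left_module: "M \<in> mod_R \<Longrightarrow> left_module M"
  by (simp add: mod_R_def)

section \<open>Projective modules\<close>

lemma projectiveI:
  fixes P :: "('r::ring_1, 'k::field) rmod"
  assumes "P \<in> mod_R"
    and "\<And>(M :: ('r, 'k) rmod) (N :: ('r, 'k) rmod) g f. M \<in> mod_R \<Longrightarrow> N \<in> mod_R \<Longrightarrow> lin M N g \<Longrightarrow>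
      g ` carr M = carr N \<Longrightarrow> lin P N f \<Longrightarrow>
      \<exists>h. lin P M h \<and> (\<forall>x\<in>carr P. g (h x) = f x)"
  shows "projective P"
  unfolding projective_def
proof (intro conjI allI impI ballI)
  fix M N :: "('r, 'k) rmod" and g f
  assume "M \<in> mod_R \<and> N \<in> mod_R" "g \<in> Hom M N" "f \<in> Hom P N" "g ` carr M = carr N"
  then obtain h where "lin P M h" "\<forall>x\<in>carr P. g (h x) = f x"
    using assms(2)[of M N g f] Hom_lin by blast
  then show "\<exists>h\<in>Hom P M. \<forall>x\<in>carr P. g (h x) = f x"
    using lin_restrict[of P M h] mod_R_left_module[OF assms(1)]
    by (intro bexI[of _ "restrict h (carr P)"]) auto
qed (rule assms(1))

lemma projective_mod_R: "projective P \<Longrightarrow> P \<in> mod_R"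
  by (simp add: projective_def)

lemma projective_lift:
  fixes P M N :: "('r::ring_1, 'k::field) rmod"
  assumes "projective P" "M \<in> mod_R" "N \<in> mod_R" "lin M N g" "g ` carr M = carr N" "lin P N f"
  obtains h where "lin P M h" "\<And>x. x \<in> carr P \<Longrightarrow> g (h x) = f x"
proof -
  have lm: "left_module P" "left_module M" using assms projective_mod_R mod_R_left_module by auto
  have "restrict g (carr M) \<in> Hom M N" "restrict f (carr P) \<in> Hom P N"
    using lm assms by (auto intro: lin_restrict)
  moreover have "restrict g (carr M) ` carr M = carr N" using assms(5) by simp
  ultimately obtain h where h: "h \<in> Hom P M"
    "\<forall>x\<in>carr P. restrict g (carr M) (h x) = restrict f (carr P) x"
    using assms(1-3) unfolding projective_def by blast
  then have "lin P M h" using Hom_lin by blast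
  moreover have "g (h x) = f x" if "x \<in> carr P" for x
    using h(2) that lin_closed[OF \<open>lin P M h\<close>] by auto
  ultimately show thesis using that by blast
qed

text \<open>The categorical form of a direct summand. It is transitive and passes along isomorphisms
  without carrying complements; a complement is recovered as a kernel when one is required.\<close>

definition retract :: "('r::ring_1, 'k::field) rmod \<Rightarrow> ('r, 'k) rmod \<Rightarrow> bool" where
  "retract N M \<longleftrightarrow> N \<in> mod_R \<and> M \<in> mod_R \<and>
     (\<exists>i p. lin N M i \<and> lin M N p \<and> (\<forall>x\<in>carr N. p (i x) = x))"

lemma retractI:
  "N \<in> mod_R \<Longrightarrow> M \<in> mod_R \<Longrightarrow> lin N M i \<Longrightarrow> lin M N p \<Longrightarrow> (\<And>x. x \<in> carr N \<Longrightarrow> p (i x) = x) \<Longrightarrow> retract N M"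
  by (auto simp: retract_def)

lemma retract_trans:
  assumes "retract N M" "retract M L" shows "retract N L"
proof -
  obtain i p where 1: "lin N M i" "lin M N p" "\<forall>x\<in>carr N. p (i x) = x"
    using assms(1) by (auto simp: retract_def)
  obtain j q where 2: "lin M L j" "lin L M q" "\<forall>x\<in>carr M. q (j x) = x"
    using assms(2) by (auto simp: retract_def)
  have "lin N L (\<lambda>x. j (i x))" "lin L N (\<lambda>x. p (q x))" using 1 2 lin_comp by blast+
  then show ?thesis
    by (rule retractI[rotated 2]) (use 1 2 assms in \<open>auto simp: retract_def lin_closed\<close>)
qed

lemma retract_iso: "N \<in> mod_R \<Longrightarrow> N \<cong>\<^sub>R M \<Longrightarrow> M \<in> mod_R \<Longrightarrow> retract N M"
  using mod_isoE[of N M] mod_R_left_module retractI by metis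

lemma retract_refl: "M \<in> mod_R \<Longrightarrow> retract M M"
  by (auto intro: retractI lin_ident)

lemma projective_retract:
  assumes "retract N P" "projective P" shows "projective N"
proof (rule projectiveI)
  obtain i p where ip: "lin N P i" "lin P N p" "\<forall>x\<in>carr N. p (i x) = x"
    using assms(1) by (auto simp: retract_def)
  show "N \<in> mod_R" using assms by (auto simp: retract_def)
  fix A B g f assume *: "A \<in> mod_R" "B \<in> mod_R" "lin A B g" "g ` carr A = carr B" "lin N B f"
  then obtain h where "lin P A h" "\<And>x. x \<in> carr P \<Longrightarrow> g (h x) = f (p x)"
    using projective_lift[OF assms(2) *(1-4) lin_comp[OF ip(2) *(5)]] by metis
  then show "\<exists>h. lin N A h \<and> (\<forall>x\<in>carr N. g (h x) = f x)"
    using ip lin_comp[of N P i A h] by (intro exI[of _ "\<lambda>x. h (i x)"]) (auto simp: lin_closed)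
qed

lemma projective_iso:
  fixes P Q :: "('r::ring_1, 'k::field) rmod"
  shows "projective P \<Longrightarrow> P \<cong>\<^sub>R Q \<Longrightarrow> Q \<in> mod_R \<Longrightarrow> projective Q"
  using projective_retract[of Q P] retract_iso[of Q P] mod_iso_sym projective_mod_R
    mod_R_left_module by blast

text \<open>Membership of the sum in \<open>mod_R\<close> is a hypothesis here, because closure of
  \<open>mod_R\<close> under sums rests on finite length, which is itself obtained from projective
  modules built as such sums.\<close>

lemma projective_ds_mod_R:
  assumes "projective P" "projective Q" "ds P Q \<in> mod_R" shows "projective (ds P Q)"
proof (rule projectiveI[OF assms(3)])
  fix A B g f assume *: "A \<in> mod_R" "B \<in> mod_R" "lin A B g" "g ` carr A = carr B" "lin (ds P Q) B f"
  have lm: "left_module P" "left_module Q" "left_module A"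
    using assms * projective_mod_R mod_R_left_module by blast+
  obtain h where h: "lin P A h" "\<And>x. x \<in> carr P \<Longrightarrow> g (h x) = f (vpair x 0)"
    using projective_lift[OF assms(1) *(1-4) lin_comp[OF lin_inl[OF lm(2)] *(5)]] by metis
  obtain k where k: "lin Q A k" "\<And>x. x \<in> carr Q \<Longrightarrow> g (k x) = f (vpair 0 x)"
    using projective_lift[OF assms(2) *(1-4) lin_comp[OF lin_inr[OF lm(1)] *(5)]] by metis
  have "g (h (vfst x) + k (vsnd x)) = f x" if x: "x \<in> carr (ds P Q)" for x
  proof -
    have "f (vpair (vfst x) 0 + vpair 0 (vsnd x)) = f (vpair (vfst x) 0) + f (vpair 0 (vsnd x))"
      using x lm by (intro lin_add[OF *(5)]) (auto simp: lm_zero)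
    then show ?thesis
      using x h k *(3) by (simp add: lin_add lin_closed flip: vpair_add(5))
  qed
  then show "\<exists>h. lin (ds P Q) A h \<and> (\<forall>x\<in>carr (ds P Q). g (h x) = f x)"
    using lin_copair[OF lm(3) h(1) k(1)] by blast
qed

lemma projective_zero:
  assumes "M \<in> mod_R" "zero_module M" shows "projective M"
proof (rule projectiveI[OF assms(1)])
  fix A B g f assume *: "A \<in> mod_R" "B \<in> mod_R" "lin A B g" "g ` carr A = carr B" "lin M B f"
  then show "\<exists>h. lin M A h \<and> (\<forall>x\<in>carr M. g (h x) = f x)"
    using assms lin_zero[of A M] lin_0[of M B f] lin_0[of A B g]
    by (intro exI[of _ "\<lambda>x. 0"]) (auto simp: zero_module_def mod_R_left_module)
qed

section \<open>Finitely generated modules over a finite dimensional algebra\<close>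

context finite_dimensional_algebra
begin

text \<open>\<open>F\<close> is the ring as a left module over itself, transported into
  \<open>nat \<Rightarrow> 'k\<close> by coordinates with respect to a finite basis;
  \<open>e\<close> corresponds to \<open>1\<close>. The last two properties say that homomorphisms
  out of \<open>F\<close> correspond to elements of the target.\<close>

lemma regular_module:
  obtains F :: "('r, 'k) rmod" and e :: "nat \<Rightarrow> 'k" where "left_module F" "finite_length F"
    "e \<in> carr F"
    "\<And>(M :: ('r, 'k) rmod) x. left_module M \<Longrightarrow> x \<in> carr M \<Longrightarrow> \<exists>f. lin F M f \<and> f e = x"
    "\<And>(M :: ('r, 'k) rmod) f g. lin F M f \<Longrightarrow> lin F M g \<Longrightarrow> f e = g e \<Longrightarrow> \<forall>x\<in>carr F. f x = g x"
proof -
  obtain A where A: "finite A" "span A = UNIV" using finite_dimensional by blast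
  obtain B where B: "B \<subseteq> A" "independent B" "A \<subseteq> span B"
    using maximal_independent_subset[of A] by blast
  have sB: "span B = UNIV" using A B span_mono span_span by (metis top.extremum_uniqueI)
  have fB: "finite B" using A B finite_subset by blast
  interpret fd: finite_dimensional_vector_space scale B
    using fB B sB by unfold_locales auto
  obtain h where h: "bij_betw h {..<card B} B"
    using ex_bij_betw_nat_finite[OF fB] atLeast0LessThan by auto
  define c where "c v = (\<lambda>n. if n < card B then representation B v (h n) else 0)" for v
  have cadd: "c (v + w) = c v + c w" for v w
    using B sB by (auto simp: c_def fun_eq_iff representation_add)
  have cinj: "v = w" if "c v = c w" for v w
  proof -
    have "representation B v b = representation B w b" if "b \<in> B" for b
    proof -
      obtain n where "n < card B" "b = h n" using h \<open>b \<in> B\<close> by (auto simp: bij_betw_def)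
      then show ?thesis using fun_cong[OF \<open>c v = c w\<close>, of n] by (simp add: c_def)
    qed
    moreover have "v = (\<Sum>b\<in>B. scale (representation B v b) b)" for v
      using sum_representation_eq[OF B(2) _ fB subset_refl, of v] sB by simp
    ultimately show ?thesis by (metis (no_types, lifting) sum.cong)
  qed
  define d where "d = inv_into UNIV c"
  have dc [simp]: "d (c v) = v" for v unfolding d_def using cinj by (simp add: inj_def)
  have c0 [simp]: "c 0 = 0" using cadd[of 0 0] by simp
  define F :: "('r, 'k) rmod" where "F = \<lparr>carr = range c, act = (\<lambda>r x. c (r * d x))\<rparr>"
  have lF: "left_module F"
    unfolding left_module_def F_def
    by (auto simp: algebra_simps simp flip: cadd intro: rev_image_eqI[where x = 0])
  have "dim {v. c v \<in> S} < dim {v. c v \<in> T}" if ST: "submodule F S" "submodule F T" "S \<subset> T" for S T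
  proof -
    have sub: "subspace {v. c v \<in> S}" if "submodule F S" for S
      unfolding subspace_def
    proof (intro conjI ballI allI)
      fix a v assume "v \<in> {v. c v \<in> S}"
      \<comment> \<open>Acting by \<open>scale a 1\<close> is multiplication by the scalar
        \<open>a\<close>, so submodules pull back to linear subspaces and a strict inclusion raises
        the dimension.\<close>
      then have "act F (scale a 1) (c v) \<in> S" using that by (auto simp: submodule_def)
      then show "scale a v \<in> {v. c v \<in> S}" by (simp add: F_def scale_mult_left)
    qed (use that in \<open>auto simp: submodule_def cadd\<close>)
    have "{v. c v \<in> S} \<subset> {v. c v \<in> T}" using ST by (auto simp: submodule_def F_def)
    then show ?thesis
      using fd.subspace_dim_equal[OF sub[OF ST(1)] sub[OF ST(2)]] by auto
  qed
  then have "finite_length F" unfolding finite_length_def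
    by (intro exI[of _ "\<lambda>S. dim {v. c v \<in> S}"]) blast
  moreover have "\<exists>f. lin F M f \<and> f (c 1) = x" if "left_module M" "x \<in> carr M" for M ::
    "('r, 'k) rmod" and x
    using that by (intro exI[of _ "\<lambda>y. act M (d y) x"])
      (auto simp: lin_def F_def lm_act act_radd act_mult act_one simp flip: cadd)
  moreover have "\<forall>x\<in>carr F. f x = g x" if "lin F M f" "lin F M g" "f (c 1) = g (c 1)" for M ::
    "('r, 'k) rmod" and f g
  proof
    fix x assume "x \<in> carr F"
    then have "x = act F (d x) (c 1)" "c 1 \<in> carr F" by (auto simp: F_def)
    then show "f x = g x" using that lin_act by metis
  qed
  moreover have "c 1 \<in> carr F" by (simp add: F_def)
  ultimately show thesis using that lF by blast
qed

lemma finite_length_ds: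
  fixes A B :: "('r, 'k) rmod"
  assumes "left_module A" "finite_length A" "left_module B" "finite_length B"
  shows "finite_length (ds A B)"
proof (rule finite_length_extension[OF left_module_ds[OF assms(1,3)] lin_vfst _ assms(2,1)])
  have "submodule (ds A B) (Ker (ds A B) vfst)"
    using assms by (intro submodule_Ker[OF _ _ lin_vfst]) (auto intro: left_module_ds)
  then have l: "left_module (ds A B\<lparr>carr := Ker (ds A B) vfst\<rparr>)"
    using assms by (intro submodule_left_module left_module_ds)
  have g: "lin (ds A B\<lparr>carr := Ker (ds A B) vfst\<rparr>) B vsnd"
    by (auto simp: lin_def Ker_def)
  have "inj_on vsnd (Ker (ds A B) vfst)"
    by (auto simp: inj_on_def Ker_def intro: vpair_eqI)
  then show "finite_length (ds A B\<lparr>carr := Ker (ds A B) vfst\<rparr>)"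
    by (intro finite_length_mono[OF l assms(3,4) g]) simp
qed

text \<open>One copy of the regular module is added for each generator. Finite length is kept
  through the induction since it is what places the growing sum in \<open>mod_R\<close>.\<close>

lemma finite_generators_epi:
  fixes M :: "('r, 'k) rmod"
  assumes "left_module M" "finite B" "B \<subseteq> carr M"
  shows "\<exists>(P :: ('r, 'k) rmod) f. projective P \<and> finite_length P \<and> lin P M f \<and> B \<subseteq> f ` carr P"
  using assms(2,3)
proof (induction B)
  case empty
  let ?Z = "zero_mod :: ('r, 'k) rmod"
  have "finite_length ?Z" using zero_mod(2) by (rule finite_length_zero)
  then have "projective ?Z"
    using zero_mod(1) finite_length_finitely_generated
    by (intro projective_zero zero_mod(2)) (auto simp: mod_R_def)
  then show ?case using \<open>finite_length ?Z\<close> lin_zero[OF assms(1)] by blast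
next
  case (insert x B)
  have "B \<subseteq> carr M" using insert.prems by simp
  from insert.IH[OF this] obtain P :: "('r, 'k) rmod" and f
    where P: "projective P" "finite_length P" "lin P M f" "B \<subseteq> f ` carr P"
    by (elim exE conjE)
  obtain F :: "('r, 'k) rmod" and e where F: "left_module F" "finite_length F" "e \<in> carr F"
    "\<And>(M :: ('r, 'k) rmod) x. left_module M \<Longrightarrow> x \<in> carr M \<Longrightarrow> \<exists>f. lin F M f \<and> f e = x"
    "\<And>(M :: ('r, 'k) rmod) f g. lin F M f \<Longrightarrow> lin F M g \<Longrightarrow> f e = g e \<Longrightarrow> \<forall>x\<in>carr F. f x = g x"
    by (rule regular_module) (rule that)
  have "F \<in> mod_R" using F finite_length_finitely_generated by (auto simp: mod_R_def)
  \<comment> \<open>Any preimage \<open>a\<close> of \<open>f e\<close> defines the lift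
    \<open>h\<close>; since homomorphisms out of \<open>F\<close> are determined at
    \<open>e\<close>, the composite of \<open>h\<close> and \<open>g\<close> is
    \<open>f\<close>.\<close>
  have "projective F"
  proof (rule projectiveI[OF \<open>F \<in> mod_R\<close>])
    fix A B g f assume *: "A \<in> mod_R" "B \<in> mod_R" "lin A B g" "g ` carr A = carr B" "lin F B f"
    obtain a where a: "a \<in> carr A" "g a = f e" using * F(3) lin_closed[OF *(5)] by (metis imageE)
    obtain h where h: "lin F A h" "h e = a" using F(4)[OF mod_R_left_module[OF *(1)] a(1)] by blast
    have "\<forall>x\<in>carr F. g (h x) = f x"
      using a h by (intro F(5)[OF lin_comp[OF h(1) *(3)] *(5)]) auto
    then show "\<exists>h. lin F A h \<and> (\<forall>x\<in>carr F. g (h x) = f x)" using h by blast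
  qed
  obtain k where k: "lin F M k" "k e = x" using F(4)[OF assms(1), of x] insert.prems by blast
  have lP: "left_module P" using P projective_mod_R mod_R_left_module by blast
  have fl: "finite_length (ds P F)" using finite_length_ds lP P F by blast
  then have "projective (ds P F)"
    using P \<open>projective F\<close> left_module_ds[OF lP F(1)] finite_length_finitely_generated[of "ds P F"]
    by (intro projective_ds_mod_R) (auto simp: mod_R_def)
  moreover have "lin (ds P F) M (\<lambda>x. f (vfst x) + k (vsnd x))"
    using assms(1) P k lin_copair by blast
  moreover have "insert x B \<subseteq> (\<lambda>x. f (vfst x) + k (vsnd x)) ` carr (ds P F)"
  proof
    fix y assume "y \<in> insert x B"
    then have "y = x \<or> (\<exists>z\<in>carr P. y = f z)" using P(4) by blast
    then consider "y = x" | z where "z \<in> carr P" "y = f z" by blast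
    then show "y \<in> (\<lambda>x. f (vfst x) + k (vsnd x)) ` carr (ds P F)"
    proof cases
      case 1
      then show ?thesis using F(3) k(2) lin_0[OF lP P(3)] lm_zero[OF lP]
        by (intro image_eqI[of _ _ "vpair 0 e"]) auto
    next
      case 2
      then show ?thesis using lin_0[OF F(1) k(1)] lm_zero[OF F(1)]
        by (intro image_eqI[of _ _ "vpair z 0"]) auto
    qed
  qed
  ultimately show ?case using fl by blast
qed

lemma enough_projectives:
  fixes M :: "('r, 'k) rmod"
  assumes "M \<in> mod_R"
  obtains P :: "('r, 'k) rmod" and f where "projective P" "finite_length P" "lin P M f"
    "f ` carr P = carr M"
proof -
  have l: "left_module M" using assms mod_R_left_module by blast
  obtain B where B: "B \<subseteq> carr M" "finite B" "\<And>S. submodule M S \<Longrightarrow> B \<subseteq> S \<Longrightarrow> S = carr M"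
    using assms unfolding mod_R_def finitely_generated_def by blast
  then obtain P f where P: "projective P" "finite_length P" "lin P M f" "B \<subseteq> f ` carr P"
    using finite_generators_epi[OF l, of B] by blast
  have lP: "left_module P" using P projective_mod_R mod_R_left_module by blast
  have "f ` carr P = carr M"
    using B(3) P submodule_image[OF lP P(3) submodule_carr[OF lP]] by blast
  then show thesis using that P by blast
qed

text \<open>Finite generation presents \<open>M\<close> as a quotient of a projective module of
  finite length. In terms of finite length, \<open>mod_R\<close> is visibly closed under submodules
  and finite sums, hence under kernels.\<close>

lemma mod_R_iff:
  fixes M :: "('r, 'k) rmod"
  shows "M \<in> mod_R \<longleftrightarrow> left_module M \<and> finite_length M"
proof
  assume M: "M \<in> mod_R"
  obtain P f where P: "projective P" "finite_length P" "lin P M f" "f ` carr P = carr M"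
    using enough_projectives[OF M] .
  then have "finite_length M" using finite_length_epi projective_mod_R mod_R_left_module by blast
  then show "left_module M \<and> finite_length M" using M mod_R_left_module by blast
qed (auto simp: mod_R_def finite_length_finitely_generated)

lemma mod_R_sub:
  fixes M :: "('r, 'k) rmod"
  shows "M \<in> mod_R \<Longrightarrow> submodule M S \<Longrightarrow> M\<lparr>carr := S\<rparr> \<in> mod_R"
  by (simp add: mod_R_iff finite_length_sub submodule_left_module)

lemma mod_R_Ker:
  fixes M :: "('r, 'k) rmod"
  shows "M \<in> mod_R \<Longrightarrow> N \<in> mod_R \<Longrightarrow> lin M N f \<Longrightarrow> M\<lparr>carr := Ker M f\<rparr> \<in> mod_R"
  by (intro mod_R_sub submodule_Ker[of M N f]) (auto dest: mod_R_left_module)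

lemma mod_R_ds:
  fixes A :: "('r, 'k) rmod"
  shows "A \<in> mod_R \<Longrightarrow> B \<in> mod_R \<Longrightarrow> ds A B \<in> mod_R"
  by (simp add: mod_R_iff finite_length_ds left_module_ds)

lemma mod_R_zero_mod: "(zero_mod :: ('r, 'k) rmod) \<in> mod_R"
  using mod_R_iff zero_mod finite_length_zero by blast

lemma mod_R_pow:
  fixes A :: "('r, 'k) rmod"
  shows "A \<in> mod_R \<Longrightarrow> pow_mod A n \<in> mod_R"
  by (induction n) (auto intro: mod_R_ds mod_R_zero_mod)

lemma projective_ds:
  fixes P :: "('r, 'k) rmod"
  shows "projective P \<Longrightarrow> projective Q \<Longrightarrow> projective (ds P Q)"
  by (simp add: projective_ds_mod_R mod_R_ds projective_mod_R)

lemma projective_zero_mod: "projective (zero_mod :: ('r, 'k) rmod)"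
  by (simp add: mod_R_zero_mod projective_zero zero_mod)

lemma projective_pow:
  fixes P :: "('r, 'k) rmod"
  shows "projective P \<Longrightarrow> projective (pow_mod P n)"
  by (induction n) (auto intro: projective_ds projective_zero_mod)

lemma retract_ds:
  fixes A :: "('r, 'k) rmod"
  assumes "A \<in> mod_R" "B \<in> mod_R"
  shows "retract A (ds A B)" "retract B (ds A B)"
  using assms mod_R_ds lin_inl[of B A] lin_vfst[of A B] lin_inr[of A B] lin_vsnd[of A B]
  by (auto intro!: retractI simp: mod_R_left_module)

lemma retract_ds_cong:
  fixes A :: "('r, 'k) rmod"
  assumes "retract A A'" "retract B B'"
  shows "retract (ds A B) (ds A' B')"
proof -
  obtain i p where 1: "lin A A' i" "lin A' A p" "\<forall>x\<in>carr A. p (i x) = x"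
    using assms(1) by (auto simp: retract_def)
  obtain j q where 2: "lin B B' j" "lin B' B q" "\<forall>x\<in>carr B. q (j x) = x"
    using assms(2) by (auto simp: retract_def)
  show ?thesis
    by (rule retractI[where i = "\<lambda>x. vpair (i (vfst x)) (j (vsnd x))" and p =
      "\<lambda>x. vpair (p (vfst x)) (q (vsnd x))"])
      (use 1 2 assms in \<open>auto intro!: lin_vpair mod_R_ds intro: lin_comp[OF lin_vfst] lin_comp[OF
        lin_vsnd]
        simp: retract_def\<close>)
qed

section \<open>Projective covers\<close>

text \<open>A submodule \<open>L\<close> of \<open>P\<close> that is minimal among those mapping onto \<open>M\<close> is the image of an
  endomorphism \<open>h\<close> of \<open>P\<close> over \<open>M\<close>; since \<open>h\<close> maps \<open>L\<close> onto \<open>L\<close>, it is bijective there, so \<open>L\<close> is a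
  retract of \<open>P\<close>.\<close>

lemma projective_cover_exists:
  fixes M :: "('r, 'k) rmod"
  assumes "M \<in> mod_R"
  obtains P :: "('r, 'k) rmod" and f where "projective_cover P f M"
proof -
  obtain P f where P: "projective P" "finite_length P" "lin P M f" "f ` carr P = carr M"
    using enough_projectives[OF assms] .
  have PR: "P \<in> mod_R" using P projective_mod_R by blast
  have lP: "left_module P" using PR mod_R_left_module by auto
  obtain L where L: "submodule P L" "f ` L = carr M"
    and min: "\<And>U. submodule P U \<Longrightarrow> f ` U = carr M \<Longrightarrow> U \<subseteq> L \<Longrightarrow> U = L"
    using finite_length_minimal[OF P(2) submodule_carr[OF lP], of "\<lambda>U. f ` U = carr M"] P(4)
    by blast
  let ?L = "P\<lparr>carr := L\<rparr>"
  have LP: "L \<subseteq> carr P" using L by (simp add: submodule_def)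
  have LR: "?L \<in> mod_R" using L PR mod_R_sub by blast
  have lL: "left_module ?L" using LR mod_R_left_module by blast
  have fL: "lin ?L M f" using LP P lin_sub by blast
  obtain h where h: "lin P ?L h" "\<And>x. x \<in> carr P \<Longrightarrow> f (h x) = f x"
    using projective_lift[OF P(1) LR assms fL _ P(3)] L by auto
  have hP: "lin P P h" using h(1) lin_from_sub LP by blast
  have hL: "lin ?L ?L h" using lin_sub[OF LP h(1)] .
  have "submodule P (h ` L)" using submodule_image[OF lP hP L(1)] .
  moreover have "h ` L \<subseteq> L" using lin_closed[OF hL] by auto
  moreover have "f ` h ` L = carr M"
    unfolding L(2)[symmetric] image_image using h(2) LP by (intro image_cong) auto
  ultimately have hsurj: "h ` L = L" using min by blast
  then have "inj_on h L"
    using finite_length_surj_inj[OF lL _ hL] LR mod_R_iff by simp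
  then have "bij_betw h (carr ?L) (carr ?L)" using hsurj by (simp add: bij_betw_def)
  then obtain g where g: "lin ?L ?L g" "\<And>x. x \<in> carr ?L \<Longrightarrow> g (h x) = x"
    using lin_inverse[OF lL hL] by metis
  have "retract ?L P"
    using LR PR lin_from_sub[OF lin_ident[of ?L] LP] lin_comp[OF h(1) g(1)] g(2)
    by (intro retractI[where i = "\<lambda>x. x" and p = "\<lambda>x. g (h x)"]) auto
  then have pL: "projective ?L" using P(1) projective_retract by blast
  have "projective_cover ?L (restrict f L) M"
    unfolding projective_cover_def
  proof (intro conjI allI impI)
    show "restrict f L \<in> Hom ?L M" using lin_restrict[OF lL fL] by simp
    fix U assume U: "submodule ?L U \<and> {x + y |x y. x \<in> U \<and> y \<in> Ker ?L (restrict f L)} = carr ?L"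
    then have UL: "submodule P U" "U \<subseteq> L" using submodule_sub_iff[OF L(1)] by blast+
    have "f ` U = carr M"
    proof
      show "f ` U \<subseteq> carr M" using UL LP P by auto
      show "carr M \<subseteq> f ` U"
      proof
        fix z assume "z \<in> carr M"
        then obtain w where w: "w \<in> L" "f w = z" using L(2) by (metis imageE)
        then have "w \<in> {x + y |x y. x \<in> U \<and> y \<in> Ker ?L (restrict f L)}" using U by simp
        then obtain x y where xy: "w = x + y" "x \<in> U" "y \<in> L" "f y = 0"
          by (auto simp: Ker_def)
        then have "f w = f x" using LP UL lin_add[OF P(3), of x y] by auto
        then show "z \<in> f ` U" using w xy by blast
      qed
    qed
    then show "U = carr ?L" using min UL by simp
  qed (use pL L in auto)
  then show thesis by (rule that)
qed

end

section \<open>Short exact sequences and syzygies\<close>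

text \<open>The maps are existentially quantified, so the outer terms can be exchanged freely for
  isomorphic modules.\<close>

definition ses :: "('r::ring_1, 'k::field) rmod \<Rightarrow> ('r, 'k) rmod \<Rightarrow> ('r, 'k) rmod \<Rightarrow> bool" where
  "ses K M N \<longleftrightarrow> K \<in> mod_R \<and> M \<in> mod_R \<and> N \<in> mod_R \<and>
     (\<exists>i p. lin K M i \<and> inj_on i (carr K) \<and> lin M N p \<and> p ` carr M = carr N \<and> i ` carr K = Ker M p)"

lemma sesI:
  "K \<in> mod_R \<Longrightarrow> M \<in> mod_R \<Longrightarrow> N \<in> mod_R \<Longrightarrow> lin K M i \<Longrightarrow> inj_on i (carr K) \<Longrightarrow> lin M N p \<Longrightarrow>
    p ` carr M = carr N \<Longrightarrow> i ` carr K = Ker M p \<Longrightarrow> ses K M N"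
  by (auto simp: ses_def)

lemma sesE:
  assumes "ses K M N"
  obtains i p where "K \<in> mod_R" "M \<in> mod_R" "N \<in> mod_R" "left_module K" "left_module M"
    "left_module N"
    "lin K M i" "inj_on i (carr K)" "lin M N p" "p ` carr M = carr N" "i ` carr K = Ker M p"
  using assms mod_R_left_module unfolding ses_def by blast

lemma ses_mod_R:
  assumes "ses K M N" shows "K \<in> mod_R" "M \<in> mod_R" "N \<in> mod_R"
  using assms by (auto simp: ses_def)

lemma ses_iso_left:
  assumes "ses K M N" "K \<cong>\<^sub>R K'" "K' \<in> mod_R" shows "ses K' M N"
proof -
  obtain i p where *: "K \<in> mod_R" "M \<in> mod_R" "N \<in> mod_R" "left_module K" "lin K M i"
    "inj_on i (carr K)"
    "lin M N p" "p ` carr M = carr N" "i ` carr K = Ker M p"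
    using assms(1) by (rule sesE)
  obtain f g where f: "lin K' K g" "bij_betw g (carr K') (carr K)"
    using mod_isoE[OF assms(2) *(4)] by metis
  have "(\<lambda>x. i (g x)) ` carr K' = i ` g ` carr K'" by (simp add: image_image)
  then have "(\<lambda>x. i (g x)) ` carr K' = Ker M p" using f * by (simp add: bij_betw_def)
  moreover have "inj_on (\<lambda>x. i (g x)) (carr K')"
    using f * comp_inj_on[of g "carr K'" i] by (simp add: bij_betw_def comp_def)
  ultimately show ?thesis
    by (rule sesI[OF assms(3) *(2,3) lin_comp[OF f(1) *(5)] _ *(7,8), rotated])
qed

lemma ses_iso_right:
  assumes "ses K M N" "N \<cong>\<^sub>R N'" "N' \<in> mod_R" shows "ses K M N'"
proof -
  obtain i p where *: "K \<in> mod_R" "M \<in> mod_R" "N \<in> mod_R" "left_module N" "lin K M i"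
    "inj_on i (carr K)"
    "lin M N p" "p ` carr M = carr N" "i ` carr K = Ker M p"
    using assms(1) by (rule sesE)
  obtain f g where f: "lin N N' f" "bij_betw f (carr N) (carr N')"
    using mod_isoE[OF assms(2) *(4)] by metis
  have "(\<lambda>x. f (p x)) ` carr M = f ` p ` carr M" by (simp add: image_image)
  then have 1: "(\<lambda>x. f (p x)) ` carr M = carr N'" using f * by (simp add: bij_betw_def)
  have "f (p x) = 0 \<longleftrightarrow> p x = 0" if "x \<in> carr M" for x
    using f lin_closed[OF *(7) that] lin_0[OF *(4) f(1)] lin_injD[OF *(4) f(1)]
    by (auto simp: bij_betw_def)
  then have 2: "i ` carr K = Ker M (\<lambda>x. f (p x))" using *(9) by (auto simp: Ker_def)
  show ?thesis
    by (rule sesI[OF *(1,2) assms(3) *(5,6) lin_comp[OF *(7) f(1)] 1 2])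
qed

context finite_dimensional_algebra
begin

lemma ses_zero_left:
  fixes M :: "('r, 'k) rmod"
  assumes "M \<in> mod_R" shows "ses zero_mod M M"
  by (rule sesI[OF mod_R_zero_mod assms assms lin_zero _ lin_ident])
    (use mod_R_left_module[OF assms] lm_zero[of M] in \<open>auto simp: zero_mod_def Ker_def\<close>)

lemma ses_zero_left_iso:
  fixes M N :: "('r, 'k) rmod"
  assumes "ses zero_mod M N" shows "M \<cong>\<^sub>R N"
proof -
  obtain i p where *: "left_module M" "lin zero_mod M i" "lin M N p" "p ` carr M = carr N"
    "i ` carr (zero_mod :: ('r, 'k) rmod) = Ker M p"
    using assms by (rule sesE)
  have "Ker M p = {0}" using *(5) lin_0[OF zero_mod(1) *(2)] by (simp add: zero_mod_def)
  then have "x = 0" if "x \<in> carr M" "p x = 0" for x using that by (auto simp: Ker_def)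
  then show ?thesis using *(4) by (intro mod_isoI[OF *(1,3)]) (blast, metis imageE)
qed

text \<open>The complement of \<open>N\<close> is the kernel of the retraction \<open>p\<close>, and
  \<open>x\<close> is split into \<open>p x\<close> and \<open>x - i (p x)\<close>.\<close>

lemma retract_complement:
  fixes N M :: "('r, 'k) rmod"
  assumes "retract N M"
  obtains L where "L \<in> mod_R" "M \<cong>\<^sub>R ds N L"
proof -
  obtain i p where ip: "lin N M i" "lin M N p" "\<And>x. x \<in> carr N \<Longrightarrow> p (i x) = x" and NM: "N \<in> mod_R"
    "M \<in> mod_R"
    using assms by (auto simp: retract_def)
  have l: "left_module N" "left_module M" using NM mod_R_left_module by auto
  let ?L = "M\<lparr>carr := Ker M p\<rparr>"
  have L: "?L \<in> mod_R" using NM ip mod_R_Ker by blast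
  have 1: "lin M ?L (\<lambda>x. x - i (p x))"
  proof (rule lin_into_sub[OF lin_minus[OF l(2) lin_ident lin_comp[OF ip(2,1)]]])
    show "(\<lambda>x. x - i (p x)) ` carr M \<subseteq> Ker M p"
      using ip l by (auto simp: Ker_def lin_diff lm_diff lin_closed)
  qed
  have 2: "lin (ds N ?L) M (\<lambda>x. i (vfst x) + vsnd x)"
    using lin_copair[OF l(2) ip(1) lin_from_sub[OF lin_ident[of ?L]]] by (simp add: Ker_def)
  have "M \<cong>\<^sub>R ds N ?L"
  proof (rule mod_isoI_inverse[OF l(2) lin_vpair[OF ip(2) 1] 2])
    fix y assume y: "y \<in> carr (ds N ?L)"
    then have "p (i (vfst y) + vsnd y) = vfst y"
      using ip lin_add[OF ip(2), of "i (vfst y)" "vsnd y"] lin_closed[OF ip(1)]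
      by (simp add: Ker_def)
    then show "vpair (p (i (vfst y) + vsnd y)) (i (vfst y) + vsnd y - i (p (i (vfst y) + vsnd y)))
      = y"
      by (auto intro: vpair_eqI)
  qed auto
  then show thesis using that L by blast
qed

lemma direct_summand_iff_retract:
  fixes N M :: "('r, 'k) rmod"
  assumes "M \<in> mod_R"
  shows "direct_summand N M \<longleftrightarrow> retract N M"
proof
  assume "direct_summand N M"
  then obtain L :: "('r, 'k) rmod" where L: "N \<in> mod_R" "L \<in> mod_R" "M \<cong>\<^sub>R ds N L"
    using assms mod_iso_direct_sum mod_R_left_module unfolding direct_summand_def by blast
  then have "retract (ds N L) M"
    using assms mod_R_ds mod_iso_sym mod_R_left_module retract_iso by blast
  then show "retract N M" using L retract_ds(1) retract_trans by blast
next
  assume r: "retract N M"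
  then obtain L where "L \<in> mod_R" "M \<cong>\<^sub>R ds N L" using retract_complement by blast
  then show "direct_summand N M"
    using r mod_iso_direct_sum[OF mod_R_left_module[OF assms]]
      unfolding direct_summand_def retract_def by blast
qed

lemma ses_Ker:
  fixes N M :: "('r, 'k) rmod"
  assumes "M \<in> mod_R" "N \<in> mod_R" "lin M N p" "p ` carr M = carr N"
  shows "ses (M\<lparr>carr := Ker M p\<rparr>) M N"
  by (rule sesI[OF mod_R_Ker[OF assms(1-3)] assms(1,2) lin_from_sub[OF lin_ident] _ assms(3,4)])
    (auto simp: Ker_def)

lemma ses_sub_Ker:
  fixes K M N :: "('r, 'k) rmod"
  assumes "ses K M N"
  obtains p where "lin M N p" "p ` carr M = carr N" "M\<lparr>carr := Ker M p\<rparr> \<in> mod_R"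
    "M\<lparr>carr := Ker M p\<rparr> \<cong>\<^sub>R K"
proof -
  obtain i p where *: "K \<in> mod_R" "M \<in> mod_R" "N \<in> mod_R" "left_module K" "lin K M i"
    "inj_on i (carr K)"
    "lin M N p" "p ` carr M = carr N" "i ` carr K = Ker M p"
    using assms(1) by (rule sesE)
  have L: "M\<lparr>carr := Ker M p\<rparr> \<in> mod_R" using * mod_R_Ker by blast
  have "lin K (M\<lparr>carr := Ker M p\<rparr>) i" using * by (intro lin_into_sub) auto
  moreover have "bij_betw i (carr K) (carr (M\<lparr>carr := Ker M p\<rparr>))" using *
    by (simp add: bij_betw_def)
  ultimately have "K \<cong>\<^sub>R M\<lparr>carr := Ker M p\<rparr>" using mod_iso_iff[OF *(4)] by blast
  then show thesis using that[OF *(7,8) L] mod_iso_sym *(4) L mod_R_left_module by blast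
qed

lemma ses_ds:
  fixes K M N K' M' N' :: "('r, 'k) rmod"
  assumes "ses K M N" "ses K' M' N'"
  shows "ses (ds K K') (ds M M') (ds N N')"
proof -
  obtain i p where 1: "K \<in> mod_R" "M \<in> mod_R" "N \<in> mod_R" "lin K M i" "inj_on i (carr K)"
    "lin M N p" "p ` carr M = carr N" "i ` carr K = Ker M p"
    using assms(1) by (rule sesE)
  obtain j q where 2: "K' \<in> mod_R" "M' \<in> mod_R" "N' \<in> mod_R" "lin K' M' j" "inj_on j (carr K')"
    "lin M' N' q" "q ` carr M' = carr N'" "j ` carr K' = Ker M' q"
    using assms(2) by (rule sesE)
  show ?thesis
  proof (rule sesI)
    let ?i = "\<lambda>x. vpair (i (vfst x)) (j (vsnd x))" and ?p = "\<lambda>x. vpair (p (vfst x)) (q (vsnd x))"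
    show "lin (ds K K') (ds M M') ?i" "lin (ds M M') (ds N N') ?p"
      using 1 2 by (auto intro!: lin_vpair intro: lin_comp[OF lin_vfst] lin_comp[OF lin_vsnd])
    show "inj_on ?i (carr (ds K K'))"
    proof (rule inj_onI)
      fix x y assume xy: "x \<in> carr (ds K K')" "y \<in> carr (ds K K')" "?i x = ?i y"
      have "i (vfst x) = i (vfst y)" "j (vsnd x) = j (vsnd y)"
        using arg_cong[of _ _ vfst, OF xy(3)] arg_cong[of _ _ vsnd, OF xy(3)] by simp_all
      then have "vfst x = vfst y" "vsnd x = vsnd y"
        using xy(1,2) inj_onD[OF 1(5), of "vfst x" "vfst y"] inj_onD[OF 2(5), of "vsnd x"
          "vsnd y"] by simp_all
      then show "x = y" by (rule vpair_eqI)
    qed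
    show "?p ` carr (ds M M') = carr (ds N N')"
    proof
      show "?p ` carr (ds M M') \<subseteq> carr (ds N N')" using 1 2 by (auto simp: lin_closed)
      show "carr (ds N N') \<subseteq> ?p ` carr (ds M M')"
      proof
        fix y assume "y \<in> carr (ds N N')"
        then have "vfst y \<in> p ` carr M" "vsnd y \<in> q ` carr M'" using 1 2 by auto
        then obtain a b where "a \<in> carr M" "vfst y = p a" "b \<in> carr M'" "vsnd y = q b" by blast
        then show "y \<in> ?p ` carr (ds M M')"
          by (intro image_eqI[of _ _ "vpair a b"]) (auto intro: vpair_eqI)
      qed
    qed
    show "?i ` carr (ds K K') = Ker (ds M M') ?p"
    proof
      show "?i ` carr (ds K K') \<subseteq> Ker (ds M M') ?p"
      proof
        fix y assume "y \<in> ?i ` carr (ds K K')"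
        then obtain x where x: "vfst x \<in> carr K" "vsnd x \<in> carr K'" "y = ?i x" by auto
        then have "i (vfst x) \<in> Ker M p" "j (vsnd x) \<in> Ker M' q" using 1(8) 2(8) by auto
        then show "y \<in> Ker (ds M M') ?p" using x by (simp add: Ker_def)
      qed
      show "Ker (ds M M') ?p \<subseteq> ?i ` carr (ds K K')"
      proof
        fix y assume "y \<in> Ker (ds M M') ?p"
        then have "vfst y \<in> i ` carr K" "vsnd y \<in> j ` carr K'" using 1 2 by (auto simp: Ker_def)
        then obtain a b where "a \<in> carr K" "vfst y = i a" "b \<in> carr K'" "vsnd y = j b" by blast
        then show "y \<in> ?i ` carr (ds K K')"
          by (intro image_eqI[of _ _ "vpair a b"]) (auto intro: vpair_eqI)
      qed
    qed
  qed (use 1 2 in \<open>auto intro: mod_R_ds\<close>)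
qed

lemma ses_projective_split:
  fixes K M N :: "('r, 'k) rmod"
  assumes "ses K M N" "projective N"
  shows "M \<cong>\<^sub>R ds K N"
proof -
  obtain i p where *: "K \<in> mod_R" "M \<in> mod_R" "N \<in> mod_R" "left_module K" "left_module M"
    "left_module N"
    "lin K M i" "inj_on i (carr K)" "lin M N p" "p ` carr M = carr N" "i ` carr K = Ker M p"
    using assms(1) by (rule sesE)
  obtain s where s: "lin N M s" "\<And>x. x \<in> carr N \<Longrightarrow> p (s x) = x"
    using projective_lift[OF assms(2) *(2,3,9,10) lin_ident] by metis
  have iK: "i x \<in> carr M" "p (i x) = 0" if "x \<in> carr K" for x
    using *(11) that by (auto simp: Ker_def)
  have "ds K N \<cong>\<^sub>R M"
  proof (rule mod_isoI[OF left_module_ds[OF *(4,6)] lin_copair[OF *(5,7) s(1)]])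
    fix x assume x: "x \<in> carr (ds K N)" and 0: "i (vfst x) + s (vsnd x) = 0"
    have "p (i (vfst x) + s (vsnd x)) = vsnd x"
      using x iK s lin_closed[OF s(1)] by (simp add: lin_add[OF *(9)])
    then have snd: "vsnd x = 0" using 0 lin_0[OF *(5,9)] by simp
    then have "i (vfst x) = 0" using 0 lin_0[OF *(6) s(1)] by simp
    then have "vfst x = 0" using x lin_injD[OF *(4,7,8)] by simp
    then show "x = 0" using snd by (auto intro: vpair_eqI)
  next
    fix y assume y: "y \<in> carr M"
    then have "y - s (p y) \<in> i ` carr K"
      using *(5,9,11) s lin_closed[OF s(1)] lin_closed[OF *(9)]
      by (simp add: Ker_def lin_diff lm_diff)
    then obtain x where "x \<in> carr K" "y - s (p y) = i x" by blast
    then show "\<exists>x\<in>carr (ds K N). i (vfst x) + s (vsnd x) = y"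
      using y lin_closed[OF *(9)]
      by (intro bexI[of _ "vpair x (p y)"]) (auto simp: algebra_simps)
  qed
  then show ?thesis by (rule mod_iso_sym[OF left_module_ds[OF *(4,6)] *(5)])
qed

lemma pullback_ses:
  fixes M M' N :: "('r, 'k) rmod"
  assumes "M \<in> mod_R" "M' \<in> mod_R" "N \<in> mod_R" and p: "lin M N p" "p ` carr M = carr N"
    and q: "lin M' N q"
  shows "ses (M\<lparr>carr := Ker M p\<rparr>) (ds M M'\<lparr>carr := {x \<in> carr (ds M M'). p (vfst x) = q (vsnd x)}\<rparr>)
    M'"
    (is "ses ?K ?X M'")
proof (rule sesI)
  have l: "left_module M" "left_module M'" "left_module N" using assms mod_R_left_module by auto
  \<comment> \<open>The pullback is the kernel of the difference of the two maps to
    \<open>N\<close>, hence lies in \<open>mod_R\<close>.\<close>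
  have "lin (ds M M') N (\<lambda>x. p (vfst x) - q (vsnd x))"
    using l p q by (intro lin_minus) (auto intro: lin_comp[OF lin_vfst] lin_comp[OF lin_vsnd])
  from mod_R_Ker[OF mod_R_ds[OF assms(1,2)] assms(3) this] show "?X \<in> mod_R" by (simp add: Ker_def)
  have 0: "p 0 = 0" "q 0 = 0" "0 \<in> carr M" "0 \<in> carr M'" using l lin_0 p q lm_zero by blast+
  have KM: "Ker M p \<subseteq> carr M" and sub: "carr ?X \<subseteq> carr (ds M M')" by (auto simp: Ker_def)
  show "lin ?K ?X (\<lambda>x. vpair x 0)"
    by (rule lin_into_sub[OF lin_sub[OF KM lin_inl[OF l(2)]]]) (use 0 in \<open>auto simp: Ker_def\<close>)
  show "inj_on (\<lambda>x. vpair x 0) (carr ?K)" by (rule inj_onI) (metis vpair_simps(1))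
  show "lin ?X M' vsnd" using lin_sub[OF sub lin_vsnd] by simp
  show "vsnd ` carr ?X = carr M'"
  proof
    show "carr M' \<subseteq> vsnd ` carr ?X"
    proof
      fix y assume y: "y \<in> carr M'"
      then have "q y \<in> p ` carr M" using p(2) lin_closed[OF q(1)] by simp
      then obtain x where "x \<in> carr M" "q y = p x" by blast
      then show "y \<in> vsnd ` carr ?X" using y by (intro image_eqI[of _ _ "vpair x y"]) auto
    qed
  qed auto
  have "x \<in> (\<lambda>x. vpair x 0) ` Ker M p" if "x \<in> Ker ?X vsnd" for x
    using that 0 by (intro image_eqI[of _ _ "vfst x"]) (auto simp: Ker_def intro: vpair_eqI)
  then show "(\<lambda>x. vpair x 0) ` carr ?K = Ker ?X vsnd"
    using 0 by (auto simp: Ker_def)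
qed (use assms mod_R_Ker in blast)+

text \<open>The pullback of the two epimorphisms onto \<open>M\<close> maps onto \<open>P'\<close>
  with kernel \<open>K\<close> and onto \<open>P\<close> with kernel \<open>K'\<close>, and both
  sequences split. \<open>?X\<close> and \<open>?Y\<close> are this pullback with its coordinates in
  either order.\<close>

lemma Schanuel:
  fixes K P K' P' M :: "('r, 'k) rmod"
  assumes "ses K P M" "ses K' P' M" "projective P" "projective P'"
  shows "ds K P' \<cong>\<^sub>R ds K' P"
proof -
  note mR = ses_mod_R[OF assms(1)] ses_mod_R[OF assms(2)]
  obtain p where p: "lin P M p" "p ` carr P = carr M" "P\<lparr>carr := Ker P p\<rparr> \<cong>\<^sub>R K"
    using assms(1) by (rule ses_sub_Ker)
  obtain q where q: "lin P' M q" "q ` carr P' = carr M" "P'\<lparr>carr := Ker P' q\<rparr> \<cong>\<^sub>R K'"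
    using assms(2) by (rule ses_sub_Ker)
  let ?X = "ds P P'\<lparr>carr := {x \<in> carr (ds P P'). p (vfst x) = q (vsnd x)}\<rparr>"
  let ?Y = "ds P' P\<lparr>carr := {x \<in> carr (ds P' P). q (vfst x) = p (vsnd x)}\<rparr>"
  have X: "ses K ?X P'" using ses_iso_left[OF pullback_ses[OF mR(2,5,3) p(1,2) q(1)] p(3) mR(1)] .
  have Y: "ses K' ?Y P" using ses_iso_left[OF pullback_ses[OF mR(5,2,3) q(1,2) p(1)] q(3) mR(4)] .
  have l: "left_module ?X" "left_module ?Y" "left_module (ds K P')" "left_module (ds K' P)"
    using ses_mod_R(2)[OF X] ses_mod_R(2)[OF Y] mR mod_R_ds mod_R_left_module by blast+
  have "?X \<cong>\<^sub>R ?Y"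
    using l(1) by (rule mod_isoI_inverse[where f = "\<lambda>x. vpair (vsnd x) (vfst x)" and g =
      "\<lambda>x. vpair (vsnd x) (vfst x)"])
      (auto simp: lin_def)
  then have "?X \<cong>\<^sub>R ds K' P"
    using mod_iso_trans[OF l(1) _ ses_projective_split[OF Y assms(3)] l(2)] by blast
  then show ?thesis
    using mod_iso_trans[OF l(3) mod_iso_sym[OF l(1,3) ses_projective_split[OF X assms(4)]] _ l(1)]
    by blast
qed

text \<open>\<open>PB\<close> maps to \<open>M\<close> by a lift \<open>q\<close> of its map to
  \<open>B\<close>; together with \<open>PA \<rightarrow> A \<rightarrow> M\<close> this gives the
  epimorphism \<open>f\<close> from \<open>ds PA PB\<close>. The second projection makes its kernel
  an extension of \<open>KB\<close> by \<open>KA\<close>.\<close>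

lemma horseshoe:
  fixes A M B KA PA KB PB :: "('r, 'k) rmod"
  assumes "ses A M B" "ses KA PA A" "ses KB PB B" "projective PB"
  obtains K where "ses K (ds PA PB) M" "ses KA K KB"
proof -
  obtain i g where 1: "A \<in> mod_R" "M \<in> mod_R" "B \<in> mod_R" "left_module A" "left_module M"
    "left_module B"
    "lin A M i" "inj_on i (carr A)" "lin M B g" "g ` carr M = carr B" "i ` carr A = Ker M g"
    using assms(1) by (rule sesE)
  obtain k a where 2: "KA \<in> mod_R" "PA \<in> mod_R" "A \<in> mod_R" "left_module KA" "left_module PA"
    "left_module A"
    "lin KA PA k" "inj_on k (carr KA)" "lin PA A a" "a ` carr PA = carr A" "k ` carr KA = Ker PA a"
    using assms(2) by (rule sesE)
  have 3: "KB \<in> mod_R" "PB \<in> mod_R" "left_module PB"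
    using ses_mod_R[OF assms(3)] mod_R_left_module by auto
  obtain b where b: "lin PB B b" "b ` carr PB = carr B" "PB\<lparr>carr := Ker PB b\<rparr> \<in> mod_R"
    "PB\<lparr>carr := Ker PB b\<rparr> \<cong>\<^sub>R KB"
    using assms(3) by (rule ses_sub_Ker)
  obtain q where q: "lin PB M q" "\<And>x. x \<in> carr PB \<Longrightarrow> g (q x) = b x"
    using projective_lift[OF assms(4) 1(2,3,9,10) b(1)] by blast
  have gi: "g (i x) = 0" "i x \<in> carr M" if "x \<in> carr A" for x using 1(11) that
    by (auto simp: Ker_def)
  have ak: "a (k x) = 0" "k x \<in> carr PA" if "x \<in> carr KA" for x using 2(11) that
    by (auto simp: Ker_def)
  have ac: "a x \<in> carr A" if "x \<in> carr PA" for x using lin_closed[OF 2(9) that] .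
  have qc: "q x \<in> carr M" if "x \<in> carr PB" for x using lin_closed[OF q(1) that] .
  have 0: "a 0 = 0" "i 0 = 0" "q 0 = 0" "0 \<in> carr PB"
    using lin_0[OF 2(5,9)] lin_0[OF 1(4,7)] lin_0[OF 3(3) q(1)] lm_zero[OF 3(3)] .
  define f where "f = (\<lambda>x. i (a (vfst x)) + q (vsnd x))"
  have f: "lin (ds PA PB) M f" unfolding f_def
    by (rule lin_copair[OF 1(5) lin_comp[OF 2(9) 1(7)] q(1)])
  have hit: "\<exists>z\<in>carr PA. i (a z) = y" if "y \<in> Ker M g" for y
  proof -
    have "y \<in> i ` a ` carr PA" using that 1(11) 2(10) by simp
    then show ?thesis by blast
  qed
  have fs: "f ` carr (ds PA PB) = carr M"
  proof
    show "carr M \<subseteq> f ` carr (ds PA PB)"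
    proof
      fix m assume m: "m \<in> carr M"
      then have "g m \<in> b ` carr PB" using b(2) lin_closed[OF 1(9)] by simp
      then obtain y where y: "y \<in> carr PB" "g m = b y" by blast
      then have "m - q y \<in> Ker M g" using m qc q(2)
        by (simp add: Ker_def lin_diff[OF 1(5,9)] lm_diff[OF 1(5)])
      then obtain z where "z \<in> carr PA" "i (a z) = m - q y" using hit by blast
      then show "m \<in> f ` carr (ds PA PB)" using y
        by (intro image_eqI[of _ _ "vpair z y"]) (auto simp: f_def)
    qed
  qed (use lin_closed[OF f] in auto)
  let ?K = "ds PA PB\<lparr>carr := Ker (ds PA PB) f\<rparr>"
  have K: "ses ?K (ds PA PB) M" using ses_Ker[OF mod_R_ds[OF 2(2) 3(2)] 1(2) f fs] .
  have KR: "?K \<in> mod_R" using ses_mod_R(1)[OF K] .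
  have sub: "Ker (ds PA PB) f \<subseteq> carr (ds PA PB)" by (auto simp: Ker_def)
  have Ki: "x \<in> Ker (ds PA PB) f \<longleftrightarrow> vfst x \<in> carr PA \<and> vsnd x \<in> carr PB \<and>
    i (a (vfst x)) + q (vsnd x) = 0" for x
    by (auto simp: Ker_def f_def)
  have "ses KA ?K (PB\<lparr>carr := Ker PB b\<rparr>)"
  proof (rule sesI[OF 2(1) KR b(3)])
    show "lin KA ?K (\<lambda>x. vpair (k x) 0)"
      by (rule lin_into_sub[OF lin_comp[OF 2(7) lin_inl[OF 3(3)]]]) (use ak 0 in \<open>auto simp:
        Ker_def f_def\<close>)
    show "inj_on (\<lambda>x. vpair (k x) 0) (carr KA)"
      by (rule inj_onI) (metis vpair_simps(1) inj_onD[OF 2(8)])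
    \<comment> \<open>Applying \<open>g\<close> to the relation that defines the kernel removes the
      part coming from \<open>A\<close>.\<close>
    have kb: "b (vsnd x) = 0" if "x \<in> carr ?K" for x
    proof -
      have "g (i (a (vfst x)) + q (vsnd x)) = b (vsnd x)"
        using that gi ac qc q(2) by (subst lin_add[OF 1(9)]) (auto simp: Ki)
      then show ?thesis using that lin_0[OF 1(5,9)] by (simp add: Ki)
    qed
    show "lin ?K (PB\<lparr>carr := Ker PB b\<rparr>) vsnd"
      by (rule lin_into_sub[OF lin_sub[OF sub lin_vsnd]]) (use kb in \<open>auto simp: Ki Ker_def[of PB]\<close>)
    show "vsnd ` carr ?K = carr (PB\<lparr>carr := Ker PB b\<rparr>)"
    proof
      show "vsnd ` carr ?K \<subseteq> carr (PB\<lparr>carr := Ker PB b\<rparr>)" using kb by (auto simp: Ki Ker_def[of PB])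
      show "carr (PB\<lparr>carr := Ker PB b\<rparr>) \<subseteq> vsnd ` carr ?K"
      proof
        fix y assume "y \<in> carr (PB\<lparr>carr := Ker PB b\<rparr>)"
        then have y: "y \<in> carr PB" "b y = 0" by (auto simp: Ker_def)
        then have "- q y \<in> Ker M g"
          using qc q(2) by (simp add: Ker_def lin_uminus[OF 1(5,9)] lm_uminus[OF 1(5)])
        then obtain z where "z \<in> carr PA" "i (a z) = - q y" using hit by blast
        then show "y \<in> vsnd ` carr ?K" using y by (intro image_eqI[of _ _
          "vpair z y"]) (auto simp: Ki)
      qed
    qed
    show "(\<lambda>x. vpair (k x) 0) ` carr KA = Ker ?K vsnd"
    proof
      show "(\<lambda>x. vpair (k x) 0) ` carr KA \<subseteq> Ker ?K vsnd"
        using ak 0 by (auto simp: Ker_def f_def)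
      show "Ker ?K vsnd \<subseteq> (\<lambda>x. vpair (k x) 0) ` carr KA"
      proof
        fix x assume "x \<in> Ker ?K vsnd"
        then have x: "vfst x \<in> carr PA" "vsnd x = 0" "i (a (vfst x)) = 0"
          using 0 by (auto simp: Ker_def f_def)
        then have "a (vfst x) = 0" using lin_injD[OF 1(4,7,8) ac] by blast
        then have "vfst x \<in> k ` carr KA" using x 2(11) by (simp add: Ker_def)
        then obtain u where "u \<in> carr KA" "vfst x = k u" by blast
        then show "x \<in> (\<lambda>x. vpair (k x) 0) ` carr KA"
          using x(2) by (intro image_eqI[of _ _ u]) (auto intro: vpair_eqI)
      qed
    qed
  qed
  then have "ses KA ?K KB" using ses_iso_right b(4) 3(1) by blast
  then show thesis using that K by blast
qed

section \<open>Syzygies obtained from projective covers\<close>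

lemma syzygy_ses:
  fixes M :: "('r, 'k) rmod"
  assumes "M \<in> mod_R"
  obtains P where "projective P" "ses (\<Omega> M) P M"
proof -
  obtain P and f :: "(nat \<Rightarrow> 'k) \<Rightarrow> nat \<Rightarrow> 'k" where "projective_cover P f M"
    using projective_cover_exists[OF assms] by blast
  then have "\<exists>K P f. projective_cover P f M \<and> K = P\<lparr>carr := Ker P f\<rparr>" by blast
  then have "\<exists>P f. projective_cover P f M \<and> \<Omega> M = P\<lparr>carr := Ker P f\<rparr>"
    unfolding syzygy_def by (rule someI_ex)
  \<comment> \<open>The choice made by \<open>\<Omega>\<close> is unpacked here; afterwards
    \<open>\<Omega> M\<close> is handled through its short exact sequence with a projective middle
    term.\<close>
  then obtain P f where P: "projective_cover P f M" "\<Omega> M = P\<lparr>carr := Ker P f\<rparr>" by blast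
  then have "projective P" "ses (P\<lparr>carr := Ker P f\<rparr>) P M"
    using ses_Ker[of P M f] assms Hom_lin projective_mod_R unfolding projective_cover_def by auto
  then show thesis using that P by metis
qed

lemma syzygy_mod_R: "M \<in> mod_R \<Longrightarrow> \<Omega> M \<in> mod_R" for M :: "('r, 'k) rmod"
  using syzygy_ses ses_mod_R by metis

lemma syzygy_funpow_mod_R: "M \<in> mod_R \<Longrightarrow> (\<Omega> ^^ n) M \<in> mod_R" for M :: "('r, 'k) rmod"
  by (induction n) (auto intro: syzygy_mod_R)

section \<open>Stable isomorphism\<close>

text \<open>Isomorphism up to projective direct summands. It absorbs the choice of a projective
  presentation and is exactly the relation between kernels that Schanuel's lemma delivers.\<close>

definition stably_iso :: "('r, 'k) rmod \<Rightarrow> ('r, 'k) rmod \<Rightarrow> bool"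
  (infix \<open>\<simeq>\<close> 50) where
  "M \<simeq> N \<longleftrightarrow> M \<in> mod_R \<and> N \<in> mod_R \<and> (\<exists>P Q. projective P \<and> projective Q \<and> ds M P \<cong>\<^sub>R ds N Q)"

lemma stably_isoI:
  "M \<in> mod_R \<Longrightarrow> N \<in> mod_R \<Longrightarrow> projective P \<Longrightarrow> projective Q \<Longrightarrow> ds M P \<cong>\<^sub>R ds N Q \<Longrightarrow> M \<simeq> N"
  by (auto simp: stably_iso_def)

lemma stably_iso_mod_R: "M \<simeq> N \<Longrightarrow> M \<in> mod_R" "M \<simeq> N \<Longrightarrow> N \<in> mod_R"
  by (auto simp: stably_iso_def)

lemma iso_stably_iso: "M \<in> mod_R \<Longrightarrow> N \<in> mod_R \<Longrightarrow> M \<cong>\<^sub>R N \<Longrightarrow> M \<simeq> N"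
  by (rule stably_isoI[OF _ _ projective_zero_mod projective_zero_mod])
    (auto intro!: ds_cong mod_iso_refl mod_R_left_module mod_R_zero_mod)

lemma stably_iso_refl: "M \<in> mod_R \<Longrightarrow> M \<simeq> M"
  by (simp add: iso_stably_iso mod_iso_refl mod_R_left_module)

lemma stably_iso_sym: "M \<simeq> N \<Longrightarrow> N \<simeq> M"
  unfolding stably_iso_def by (meson mod_R_ds mod_R_left_module mod_iso_sym projective_mod_R)

lemma stably_iso_trans [trans]:
  assumes "M \<simeq> N" "N \<simeq> L" shows "M \<simeq> L"
proof -
  obtain P Q where 1: "M \<in> mod_R" "N \<in> mod_R" "projective P" "projective Q" "ds M P \<cong>\<^sub>R ds N Q"
    using assms(1) by (auto simp: stably_iso_def)
  obtain P' Q' where 2: "L \<in> mod_R" "projective P'" "projective Q'" "ds N P' \<cong>\<^sub>R ds L Q'"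
    using assms(2) by (auto simp: stably_iso_def)
  have l: "left_module M" "left_module N" "left_module L" "left_module P" "left_module Q"
    "left_module P'" "left_module Q'"
    using 1 2 projective_mod_R mod_R_left_module by auto
  note [simp, intro] = l left_module_ds
  have a: "ds M (ds P P') \<cong>\<^sub>R ds (ds M P) P'" by (rule mod_iso_sym) (auto intro: ds_assoc)
  have a': "ds (ds M P) P' \<cong>\<^sub>R ds (ds N Q) P'"
    using 1 by (auto intro: ds_cong mod_iso_refl)
  have b: "ds (ds N Q) P' \<cong>\<^sub>R ds N (ds Q P')" by (auto intro: ds_assoc)
  have c: "ds N (ds Q P') \<cong>\<^sub>R ds N (ds P' Q)" by (auto intro: ds_cong mod_iso_refl ds_commute)
  have d: "ds N (ds P' Q) \<cong>\<^sub>R ds (ds N P') Q" by (rule mod_iso_sym) (auto intro: ds_assoc)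
  have e: "ds (ds N P') Q \<cong>\<^sub>R ds (ds L Q') Q" using 2 by (auto intro: ds_cong mod_iso_refl)
  have f: "ds (ds L Q') Q \<cong>\<^sub>R ds L (ds Q' Q)" by (auto intro: ds_assoc)
  have "ds M (ds P P') \<cong>\<^sub>R ds L (ds Q' Q)"
    by (rule mod_iso_trans[OF _ a mod_iso_trans[OF _ a' mod_iso_trans[OF _ b mod_iso_trans[OF _ c
      mod_iso_trans[OF _ d mod_iso_trans[OF _ e f]]]]]]) auto
  then show ?thesis by (rule stably_isoI[rotated -1]) (use 1 2 in \<open>auto intro: projective_ds\<close>)
qed

lemma stably_iso_ds:
  assumes "M \<simeq> N" "M' \<simeq> N'" shows "ds M M' \<simeq> ds N N'"
proof -
  obtain P Q where 1: "M \<in> mod_R" "N \<in> mod_R" "projective P" "projective Q" "ds M P \<cong>\<^sub>R ds N Q"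
    using assms(1) by (auto simp: stably_iso_def)
  obtain P' Q' where 2: "M' \<in> mod_R" "N' \<in> mod_R" "projective P'" "projective Q'"
    "ds M' P' \<cong>\<^sub>R ds N' Q'"
    using assms(2) by (auto simp: stably_iso_def)
  have l: "left_module M" "left_module N" "left_module M'" "left_module N'"
    "left_module P" "left_module Q" "left_module P'" "left_module Q'"
    using 1 2 projective_mod_R mod_R_left_module by auto
  note [simp, intro] = l left_module_ds
  have a: "ds (ds M M') (ds P P') \<cong>\<^sub>R ds (ds M P) (ds M' P')" by (auto intro: ds_exchange)
  have b: "ds (ds M P) (ds M' P') \<cong>\<^sub>R ds (ds N Q) (ds N' Q')" using 1 2 by (auto intro: ds_cong)
  have c: "ds (ds N Q) (ds N' Q') \<cong>\<^sub>R ds (ds N N') (ds Q Q')" by (auto intro: ds_exchange)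
  have "ds (ds M M') (ds P P') \<cong>\<^sub>R ds (ds N N') (ds Q Q')"
    by (rule mod_iso_trans[OF _ a mod_iso_trans[OF _ b c]]) auto
  then show ?thesis by (rule stably_isoI[rotated -1]) (use 1 2 in \<open>auto intro: projective_ds
    mod_R_ds\<close>)
qed

lemma stably_iso_ds_projective:
  assumes "M \<in> mod_R" "projective P" shows "ds M P \<simeq> M"
proof (rule stably_isoI[OF mod_R_ds _ projective_zero_mod assms(2)])
  show "ds (ds M P) zero_mod \<cong>\<^sub>R ds M P"
    using assms by (intro ds_zero zero_mod) (auto intro: mod_R_left_module mod_R_ds
      projective_mod_R)
qed (use assms projective_mod_R in auto)

lemma stably_iso_projective:
  assumes "projective P" "projective Q" shows "P \<simeq> Q"
proof (rule stably_isoI[OF _ _ assms(2,1)])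
  show "ds P Q \<cong>\<^sub>R ds Q P" using assms by (intro ds_commute) (auto intro: mod_R_left_module
    projective_mod_R)
qed (use assms projective_mod_R in auto)

lemma projective_stably_iso:
  assumes "projective N" "M \<simeq> N" shows "projective M"
proof -
  obtain P Q where 1: "M \<in> mod_R" "N \<in> mod_R" "projective P" "projective Q" "ds M P \<cong>\<^sub>R ds N Q"
    using assms(2) by (auto simp: stably_iso_def)
  have "retract M (ds M P)" using 1 projective_mod_R retract_ds(1) by blast
  moreover have "retract (ds M P) (ds N Q)" using 1 projective_mod_R mod_R_ds retract_iso by blast
  ultimately show ?thesis using projective_retract retract_trans projective_ds assms(1) 1(4)
    by blast
qed

text \<open>Adding the projectives of the stable isomorphism to the middle and right terms, with
  kernel zero, turns both sequences into presentations of one module; Schanuel's lemma compares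
  their kernels.\<close>

lemma stably_iso_syzygies:
  assumes "ses K P M" "projective P" "ses L Q N" "projective Q" "M \<simeq> N"
  shows "K \<simeq> L"
proof -
  obtain P' Q' where 1: "M \<in> mod_R" "N \<in> mod_R" "projective P'" "projective Q'"
    "ds M P' \<cong>\<^sub>R ds N Q'"
    using assms(5) by (auto simp: stably_iso_def)
  have KL: "K \<in> mod_R" "L \<in> mod_R" using assms ses_mod_R by blast+
  have "ses (ds K zero_mod) (ds P P') (ds M P')" "ses (ds L zero_mod) (ds Q Q') (ds N Q')"
    using ses_ds assms ses_zero_left[OF projective_mod_R] 1 by blast+
  moreover have "ds K zero_mod \<cong>\<^sub>R K" "ds L zero_mod \<cong>\<^sub>R L"
    using KL by (auto intro: ds_zero zero_mod mod_R_left_module)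
  ultimately have "ses K (ds P P') (ds M P')" "ses L (ds Q Q') (ds N Q')"
    using ses_iso_left KL by blast+
  then have "ses K (ds P P') (ds N Q')" "ses L (ds Q Q') (ds N Q')"
    using ses_iso_right 1 mod_R_ds projective_mod_R by blast+
  moreover have "projective (ds P P')" "projective (ds Q Q')" using assms 1 projective_ds by auto
  ultimately show ?thesis using Schanuel KL stably_isoI by blast
qed

lemma stably_iso_syzygy:
  assumes "M \<simeq> N" shows "\<Omega> M \<simeq> \<Omega> N"
proof -
  obtain P where P: "projective P" "ses (\<Omega> M) P M" using syzygy_ses stably_iso_mod_R(1)[OF assms]
    by blast
  obtain Q where Q: "projective Q" "ses (\<Omega> N) Q N" using syzygy_ses stably_iso_mod_R(2)[OF assms]
    by blast
  show ?thesis by (rule stably_iso_syzygies[OF P(2,1) Q(2,1) assms])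
qed

text \<open>Any projective presentation computes the syzygy up to stable isomorphism. This admits
  the non-minimal presentations that come from the horseshoe and from arbitrary resolutions.\<close>

lemma stably_iso_syzygy_of:
  assumes "ses K P M" "projective P" shows "K \<simeq> \<Omega> M"
proof -
  have M: "M \<in> mod_R" using assms(1) ses_mod_R by blast
  obtain Q where Q: "projective Q" "ses (\<Omega> M) Q M" using syzygy_ses M by blast
  show ?thesis by (rule stably_iso_syzygies[OF assms Q(2,1) stably_iso_refl[OF M]])
qed

lemma stably_iso_syzygy_funpow: "M \<simeq> N \<Longrightarrow> (\<Omega> ^^ n) M \<simeq> (\<Omega> ^^ n) N"
  by (induction n) (auto intro: stably_iso_syzygy)

lemma stably_iso_syzygy_ds:
  assumes "A \<in> mod_R" "B \<in> mod_R" shows "\<Omega> (ds A B) \<simeq> ds (\<Omega> A) (\<Omega> B)"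
proof -
  obtain P where P: "projective P" "ses (\<Omega> A) P A" using syzygy_ses[OF assms(1)] .
  obtain Q where Q: "projective Q" "ses (\<Omega> B) Q B" using syzygy_ses[OF assms(2)] .
  show ?thesis
    using stably_iso_sym[OF stably_iso_syzygy_of[OF ses_ds[OF P(2) Q(2)] projective_ds[OF P(1)
      Q(1)]]] .
qed

lemma projective_syzygy:
  fixes P :: "('r, 'k) rmod"
  assumes "projective P" shows "projective (\<Omega> P)"
proof -
  have "P \<in> mod_R" using assms projective_mod_R by blast
  then obtain Q where Q: "projective Q" "ses (\<Omega> P) Q P" using syzygy_ses by blast
  have "Q \<cong>\<^sub>R ds (\<Omega> P) P" using ses_projective_split Q(2) assms .
  then have "projective (ds (\<Omega> P) P)"
    using projective_iso Q(1) mod_R_ds syzygy_mod_R \<open>P \<in> mod_R\<close> by blast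
  then show ?thesis using retract_ds(1) syzygy_mod_R \<open>P \<in> mod_R\<close> projective_retract by blast
qed

lemma projective_syzygy_funpow: "projective P \<Longrightarrow> projective ((\<Omega> ^^ n) P)"
  for P :: "('r, 'k) rmod"
  by (induction n) (auto intro: projective_syzygy)

lemma stably_iso_syzygy_pow:
  assumes "M \<in> mod_R" shows "\<Omega> (pow_mod M n) \<simeq> pow_mod (\<Omega> M) n"
proof (induction n)
  case 0
  then show ?case by (simp add: stably_iso_projective projective_syzygy projective_zero_mod)
next
  case (Suc n)
  have "\<Omega> (ds M (pow_mod M n)) \<simeq> ds (\<Omega> M) (\<Omega> (pow_mod M n))"
    using assms mod_R_pow stably_iso_syzygy_ds by blast
  also have "ds (\<Omega> M) (\<Omega> (pow_mod M n)) \<simeq> ds (\<Omega> M) (pow_mod (\<Omega> M) n)"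
    using Suc assms by (intro stably_iso_ds stably_iso_refl syzygy_mod_R)
  finally show ?case by simp
qed

lemma stably_iso_syzygy_funpow_pow:
  assumes "M \<in> mod_R" shows "(\<Omega> ^^ k) (pow_mod M n) \<simeq> pow_mod ((\<Omega> ^^ k) M) n"
proof (induction k)
  case 0
  then show ?case using assms by (simp add: stably_iso_refl mod_R_pow)
next
  case (Suc k)
  have "\<Omega> ((\<Omega> ^^ k) (pow_mod M n)) \<simeq> \<Omega> (pow_mod ((\<Omega> ^^ k) M) n)"
    using Suc stably_iso_syzygy by blast
  also have "\<Omega> (pow_mod ((\<Omega> ^^ k) M) n) \<simeq> pow_mod (\<Omega> ((\<Omega> ^^ k) M)) n"
    using assms stably_iso_syzygy_pow syzygy_funpow_mod_R by blast
  finally show ?case by simp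
qed

lemma stably_iso_syzygy_funpow_ds:
  assumes "A \<in> mod_R" "B \<in> mod_R" shows "(\<Omega> ^^ k) (ds A B) \<simeq> ds ((\<Omega> ^^ k) A) ((\<Omega> ^^ k) B)"
proof (induction k)
  case 0
  then show ?case using assms by (simp add: stably_iso_refl mod_R_ds)
next
  case (Suc k)
  have "\<Omega> ((\<Omega> ^^ k) (ds A B)) \<simeq> \<Omega> (ds ((\<Omega> ^^ k) A) ((\<Omega> ^^ k) B))"
    using Suc stably_iso_syzygy by blast
  also have "\<Omega> (ds ((\<Omega> ^^ k) A) ((\<Omega> ^^ k) B)) \<simeq> ds (\<Omega> ((\<Omega> ^^ k) A)) (\<Omega> ((\<Omega> ^^ k) B))"
    using assms stably_iso_syzygy_ds syzygy_funpow_mod_R by blast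
  finally show ?case by simp
qed

end

section \<open>Indecomposable modules\<close>

context finite_dimensional_algebra
begin

lemma indecomposable_mod_R: "indecomposable M \<Longrightarrow> M \<in> mod_R"
  by (simp add: indecomposable_def)

lemma indecomposable_ds:
  fixes M A B :: "('r, 'k) rmod"
  assumes "indecomposable M" "A \<in> mod_R" "B \<in> mod_R" "M \<cong>\<^sub>R ds A B"
  shows "zero_module A \<or> zero_module B"
  using assms mod_iso_direct_sum[OF mod_R_left_module] unfolding indecomposable_def by blast

lemma indecomposableI:
  fixes M :: "('r, 'k) rmod"
  assumes "M \<in> mod_R" "\<not> zero_module M"
    "\<And>A B :: ('r, 'k) rmod. A \<in> mod_R \<Longrightarrow> B \<in> mod_R \<Longrightarrow> M \<cong>\<^sub>R ds A B \<Longrightarrow> zero_module A \<or> zero_module B"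
  shows "indecomposable M"
  using assms mod_iso_direct_sum[OF mod_R_left_module[OF assms(1)]] unfolding indecomposable_def
  by blast

text \<open>By the Fitting decomposition \<open>Z\<close> is the sum of the kernel and the image of
  some \<open>f^n\<close>; indecomposability kills one of them, so \<open>f\<close> is bijective or
  nilpotent. This is the locality of the endomorphism ring in the form that the exchange argument
  uses.\<close>

lemma indecomposable_endomorphism:
  fixes Z :: "('r, 'k) rmod"
  assumes Z: "indecomposable Z" and f: "lin Z Z f"
  shows "(\<exists>n. \<forall>x\<in>carr Z. (f ^^ n) x = 0) \<or> bij_betw f (carr Z) (carr Z)"
proof -
  have ZR: "Z \<in> mod_R" using Z indecomposable_mod_R by blast
  have l: "left_module Z" and fl: "finite_length Z" using ZR mod_R_iff by auto
  obtain n where n: "n > 0"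
    "\<And>x. x \<in> carr Z \<Longrightarrow> \<exists>y z. y \<in> Ker Z (f ^^ n) \<and> z \<in> (f ^^ n) ` carr Z \<and> x = y + z"
    "Ker Z (f ^^ n) \<inter> (f ^^ n) ` carr Z = {0}"
    using finite_length_Fitting[OF l fl f] by metis
  define K where "K = Ker Z (f ^^ n)"
  define I where "I = (f ^^ n) ` carr Z"
  have lf: "lin Z Z (f ^^ n)" by (rule lin_funpow[OF f])
  have sK: "submodule Z K" unfolding K_def using l lf submodule_Ker by blast
  have sI: "submodule Z I" unfolding I_def using submodule_image[OF l lf submodule_carr[OF l]] .
  let ?K = "Z\<lparr>carr := K\<rparr>" and ?I = "Z\<lparr>carr := I\<rparr>"
  have KR: "?K \<in> mod_R" and IR: "?I \<in> mod_R" using mod_R_sub ZR sK sI by auto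
  have KZ: "K \<subseteq> carr Z" and IZ: "I \<subseteq> carr Z" using sK sI by (auto simp: submodule_def)
  have "ds ?K ?I \<cong>\<^sub>R Z"
  proof (rule mod_isoI[where f = "\<lambda>x. vfst x + vsnd x"])
    show "left_module (ds ?K ?I)" using KR IR by (intro left_module_ds mod_R_left_module)
    show "lin (ds ?K ?I) Z (\<lambda>x. vfst x + vsnd x)"
      using lin_copair[OF l lin_from_sub[OF lin_ident[of ?K]] lin_from_sub[OF lin_ident[of ?I]]]
        KZ IZ by simp
    fix x assume x: "x \<in> carr (ds ?K ?I)" "vfst x + vsnd x = 0"
    then have "vsnd x = - vfst x" by (simp add: eq_neg_iff_add_eq_0 add.commute)
    then have "vsnd x \<in> K" using x lm_uminus[OF mod_R_left_module[OF KR]] by simp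
    then have "vsnd x = 0" using x n(3) unfolding K_def I_def by auto
    then show "x = 0" using x by (auto intro: vpair_eqI)
  next
    fix x assume "x \<in> carr Z"
    then obtain y z where "y \<in> K" "z \<in> I" "x = y + z" using n(2) unfolding K_def I_def by blast
    then show "\<exists>w\<in>carr (ds ?K ?I). vfst w + vsnd w = x"
      by (intro bexI[of _ "vpair y z"]) auto
  qed
  then have "Z \<cong>\<^sub>R ds ?K ?I"
    using mod_iso_sym mod_R_left_module mod_R_ds[OF KR IR] l by blast
  then consider "zero_module ?K" | "zero_module ?I"
    using indecomposable_ds[OF Z KR IR] by blast
  then show ?thesis
  proof cases
    case 1
    then have K0: "K = {0}" by (simp add: zero_module_def)
    have "inj_on f (carr Z)"
    proof (rule lin_injI[OF l f])
      fix x assume x: "x \<in> carr Z" "f x = 0"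
      have "(f ^^ n) x = (f ^^ (n - 1)) (f x)" using n(1) by (cases n) (auto simp: funpow_swap1)
      then have "(f ^^ n) x = 0" using x lin_0[OF l lin_funpow[OF f]] by simp
      then show "x = 0" using x K0 by (auto simp: K_def Ker_def)
    qed
    moreover have "f ` carr Z = carr Z"
    proof
      show "f ` carr Z \<subseteq> carr Z" using f lin_closed by blast
      show "carr Z \<subseteq> f ` carr Z"
      proof
        fix x assume "x \<in> carr Z"
        then have "x \<in> I" using n(2) K0 unfolding K_def I_def by fastforce
        then obtain w where w: "w \<in> carr Z" "x = (f ^^ n) w" unfolding I_def by blast
        then have "x = f ((f ^^ (n - 1)) w)" using n(1) by (cases n) auto
        then show "x \<in> f ` carr Z" using w lin_closed[OF lin_funpow[OF f]] by blast
      qed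
    qed
    ultimately show ?thesis by (simp add: bij_betw_def)
  next
    case 2
    then have "I = {0}" by (simp add: zero_module_def)
    then show ?thesis unfolding I_def by blast
  qed
qed

text \<open>The Krull--Schmidt exchange argument: one of the two components of the identity of \<open>Z\<close> is
  an automorphism.\<close>

lemma indecomposable_retract_ds:
  fixes Z A B :: "('r, 'k) rmod"
  assumes Z: "indecomposable Z" and AB: "A \<in> mod_R" "B \<in> mod_R" and r: "retract Z (ds A B)"
  shows "retract Z A \<or> retract Z B"
proof -
  have ZR: "Z \<in> mod_R" using Z indecomposable_mod_R by blast
  have l: "left_module Z" "left_module A" "left_module B" using ZR AB mod_R_left_module by auto
  obtain i p where ip: "lin Z (ds A B) i" "lin (ds A B) Z p" "\<And>x. x \<in> carr Z \<Longrightarrow> p (i x) = x"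
    using r by (auto simp: retract_def)
  define a where "a = (\<lambda>x. p (vpair (vfst (i x)) 0))"
  define b where "b = (\<lambda>x. p (vpair 0 (vsnd (i x))))"
  note iA = lin_comp[OF ip(1) lin_vfst] and iB = lin_comp[OF ip(1) lin_vsnd]
  note pA = lin_comp[OF lin_inl[OF l(3)] ip(2)] and pB = lin_comp[OF lin_inr[OF l(2)] ip(2)]
  have a: "lin Z Z a" and b: "lin Z Z b"
    unfolding a_def b_def using lin_comp[OF iA pA] lin_comp[OF iB pB] by auto
  have ab: "a x + b x = x" if x: "x \<in> carr Z" for x
  proof -
    have "i x \<in> carr (ds A B)" using lin_closed[OF ip(1) x] .
    then have "p (vpair (vfst (i x)) 0 + vpair 0 (vsnd (i x))) = a x + b x"
      unfolding a_def b_def using lm_zero l by (intro lin_add[OF ip(2)]) auto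
    then show ?thesis using ip(3)[OF x] by (simp flip: vpair_add(5))
  qed
  \<comment> \<open>An automorphism of \<open>Z\<close> that factors through \<open>C\<close>
    exhibits \<open>Z\<close> as a retract of \<open>C\<close> after composition with its
    inverse.\<close>
  have finish: "retract Z C"
    if C: "C \<in> mod_R" "lin Z C j" "lin C Z q" and bij: "bij_betw (\<lambda>x. q (j x)) (carr Z) (carr Z)"
      for C j q
  proof -
    obtain g where g: "lin Z Z g" "\<And>x. x \<in> carr Z \<Longrightarrow> g (q (j x)) = x"
      using lin_inverse[OF l(1) lin_comp[OF C(2,3)] bij] by metis
    show ?thesis using retractI[OF ZR C(1,2) lin_comp[OF C(3) g(1)]] g(2) by blast
  qed
  from indecomposable_endomorphism[OF Z a] show ?thesis
  proof
    assume "bij_betw a (carr Z) (carr Z)"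
    then show ?thesis using finish[OF AB(1) iA pA] unfolding a_def by blast
  next
    assume "\<exists>n. \<forall>x\<in>carr Z. (a ^^ n) x = 0"
    then obtain n where n: "\<And>x. x \<in> carr Z \<Longrightarrow> (a ^^ n) x = 0" by blast
    \<comment> \<open>On the kernel of \<open>b\<close> the map \<open>a\<close> is the identity,
      because \<open>a + b\<close> is; a nilpotent \<open>a\<close> therefore forces
      \<open>b\<close> to be injective, and so not nilpotent, as \<open>Z\<close> is
      nonzero.\<close>
    have b0: "x = 0" if x: "x \<in> carr Z" "b x = 0" for x
    proof -
      have "a x = x" using ab x by fastforce
      then have "(a ^^ n) x = x" by (induction n) auto
      then show ?thesis using n x by simp
    qed
    have "\<not> (\<exists>m. \<forall>x\<in>carr Z. (b ^^ m) x = 0)"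
    proof
      assume "\<exists>m. \<forall>x\<in>carr Z. (b ^^ m) x = 0"
      then obtain m where m: "\<And>x. x \<in> carr Z \<Longrightarrow> (b ^^ m) x = 0" by blast
      have "x = 0" if "x \<in> carr Z" for x
      proof -
        have "(b ^^ k) x = 0 \<Longrightarrow> x = 0" for k
          using b0 lin_closed[OF lin_funpow[OF b] that] by (induction k) auto
        then show ?thesis using m that by blast
      qed
      then have "zero_module Z" using zero_module_iff[OF l(1)] by blast
      then show False using Z by (simp add: indecomposable_def)
    qed
    then have "bij_betw b (carr Z) (carr Z)" using indecomposable_endomorphism[OF Z b] by blast
    then show ?thesis using finish[OF AB(2) iB pB] unfolding b_def by blast
  qed
qed

lemma retract_zero:
  fixes Z M :: "('r, 'k) rmod"
  assumes "retract Z M" "zero_module M" shows "zero_module Z"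
proof -
  obtain i p where ip: "Z \<in> mod_R" "M \<in> mod_R" "lin Z M i" "lin M Z p" "\<forall>x\<in>carr Z. p (i x) = x"
    using assms(1) by (auto simp: retract_def)
  have l: "left_module Z" "left_module M" using ip mod_R_left_module by auto
  have "x = 0" if x: "x \<in> carr Z" for x
  proof -
    have "i x = 0" using assms(2) lin_closed[OF ip(3) x] by (simp add: zero_module_def)
    then show ?thesis using ip(5) x lin_0[OF l(2) ip(4)] by metis
  qed
  then show ?thesis using zero_module_iff[OF l(1)] by blast
qed

lemma retract_indecomposable_iso:
  fixes Z M :: "('r, 'k) rmod"
  assumes "retract Z M" "indecomposable M" "\<not> zero_module Z" shows "Z \<cong>\<^sub>R M"
proof -
  obtain L where L: "L \<in> mod_R" "M \<cong>\<^sub>R ds Z L" using retract_complement[OF assms(1)] .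
  have ZM: "Z \<in> mod_R" "M \<in> mod_R" using assms(1) by (auto simp: retract_def)
  then have "zero_module L" using indecomposable_ds[OF assms(2) _ L] assms(3) by blast
  then have "ds Z L \<cong>\<^sub>R Z" using ds_zero L ZM mod_R_left_module by blast
  then have "M \<cong>\<^sub>R Z" using mod_iso_trans[OF _ L(2)] ZM L mod_R_left_module mod_R_ds by blast
  then show ?thesis using mod_iso_sym ZM mod_R_left_module by blast
qed

lemma iso_image:
  fixes A M :: "('r, 'k) rmod"
  assumes "left_module A" "lin A M f" "inj_on f (carr A)"
  shows "A \<cong>\<^sub>R M\<lparr>carr := f ` carr A\<rparr>"
  unfolding mod_iso_iff[OF assms(1)] using lin_into_sub[OF assms(2) subset_refl] assms(3)
  by (intro exI[of _ f]) (simp add: bij_betw_def)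

text \<open>A minimal counterexample is sought among the submodules of \<open>M\<close>. Minimality
  speaks of submodules of \<open>M\<close> only, so the abstract summands \<open>A\<close> and
  \<open>B\<close> are replaced by their images, which are proper in the counterexample and hence
  satisfy \<open>P\<close>; the sum clause tolerates an isomorphism and returns to the
  counterexample.\<close>

lemma mod_R_induct [consumes 1, case_names zero indecomposable sum]:
  fixes M :: "('r, 'k) rmod"
  assumes M: "M \<in> mod_R"
    and zero: "\<And>Z :: ('r, 'k) rmod. Z \<in> mod_R \<Longrightarrow> zero_module Z \<Longrightarrow> P Z"
    and indec: "\<And>Z :: ('r, 'k) rmod. indecomposable Z \<Longrightarrow> P Z"
    and sum: "\<And>A B C :: ('r, 'k) rmod. A \<in> mod_R \<Longrightarrow> B \<in> mod_R \<Longrightarrow> C \<in> mod_R \<Longrightarrow> C \<cong>\<^sub>R ds A B \<Longrightarrow>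
      P A \<Longrightarrow> P B \<Longrightarrow> P C"
  shows "P M"
proof (rule ccontr)
  assume "\<not> P M"
  then have "\<not> P (M\<lparr>carr := carr M\<rparr>)" by simp
  moreover have l: "left_module M" and fl: "finite_length M" using M mod_R_iff by auto
  ultimately obtain T where T: "submodule M T" "\<not> P (M\<lparr>carr := T\<rparr>)"
    and min: "\<And>U. submodule M U \<Longrightarrow> \<not> P (M\<lparr>carr := U\<rparr>) \<Longrightarrow> U \<subseteq> T \<Longrightarrow> U = T"
    using finite_length_minimal[OF fl submodule_carr[OF l], of "\<lambda>U. \<not> P (M\<lparr>carr := U\<rparr>)"] by metis
  let ?N = "M\<lparr>carr := T\<rparr>"
  have N: "?N \<in> mod_R" using M T(1) mod_R_sub by blast
  have lN: "left_module ?N" using N mod_R_left_module by blast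
  have "\<not> zero_module ?N" "\<not> indecomposable ?N" using T(2) zero[OF N] indec by blast+
  then obtain A B :: "('r, 'k) rmod" where AB: "A \<in> mod_R" "B \<in> mod_R" "?N \<cong>\<^sub>R ds A B"
    "\<not> zero_module A" "\<not> zero_module B"
    using indecomposableI[OF N] by blast
  have lA: "left_module A" and lB: "left_module B" using AB mod_R_left_module by auto
  have "ds A B \<cong>\<^sub>R ?N" using AB(3) mod_iso_sym lN left_module_ds[OF lA lB] by blast
  then obtain f where f: "lin (ds A B) ?N f" "bij_betw f (carr (ds A B)) (carr ?N)"
    using mod_iso_iff[OF left_module_ds[OF lA lB]] by blast
  have finj: "inj_on f (carr (ds A B))" using f(2) by (simp add: bij_betw_def)
  have part: "P (M\<lparr>carr := h ` carr C\<rparr>) \<and> submodule M (h ` carr C) \<and> C \<cong>\<^sub>R M\<lparr>carr := h ` carr C\<rparr>"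
    if C: "C \<in> mod_R" "lin C (ds A B) j" "inj_on j (carr C)" and h: "h = (\<lambda>x. f (j x))"
      and y: "y \<in> carr (ds A B)" "y \<notin> j ` carr C" for C j h y
  proof -
    have lC: "left_module C" using C mod_R_left_module by blast
    have jc: "j x \<in> carr (ds A B)" if "x \<in> carr C" for x using lin_closed[OF C(2) that] .
    have hl: "lin C ?N h" unfolding h using lin_comp[OF C(2) f(1)] .
    have hinj: "inj_on h (carr C)"
      unfolding h by (rule inj_onI) (metis jc finj C(3) inj_onD)
    have sN: "submodule ?N (h ` carr C)" using submodule_image[OF lC hl submodule_carr[OF lC]] .
    then have sM: "submodule M (h ` carr C)" "h ` carr C \<subseteq> T" using submodule_sub_iff[OF T(1)]
      by auto
    have "f y \<notin> h ` carr C"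
    proof
      assume "f y \<in> h ` carr C"
      then obtain x where "x \<in> carr C" "f y = f (j x)" unfolding h by blast
      then have "y = j x" using finj y(1) jc by (metis inj_onD)
      then show False using y(2) \<open>x \<in> carr C\<close> by blast
    qed
    moreover have "f y \<in> T" using lin_closed[OF f(1) y(1)] by simp
    ultimately have "h ` carr C \<noteq> T" by blast
    then have "P (M\<lparr>carr := h ` carr C\<rparr>)" using min sM by blast
    then show ?thesis using sM iso_image[OF lC hl hinj] by simp
  qed
  obtain a where a: "a \<in> carr A" "a \<noteq> 0" using AB(4) zero_module_iff[OF lA] by blast
  obtain b where b: "b \<in> carr B" "b \<noteq> 0" using AB(5) zero_module_iff[OF lB] by blast
  let ?A = "M\<lparr>carr := (\<lambda>x. f (vpair x 0)) ` carr A\<rparr>" and ?B =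
    "M\<lparr>carr := (\<lambda>x. f (vpair 0 x)) ` carr B\<rparr>"
  have 1: "P ?A \<and> submodule M ((\<lambda>x. f (vpair x 0)) ` carr A) \<and> A \<cong>\<^sub>R ?A"
  proof (rule part[OF AB(1) lin_inl[OF lB] _ refl, where y = "vpair 0 b"])
    show "inj_on (\<lambda>x. vpair x 0) (carr A)" by (rule inj_onI) (metis vpair_simps(1))
    show "vpair 0 b \<notin> (\<lambda>x. vpair x 0) ` carr A" using b by (metis imageE vpair_simps(2))
  qed (use b lm_zero[OF lA] in auto)
  have 2: "P ?B \<and> submodule M ((\<lambda>x. f (vpair 0 x)) ` carr B) \<and> B \<cong>\<^sub>R ?B"
  proof (rule part[OF AB(2) lin_inr[OF lA] _ refl, where y = "vpair a 0"])
    show "inj_on (\<lambda>x. vpair 0 x) (carr B)" by (rule inj_onI) (metis vpair_simps(2))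
    show "vpair a 0 \<notin> (\<lambda>x. vpair 0 x) ` carr B" using a by (metis imageE vpair_simps(1))
  qed (use a lm_zero[OF lB] in auto)
  have R: "?A \<in> mod_R" "?B \<in> mod_R" using 1 2 M mod_R_sub by auto
  have "ds A B \<cong>\<^sub>R ds ?A ?B" using 1 2 R lA lB mod_R_left_module by (intro ds_cong) auto
  then have "?N \<cong>\<^sub>R ds ?A ?B"
    using mod_iso_trans[OF lN AB(3)] left_module_ds[OF lA lB] by blast
  then have "P ?N" using sum[OF R N] 1 2 by blast
  then show False using T(2) by blast
qed

section \<open>Projective dimension\<close>

text \<open>Discarding \<open>P 0\<close> leaves a resolution of \<open>Ker e\<close>, one step
  shorter, and \<open>Ker e\<close> is stably the syzygy of \<open>M\<close>. At length zero the
  augmentation itself is an isomorphism.\<close>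

lemma resolution_projective:
  fixes M :: "('r, 'k) rmod"
  assumes "proj_resolution P d e M" "\<forall>i>n. zero_module (P i)" "M \<in> mod_R"
  shows "projective ((\<Omega> ^^ n) M)"
  using assms
proof (induction n arbitrary: P d e M)
  case 0
  have P: "projective (P 0)" "e \<in> Hom (P 0) M" "e ` carr (P 0) = carr M"
    "d 0 \<in> Hom (P (Suc 0)) (P 0)"
    "d 0 ` carr (P 1) = Ker (P 0) e" "zero_module (P 1)" "projective (P 1)"
    using 0 by (auto simp: proj_resolution_def)
  have l: "left_module (P 0)" "left_module (P 1)"
    by (intro mod_R_left_module projective_mod_R P)+
  have "d 0 0 = 0" using lin_0[OF l(2)[unfolded One_nat_def] Hom_lin[OF P(4)]] .
  then have "Ker (P 0) e = {0}" using P(5,6) by (auto simp: zero_module_def)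
  then have "P 0 \<cong>\<^sub>R M"
  proof (intro mod_isoI[OF l(1) Hom_lin[OF P(2)]])
    show "\<exists>x\<in>carr (P 0). e x = y" if "y \<in> carr M" for y
      using that P(3) by (metis imageE)
  qed (auto simp: Ker_def)
  then show ?case using projective_iso P(1) 0(3) by simp
next
  case (Suc n)
  let ?K = "P 0\<lparr>carr := Ker (P 0) e\<rparr>"
  have P: "projective (P 0)" "e \<in> Hom (P 0) M" "e ` carr (P 0) = carr M"
    "\<And>n. projective (P n)" "\<And>n. d n \<in> Hom (P (Suc n)) (P n)" "d 0 ` carr (P 1) = Ker (P 0) e"
    "\<And>n. d (Suc n) ` carr (P (Suc (Suc n))) = Ker (P (Suc n)) (d n)"
    using Suc.prems by (auto simp: proj_resolution_def)
  have K: "ses ?K (P 0) M"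
    using ses_Ker[OF projective_mod_R[OF P(1)] Suc.prems(3) Hom_lin[OF P(2)] P(3)] .
  have "d 0 \<in> Hom (P 1) ?K"
    using P(5)[of 0] P(6) by (auto simp: Hom_def)
  then have "proj_resolution (\<lambda>n. P (Suc n)) (\<lambda>n. d (Suc n)) (d 0) ?K"
    unfolding proj_resolution_def using P by simp
  moreover have "\<forall>i>n. zero_module (P (Suc i))" using Suc.prems(2) by simp
  ultimately have "projective ((\<Omega> ^^ n) ?K)" using Suc.IH ses_mod_R(1)[OF K] by blast
  moreover have "(\<Omega> ^^ n) (\<Omega> M) \<simeq> (\<Omega> ^^ n) ?K"
    using stably_iso_syzygy_funpow[OF stably_iso_sym[OF stably_iso_syzygy_of[OF K P(1)]]] .
  ultimately show ?case using projective_stably_iso by (simp add: funpow_swap1)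
qed

text \<open>A resolution of \<open>\<Omega> M\<close> is spliced with the projective presentation of
  \<open>M\<close>: the new first differential is the augmentation followed by the inclusion of the
  syzygy.\<close>

lemma projective_resolution:
  fixes M :: "('r, 'k) rmod"
  assumes "projective ((\<Omega> ^^ n) M)" "M \<in> mod_R"
  shows "\<exists>P d e. proj_resolution P d e M \<and> (\<forall>i>n. zero_module (P i))"
  using assms
proof (induction n arbitrary: M)
  case 0
  have l: "left_module M" using 0 mod_R_left_module by blast
  let ?P = "\<lambda>i::nat. if i = 0 then M else zero_mod" and ?d =
    "\<lambda>_::nat. \<lambda>x\<in>{0::nat \<Rightarrow> 'k}. 0 :: nat \<Rightarrow> 'k"
  have "proj_resolution ?P ?d (restrict (\<lambda>x. x) (carr M)) M"
    unfolding proj_resolution_def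
  proof (intro conjI allI)
    fix n
    show "projective (?P n)" using 0 projective_zero_mod by simp
    show "restrict (\<lambda>x. x) (carr M) \<in> Hom (?P 0) M" using lin_restrict[OF l lin_ident] by simp
    show "?d n \<in> Hom (?P (Suc n)) (?P n)"
      using lm_zero[OF l] act_zero[OF l] by (auto simp: Hom_def zero_mod_def)
  qed (use lm_zero[OF l] in \<open>auto simp: Ker_def zero_mod_def\<close>)
  moreover have "\<forall>i>0. zero_module (?P i)" by (simp add: zero_mod(2))
  ultimately show ?case by blast
next
  case (Suc n)
  have "projective ((\<Omega> ^^ n) (\<Omega> M))" using Suc.prems by (simp add: funpow_swap1)
  then obtain P d e where P: "proj_resolution P d e (\<Omega> M)" "\<forall>i>n. zero_module (P i)"
    using Suc.IH syzygy_mod_R Suc.prems(2) by blast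
  then have P': "\<And>n. projective (P n)" "e \<in> Hom (P 0) (\<Omega> M)" "e ` carr (P 0) = carr (\<Omega> M)"
    "\<And>n. d n \<in> Hom (P (Suc n)) (P n)" "d 0 ` carr (P 1) = Ker (P 0) e"
    "\<And>n. d (Suc n) ` carr (P (Suc (Suc n))) = Ker (P (Suc n)) (d n)"
    by (auto simp: proj_resolution_def)
  obtain Q where Q: "projective Q" "ses (\<Omega> M) Q M" using syzygy_ses Suc.prems by blast
  obtain i p where *: "left_module (\<Omega> M)" "left_module Q" "lin (\<Omega> M) Q i" "inj_on i (carr (\<Omega> M))"
    "lin Q M p"
    "p ` carr Q = carr M" "i ` carr (\<Omega> M) = Ker Q p"
    using Q(2) by (rule sesE)
  have lP: "left_module (P 0)" using P'(1) projective_mod_R mod_R_left_module by blast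
  let ?P = "case_nat Q P" and ?d = "case_nat (restrict (\<lambda>x. i (e x)) (carr (P 0))) d" and ?e =
    "restrict p (carr Q)"
  have eK: "i (e x) = 0 \<longleftrightarrow> e x = 0" if "x \<in> carr (P 0)" for x
    using lin_closed[OF Hom_lin[OF P'(2)] that] lin_0[OF *(1,3)] lin_injD[OF *(1,3,4)] by auto
  have "proj_resolution ?P ?d ?e M"
    unfolding proj_resolution_def
  proof (intro conjI allI)
    fix n
    show "projective (?P n)" using Q P' by (auto split: nat.split)
    show "?e \<in> Hom (?P 0) M" "?e ` carr (?P 0) = carr M" using lin_restrict[OF *(2,5)] *(6) by auto
    show "?d n \<in> Hom (?P (Suc n)) (?P n)"
      using lin_restrict[OF lP lin_comp[OF Hom_lin[OF P'(2)] *(3)]] P'(4) by (auto split: nat.split)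
    have "i ` e ` carr (P 0) = Ker Q p" using P'(3) *(7) by simp
    then show "?d 0 ` carr (?P 1) = Ker (?P 0) ?e" by (auto simp: Ker_def image_image)
    show "?d (Suc n) ` carr (?P (Suc (Suc n))) = Ker (?P (Suc n)) (?d n)"
      using P'(5,6) eK by (auto simp: Ker_def split: nat.split)
  qed
  moreover have "\<forall>i>Suc n. zero_module (?P i)" using P(2) by (auto split: nat.split)
  ultimately show ?case by blast
qed

text \<open>The infimum over lengths is turned into a condition on one iterated syzygy, which can be
  followed through short exact sequences and direct sums.\<close>

lemma pd_le_iff:
  fixes M :: "('r, 'k) rmod"
  assumes "M \<in> mod_R"
  shows "pd M \<le> enat n \<longleftrightarrow> projective ((\<Omega> ^^ n) M)"
proof
  let ?A = "{enat n | n. \<exists>P d e. proj_resolution P d e M \<and> (\<forall>i>n. zero_module (P i))}"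
  assume le: "pd M \<le> enat n"
  \<comment> \<open>An infimum of a nonempty set of extended naturals is attained; the empty set
    would give \<open>\<infinity>\<close>, contrary to the finite bound.\<close>
  have "pd M \<in> ?A"
  proof (cases "?A = {}")
    case True
    have "pd M = \<infinity>" unfolding pd_def True by (simp add: Inf_enat_def)
    then show ?thesis using le by simp
  next
    case False
    then obtain a where "a \<in> ?A" by blast
    then show ?thesis unfolding pd_def by (rule wellorder_InfI)
  qed
  then obtain m P d e where m: "pd M = enat m" "proj_resolution P d e M" "\<forall>i>m. zero_module (P i)"
    by blast
  then have "\<forall>i>n. zero_module (P i)" using le by auto
  then show "projective ((\<Omega> ^^ n) M)" using resolution_projective m(2) assms by blast
next
  assume "projective ((\<Omega> ^^ n) M)"
  then show "pd M \<le> enat n"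
    unfolding pd_def using projective_resolution[OF _ assms] by (intro Inf_lower) blast
qed

lemma pd_less_infinity_iff:
  fixes M :: "('r, 'k) rmod"
  assumes "M \<in> mod_R"
  shows "pd M < \<infinity> \<longleftrightarrow> (\<exists>n. projective ((\<Omega> ^^ n) M))"
  unfolding pd_le_iff[OF assms, symmetric] by (cases "pd M") auto

section \<open>Iterated syzygies along short exact sequences\<close>

lemma ses_syzygy:
  assumes "ses A M B"
  obtains K where "ses (\<Omega> A) K (\<Omega> B)" "\<Omega> M \<simeq> K"
proof -
  obtain P where P: "projective P" "ses (\<Omega> A) P A" using syzygy_ses ses_mod_R(1)[OF assms] .
  obtain Q where Q: "projective Q" "ses (\<Omega> B) Q B" using syzygy_ses ses_mod_R(3)[OF assms] .
  \<comment> \<open>The kernel \<open>K\<close> of the horseshoe presentation is an extension of the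
    syzygies of the ends, but it is compared with \<open>\<Omega> M\<close> only up to
    projectives.\<close>
  obtain K where K: "ses K (ds P Q) M" "ses (\<Omega> A) K (\<Omega> B)"
    using horseshoe[OF assms P(2) Q(2,1)] .
  have "\<Omega> M \<simeq> K"
    using stably_iso_sym[OF stably_iso_syzygy_of[OF K(1) projective_ds[OF P(1) Q(1)]]] .
  then show thesis using that K(2) by blast
qed

lemma ses_projective_dimension:
  fixes M :: "('r, 'k) rmod"
  assumes "ses A M B" "projective ((\<Omega> ^^ n) A)" "projective ((\<Omega> ^^ n) B)"
  shows "projective ((\<Omega> ^^ n) M)"
  using assms
proof (induction n arbitrary: A M B)
  case 0
  then have "M \<cong>\<^sub>R ds A B" using ses_projective_split by simp
  then show ?case
    using 0 projective_iso projective_ds ses_mod_R mod_iso_sym mod_R_left_module mod_R_ds funpow_0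
    by metis
next
  case (Suc n)
  obtain K where K: "ses (\<Omega> A) K (\<Omega> B)" "\<Omega> M \<simeq> K" using ses_syzygy[OF Suc.prems(1)] .
  have "projective ((\<Omega> ^^ n) K)" using Suc.IH[OF K(1)] Suc.prems by (simp add: funpow_swap1)
  moreover have "(\<Omega> ^^ n) (\<Omega> M) \<simeq> (\<Omega> ^^ n) K"
    using stably_iso_syzygy_funpow[OF K(2)] .
  ultimately show ?case using projective_stably_iso by (simp add: funpow_swap1)
qed

text \<open>After \<open>n\<close> horseshoe steps the right end is projective, so the sequence
  splits and the middle term is the left one plus a projective summand.\<close>

lemma ses_stable_left:
  assumes "ses A M B" "projective ((\<Omega> ^^ n) B)"
  shows "(\<Omega> ^^ n) M \<simeq> (\<Omega> ^^ n) A"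
  using assms
proof (induction n arbitrary: A M B)
  case 0
  have "M \<cong>\<^sub>R ds A B" using ses_projective_split 0 by simp
  then have "M \<simeq> ds A B" using iso_stably_iso ses_mod_R[OF 0(1)] mod_R_ds by blast
  also have "ds A B \<simeq> A" using stably_iso_ds_projective ses_mod_R[OF 0(1)] 0(2) by simp
  finally show ?case by simp
next
  case (Suc n)
  obtain K where K: "ses (\<Omega> A) K (\<Omega> B)" "\<Omega> M \<simeq> K" using ses_syzygy[OF Suc.prems(1)] .
  have "(\<Omega> ^^ n) (\<Omega> M) \<simeq> (\<Omega> ^^ n) K"
    using stably_iso_syzygy_funpow[OF K(2)] .
  also have "(\<Omega> ^^ n) K \<simeq> (\<Omega> ^^ n) (\<Omega> A)"
    using Suc.IH[OF K(1)] Suc.prems by (simp add: funpow_swap1)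
  finally show ?case by (simp add: funpow_swap1)
qed

text \<open>With a projective left end the sequence need not split. But a projective
  \<open>A\<close> is its own presentation with kernel zero, so the horseshoe identifies a syzygy of
  \<open>M\<close> with one of \<open>B\<close>: this costs the extra step and is the source of
  \<open>Suc n\<close>.\<close>

lemma ses_stable_right:
  assumes "ses A M B" "projective ((\<Omega> ^^ n) A)"
  shows "(\<Omega> ^^ Suc n) M \<simeq> (\<Omega> ^^ Suc n) B"
  using assms
proof (induction n arbitrary: A M B)
  case 0
  have A: "projective A" "A \<in> mod_R" using 0 ses_mod_R by auto
  obtain Q where Q: "projective Q" "ses (\<Omega> B) Q B" using syzygy_ses ses_mod_R(3)[OF 0(1)] .
  obtain K where K: "ses K (ds A Q) M" "ses zero_mod K (\<Omega> B)"
    using horseshoe[OF 0(1) ses_zero_left[OF A(2)] Q(2,1)] .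
  have "K \<cong>\<^sub>R \<Omega> B" using ses_zero_left_iso[OF K(2)] .
  then have "K \<simeq> \<Omega> B" using iso_stably_iso ses_mod_R[OF K(2)] by blast
  moreover have "\<Omega> M \<simeq> K" using stably_iso_sym[OF stably_iso_syzygy_of[OF K(1) projective_ds[OF
    A(1) Q(1)]]] .
  ultimately show ?case using stably_iso_trans by simp
next
  case (Suc n)
  obtain K where K: "ses (\<Omega> A) K (\<Omega> B)" "\<Omega> M \<simeq> K" using ses_syzygy[OF Suc.prems(1)] .
  have "(\<Omega> ^^ Suc n) (\<Omega> M) \<simeq> (\<Omega> ^^ Suc n) K"
    using stably_iso_syzygy_funpow[OF K(2)] .
  also have "(\<Omega> ^^ Suc n) K \<simeq> (\<Omega> ^^ Suc n) (\<Omega> B)"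
    using Suc.IH[OF K(1)] Suc.prems by (simp add: funpow_swap1)
  finally show ?case by (simp add: funpow_swap1)
qed

section \<open>Modules generated stably by a fixed module\<close>

text \<open>Membership in the additive closure of \<open>Y\<close> and the projective modules; the
  multiplicity \<open>m\<close> and the projective \<open>P\<close> are forgotten.\<close>

definition in_add :: "('r, 'k) rmod \<Rightarrow> ('r, 'k) rmod \<Rightarrow> bool" where
  "in_add N Y \<longleftrightarrow> Y \<in> mod_R \<and> (\<exists>m P. projective P \<and> retract N (ds (pow_mod Y m) P))"

lemma in_add_retract: "retract N M \<Longrightarrow> in_add M Y \<Longrightarrow> in_add N Y"
  unfolding in_add_def using retract_trans by blast

lemma in_add_mod_R: "in_add N Y \<Longrightarrow> N \<in> mod_R"
  by (auto simp: in_add_def retract_def)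

lemma in_add_stably_iso:
  assumes "M \<simeq> N" "in_add N Y" shows "in_add M Y"
proof -
  obtain P Q where 1: "M \<in> mod_R" "N \<in> mod_R" "projective P" "projective Q" "ds M P \<cong>\<^sub>R ds N Q"
    using assms(1) by (auto simp: stably_iso_def)
  obtain m R where 2: "Y \<in> mod_R" "projective R" "retract N (ds (pow_mod Y m) R)"
    using assms(2) by (auto simp: in_add_def)
  have mR: "P \<in> mod_R" "Q \<in> mod_R" "R \<in> mod_R" "pow_mod Y m \<in> mod_R"
    using 1 2 projective_mod_R mod_R_pow by auto
  have "retract M (ds M P)" using retract_ds(1)[OF 1(1) mR(1)] .
  moreover have "retract (ds M P) (ds N Q)" using 1 mR mod_R_ds retract_iso by blast
  moreover have "retract (ds N Q) (ds (ds (pow_mod Y m) R) Q)"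
    using retract_ds_cong[OF 2(3) retract_refl] mR by blast
  moreover have "retract (ds (ds (pow_mod Y m) R) Q) (ds (pow_mod Y m) (ds R Q))"
    using mR by (intro retract_iso ds_assoc mod_R_ds) (auto intro: mod_R_left_module)
  ultimately have "retract M (ds (pow_mod Y m) (ds R Q))" using retract_trans by blast
  then show ?thesis unfolding in_add_def using 2 1 projective_ds by blast
qed

lemma in_add_pow: "Y \<in> mod_R \<Longrightarrow> in_add (pow_mod Y m) Y"
  unfolding in_add_def using retract_ds(1)[OF mod_R_pow mod_R_zero_mod] projective_zero_mod by blast

text \<open>A complement of \<open>N\<close> is carried along: the syzygies of \<open>N\<close> and
  of the complement add up, stably, to a power of \<open>\<Omega> Y\<close>, and
  \<open>\<Omega> N\<close> is a retract of that sum.\<close>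

lemma in_add_syzygy:
  assumes "in_add N Y" shows "in_add (\<Omega> N) (\<Omega> Y)"
proof -
  obtain m P where 1: "Y \<in> mod_R" "projective P" "retract N (ds (pow_mod Y m) P)"
    using assms by (auto simp: in_add_def)
  let ?D = "ds (pow_mod Y m) P"
  have mR: "P \<in> mod_R" "pow_mod Y m \<in> mod_R" using 1 projective_mod_R mod_R_pow by auto
  have D: "?D \<in> mod_R" using mod_R_ds mR by blast
  have N: "N \<in> mod_R" using assms in_add_mod_R by blast
  obtain L where L: "L \<in> mod_R" "?D \<cong>\<^sub>R ds N L" using retract_complement[OF 1(3)] .
  have "ds (\<Omega> N) (\<Omega> L) \<simeq> \<Omega> (ds N L)" using stably_iso_sym stably_iso_syzygy_ds N L by blast
  also have "\<Omega> (ds N L) \<simeq> \<Omega> ?D"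
    using stably_iso_syzygy iso_stably_iso[OF D mod_R_ds[OF N L(1)] L(2)] stably_iso_sym by blast
  also have "\<Omega> ?D \<simeq> \<Omega> (pow_mod Y m)"
    using stably_iso_syzygy stably_iso_ds_projective mR 1 by blast
  also have "\<Omega> (pow_mod Y m) \<simeq> pow_mod (\<Omega> Y) m" using stably_iso_syzygy_pow 1 by blast
  finally have "in_add (ds (\<Omega> N) (\<Omega> L)) (\<Omega> Y)"
    using in_add_stably_iso in_add_pow[OF syzygy_mod_R[OF 1(1)]] by blast
  then show ?thesis using in_add_retract retract_ds(1) syzygy_mod_R N L by blast
qed

lemma in_add_syzygy_funpow: "in_add N Y \<Longrightarrow> in_add ((\<Omega> ^^ n) N) ((\<Omega> ^^ n) Y)"
  by (induction n) (auto intro: in_add_syzygy)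

lemma in_add_projective:
  assumes "in_add N Y" "projective Y" shows "projective N"
proof -
  obtain m P where "projective P" "retract N (ds (pow_mod Y m) P)"
    using assms by (auto simp: in_add_def)
  then show ?thesis using projective_retract projective_ds projective_pow assms(2) by blast
qed

text \<open>The exchange argument is applied once to separate off the projective part and then once
  for each copy of \<open>Y\<close>.\<close>

lemma in_add_indecomposable:
  assumes "in_add Z Y" "indecomposable Z" shows "retract Z Y \<or> projective Z"
proof -
  obtain m P where *: "Y \<in> mod_R" "projective P" "retract Z (ds (pow_mod Y m) P)"
    using assms by (auto simp: in_add_def)
  have "retract Z (pow_mod Y m) \<Longrightarrow> retract Z Y"
  proof (induction m)
    case 0
    then have "zero_module Z" using retract_zero zero_mod(2) by simp
    then show ?case using assms(2) by (simp add: indecomposable_def)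
  next
    case (Suc m)
    then show ?case using indecomposable_retract_ds[OF assms(2) *(1) mod_R_pow[OF *(1)]] by auto
  qed
  then show ?thesis
    using indecomposable_retract_ds[OF assms(2) mod_R_pow[OF *(1)] projective_mod_R[OF *(2)] *(3)]
      projective_retract *(2) by blast
qed

lemma retract_in_add: "retract N Y \<Longrightarrow> in_add N Y"
proof -
  assume r: "retract N Y"
  then have Y: "Y \<in> mod_R" by (simp add: retract_def)
  have 1: "retract Y (ds Y zero_mod)" using retract_ds(1)[OF Y mod_R_zero_mod] .
  have 2: "retract (ds Y zero_mod) (ds (ds Y zero_mod) zero_mod)"
    using retract_ds(1)[OF mod_R_ds[OF Y mod_R_zero_mod] mod_R_zero_mod] .
  have "retract N (ds (pow_mod Y (Suc 0)) zero_mod)"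
    using retract_trans[OF r retract_trans[OF 1 2]] by simp
  then show ?thesis unfolding in_add_def using Y projective_zero_mod by blast
qed

text \<open>A retract of \<open>M\<close> lies in the additive closure of \<open>M\<close>, and
  syzygies preserve this membership.\<close>

lemma retract_pd_mono:
  fixes N :: "('r, 'k) rmod"
  assumes "retract N M" "projective ((\<Omega> ^^ n) M)" shows "projective ((\<Omega> ^^ n) N)"
  using in_add_projective[OF in_add_syzygy_funpow[OF retract_in_add[OF assms(1)]] assms(2)] .

end

section \<open>Extensions and filtrations\<close>

text \<open>The indices are listed from the top factor of the filtration down, so that only submodules and
  never quotient modules have to be formed.\<close>

fun factor_list :: "(nat \<Rightarrow> ('r::ring_1, 'k::field) rmod) \<Rightarrow> nat list \<Rightarrow> ('r, 'k) rmod \<Rightarrow> bool" where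
  "factor_list \<theta> [] M \<longleftrightarrow> zero_module M"
| "factor_list \<theta> (j # js) M \<longleftrightarrow>
     (\<exists>g. lin M (\<theta> j) g \<and> g ` carr M = carr (\<theta> j) \<and> factor_list \<theta> js (M\<lparr>carr := Ker M g\<rparr>))"

text \<open>The map \<open>h\<close> on cosets is traded for an epimorphism on elements, sending
  \<open>x\<close> to the value of \<open>h\<close> at the coset of \<open>x\<close>. Injectivity of
  \<open>h\<close> makes its kernel exactly \<open>S\<close>.\<close>

lemma quotient_iso_epi:
  assumes N: "left_module N" and S: "submodule N S" and q: "quotient_iso N S T"
  obtains g where "lin N T g" "g ` carr N = carr T" "Ker N g = S"
proof -
  obtain h where h: "bij_betw h ((\<lambda>x. (+) x ` S) ` carr N) (carr T)"
    "\<And>x y. x \<in> carr N \<Longrightarrow> y \<in> carr N \<Longrightarrow> h ((+) (x + y) ` S) = h ((+) x ` S) + h ((+) y ` S)"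
    "\<And>r x. x \<in> carr N \<Longrightarrow> h ((+) (act N r x) ` S) = act T r (h ((+) x ` S))"
    using q unfolding quotient_iso_def by blast
  define g where "g x = h ((+) x ` S)" for x
  have g: "lin N T g"
    by (rule linI) (use h bij_betwE[OF h(1)] in \<open>auto simp: g_def\<close>)
  have surj: "g ` carr N = carr T"
    using bij_betw_imp_surj_on[OF h(1)] by (simp add: g_def image_image)
  have S': "S \<subseteq> carr N" "0 \<in> S" "\<And>x y. x \<in> S \<Longrightarrow> y \<in> S \<Longrightarrow> x + y \<in> S" using S
    by (auto simp: submodule_def)
  have S0: "(+) 0 ` S = S" by simp
  have "Ker N g = S"
  proof
    show "Ker N g \<subseteq> S"
    proof
      fix x assume "x \<in> Ker N g"
      then have x: "x \<in> carr N" "g x = g 0" using lin_0[OF N g] by (auto simp: Ker_def)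
      then have "(+) x ` S = (+) 0 ` S"
        using inj_onD[OF bij_betw_imp_inj_on[OF h(1)], of "(+) x ` S" "(+) 0 ` S"] lm_zero[OF N]
        unfolding g_def by blast
      then show "x \<in> S" using S' S0 by (metis add.right_neutral imageI)
    qed
    show "S \<subseteq> Ker N g"
    proof
      fix x assume x: "x \<in> S"
      have "(+) x ` S = S"
      proof
        show "S \<subseteq> (+) x ` S"
          using submodule_diff[OF N S] x by (auto intro!: image_eqI[of _ _ "y - x" for y])
      qed (use S' x in auto)
      then have "g x = g 0" by (simp add: g_def)
      then show "x \<in> Ker N g" using x S' lin_0[OF N g] by (auto simp: Ker_def)
    qed
  qed
  then show thesis using that g surj by blast
qed

context finite_dimensional_algebra
begin

section \<open>Vanishing of Ext and extension of homomorphisms\<close>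

lemma exists_resolution:
  fixes M :: "('r, 'k) rmod"
  assumes "M \<in> mod_R"
  shows "\<exists>P d e. proj_resolution P d e M"
proof -
  define X where "X N Q i p \<longleftrightarrow> projective Q \<and> left_module Q \<and> left_module N \<and> left_module (\<Omega> N) \<and>
    lin (\<Omega> N) Q i \<and>
      inj_on i (carr (\<Omega> N)) \<and> lin Q N p \<and> p ` carr Q = carr N \<and> i ` carr (\<Omega> N) = Ker Q p"
    for N Q :: "('r, 'k) rmod" and i p
  have XQ: "\<forall>n. \<exists>Q i p. X ((\<Omega> ^^ n) M) Q i p"
  proof
    fix n
    obtain Q where Q: "projective Q" "ses (\<Omega> ((\<Omega> ^^ n) M)) Q ((\<Omega> ^^ n) M)"
      using syzygy_ses[OF syzygy_funpow_mod_R[OF assms]] .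
    show "\<exists>Q i p. X ((\<Omega> ^^ n) M) Q i p"
      unfolding X_def using Q(2) by (rule sesE) (use Q(1) in blast)
  qed
  from choice[OF XQ] obtain Q where Q: "\<forall>n. \<exists>i p. X ((\<Omega> ^^ n) M) (Q n) i p" by blast
  from choice[OF Q] obtain i where i: "\<forall>n. \<exists>p. X ((\<Omega> ^^ n) M) (Q n) (i n) p" by blast
  from choice[OF i] obtain p where X: "\<And>n. X ((\<Omega> ^^ n) M) (Q n) (i n) (p n)" by blast
  then have *: "\<And>n. projective (Q n)" "\<And>n. left_module (Q n)" "\<And>n. left_module ((\<Omega> ^^ n) M)"
    "\<And>n. left_module (\<Omega> ((\<Omega> ^^ n) M))" "\<And>n. lin (\<Omega> ((\<Omega> ^^ n) M)) (Q n) (i n)"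
    "\<And>n. inj_on (i n) (carr (\<Omega> ((\<Omega> ^^ n) M)))" "\<And>n. lin (Q n) ((\<Omega> ^^ n) M) (p n)"
    "\<And>n. p n ` carr (Q n) = carr ((\<Omega> ^^ n) M)" "\<And>n. i n ` carr (\<Omega> ((\<Omega> ^^ n) M)) = Ker (Q n) (p n)"
    by (simp_all only: X_def)
  \<comment> \<open>The \<open>n\<close>-th differential is the projection onto the next syzygy
    followed by its inclusion into \<open>Q n\<close>; as the inclusion is injective, it has the
    kernel of the projection. Existence of a resolution is what gives the choice inside
    \<open>Ext1\<close> its meaning.\<close>
  define d where "d n = (\<lambda>x\<in>carr (Q (Suc n)). i n (p (Suc n) x))" for n
  have lp: "lin (Q (Suc n)) (\<Omega> ((\<Omega> ^^ n) M)) (p (Suc n))" for n using *(7)[of "Suc n"] by simp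
  have dHom: "d n \<in> Hom (Q (Suc n)) (Q n)" for n
    unfolding d_def by (rule lin_restrict[OF *(2) lin_comp[OF lp *(5)]])
  have dim: "d n ` carr (Q (Suc n)) = Ker (Q n) (p n)" for n
  proof -
    have "d n ` carr (Q (Suc n)) = i n ` p (Suc n) ` carr (Q (Suc n))"
      by (simp add: d_def image_image)
    then show ?thesis using *(8)[of "Suc n"] *(9)[of n] by simp
  qed
  have dker: "Ker (Q (Suc n)) (d n) = Ker (Q (Suc n)) (p (Suc n))" for n
  proof -
    have "i n (p (Suc n) x) = 0 \<longleftrightarrow> p (Suc n) x = 0" if "x \<in> carr (Q (Suc n))" for x
      using lin_0[OF *(4,5)] lin_injD[OF *(4,5,6) lin_closed[OF lp that]] by auto
    then show ?thesis by (auto simp: Ker_def d_def)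
  qed
  have "proj_resolution Q d (restrict (p 0) (carr (Q 0))) M"
    unfolding proj_resolution_def
    using *(1) lin_restrict[OF *(2) *(7)[of 0]] *(8)[of 0] dHom dim dker
    by (auto simp: Ker_def)
  then show ?thesis by blast
qed

text \<open>In a trivial quotient the only coset is the set of coboundaries itself, and a cocycle
  lies in its own coset because the zero map is a coboundary.\<close>

lemma Ext1_trivial_cocycles:
  fixes M N :: "('r, 'k) rmod"
  assumes "trivial_group (Ext1 M N)" "M \<in> mod_R" "N \<in> mod_R"
  obtains P d e where "proj_resolution P d e M" "cocycles1 P d N \<subseteq> coboundaries1 P d N"
proof -
  have N: "left_module N" using assms mod_R_left_module by blast
  obtain P d where Pd: "(SOME (P, d). \<exists>e. proj_resolution P d e M) = (P, d)"
    by (cases "SOME (P, d). \<exists>e. proj_resolution P d e M")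
  have "\<exists>x. case x of (P, d) \<Rightarrow> \<exists>e. proj_resolution P d e M" using exists_resolution[OF assms(2)]
    by auto
  then have "case (SOME (P, d). \<exists>e. proj_resolution P d e M) of (P, d) \<Rightarrow> \<exists>e. proj_resolution P d e
    M"
    by (rule someI_ex)
  then obtain e where e: "proj_resolution P d e M" using Pd by auto
  let ?G = "(Hom_group (P 1) N)\<lparr>carrier := cocycles1 P d N\<rparr>" and ?H = "coboundaries1 P d N"
  have "Ext1 M N = ?G Mod ?H" unfolding Ext1_def Pd by simp
  then have c: "carrier (?G Mod ?H) = {\<one>\<^bsub>?G Mod ?H\<^esub>}" using assms(1)
    by (simp add: trivial_group_def)
  have P: "left_module (P 0)" "lin (P 1) (P 0) (d 0)"
    using e by (auto simp: proj_resolution_def intro: projective_mod_R mod_R_left_module Hom_lin)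
  have "(\<lambda>x\<in>carr (P 1). 0) \<in> ?H"
    unfolding coboundaries1_def
  proof (rule image_eqI)
    show "(\<lambda>x\<in>carr (P 0). 0) \<in> Hom (P 0) N" using lin_restrict[OF P(1) lin_zero[OF N]] .
    show "(\<lambda>x\<in>carr (P 1). 0) = compose (carr (P 1)) (\<lambda>x\<in>carr (P 0). 0) (d 0)"
      using lin_closed[OF P(2)] by (auto simp: compose_def fun_eq_iff)
  qed
  moreover have "f \<in> ?H" if f: "f \<in> cocycles1 P d N" and z: "(\<lambda>x\<in>carr (P 1). 0) \<in> ?H" for f
  proof -
    have "?H #>\<^bsub>?G\<^esub> f \<in> carrier (?G Mod ?H)" using f by (auto simp: FactGroup_def RCOSETS_def)
    then have eq: "?H #>\<^bsub>?G\<^esub> f = ?H" using c by (simp add: FactGroup_def)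
    have "f \<in> extensional (carr (P 1))" using f by (auto simp: cocycles1_def Hom_def PiE_def)
    then have 0: "(\<lambda>x\<in>carr (P 1). (\<lambda>x\<in>carr (P 1). 0) x + f x) = f"
      by (auto simp: fun_eq_iff extensional_def)
    have "(\<lambda>x\<in>carr (P 1). 0) \<otimes>\<^bsub>?G\<^esub> f = (\<lambda>x\<in>carr (P 1). (\<lambda>x\<in>carr (P 1). 0) x + f x)"
      by (simp add: Hom_group_def)
    then have "(\<lambda>x\<in>carr (P 1). 0) \<otimes>\<^bsub>?G\<^esub> f = f" using 0 by (rule trans)
    then have "f \<in> ?H #>\<^bsub>?G\<^esub> f" unfolding r_coset_def using z by blast
    then show ?thesis using eq by simp
  qed
  ultimately have "cocycles1 P d N \<subseteq> ?H" by blast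
  then show thesis using that e by blast
qed

text \<open>This is the surjectivity of restriction from \<open>Hom(Z, N)\<close> to
  \<open>Hom(Ker g, N)\<close> in the long exact sequence, carried out on elements. The obstruction
  to extending \<open>h\<close> is the cocycle \<open>h \<circ> \<epsilon> \<circ> d 0\<close>,
  where \<open>\<epsilon>\<close> lifts the augmentation to \<open>Z\<close>; since it equals
  \<open>u \<circ> d 0\<close>, the maps \<open>h \<circ> \<epsilon>\<close> and \<open>u\<close>
  agree on \<open>Ker e\<close>.\<close>

lemma Ext1_trivial_extend:
  fixes M N Z :: "('r, 'k) rmod"
  assumes ext: "trivial_group (Ext1 M N)" and R: "M \<in> mod_R" "N \<in> mod_R" "Z \<in> mod_R"
    and g: "lin Z M g" "g ` carr Z = carr M" and h: "lin (Z\<lparr>carr := Ker Z g\<rparr>) N h"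
  obtains H where "lin Z N H" "\<And>x. x \<in> Ker Z g \<Longrightarrow> H x = h x"
proof -
  obtain P d e where P: "proj_resolution P d e M" and co: "cocycles1 P d N \<subseteq> coboundaries1 P d N"
    using Ext1_trivial_cocycles[OF ext R(1,2)] .
  have P': "\<forall>n. projective (P n)" "e \<in> Hom (P 0) M" "e ` carr (P 0) = carr M"
    "\<forall>n. d n \<in> Hom (P (Suc n)) (P n)" "d 0 ` carr (P 1) = Ker (P 0) e"
    "\<forall>n. d (Suc n) ` carr (P (Suc (Suc n))) = Ker (P (Suc n)) (d n)"
    using P unfolding proj_resolution_def by simp_all
  have P0: "projective (P 0)" using P'(1) by blast
  note e = Hom_lin[OF P'(2)] P'(3)
  have d0: "lin (P 1) (P 0) (d 0)" "d 0 ` carr (P 1) = Ker (P 0) e"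
    using Hom_lin[OF P'(4)[rule_format, of 0]] P'(5) by (simp_all only: One_nat_def)
  have d1: "d 1 ` carr (P 2) = Ker (P 1) (d 0)"
    using P'(6)[rule_format, of 0] by (simp only: One_nat_def numeral_2_eq_2)
  have P1: "projective (P 1)" using P'(1) by blast
  have l: "left_module (P 0)" "left_module (P 1)" "left_module Z" "left_module M" "left_module N"
    by (intro mod_R_left_module projective_mod_R P0 P1 R)+
  let ?K = "Z\<lparr>carr := Ker Z g\<rparr>"
  have lK: "left_module ?K" using submodule_left_module[OF l(3) submodule_Ker[OF l(3,4) g(1)]] .
  have Kc: "x \<in> carr ?K \<longleftrightarrow> x \<in> carr Z \<and> g x = 0" for x by (auto simp: Ker_def)
  obtain \<epsilon> where \<epsilon>: "lin (P 0) Z \<epsilon>" "\<And>x. x \<in> carr (P 0) \<Longrightarrow> g (\<epsilon> x) = e x"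
    using projective_lift[OF P0 R(3,1) g e(1)] by blast
  have d0K: "d 0 y \<in> carr (P 0)" "e (d 0 y) = 0" if "y \<in> carr (P 1)" for y
    using d0(2) that by (auto simp: Ker_def)
  have "lin (P 1) ?K (\<lambda>x. \<epsilon> (d 0 x))"
    by (rule lin_into_sub[OF lin_comp[OF d0(1) \<epsilon>(1)]])
      (use d0K \<epsilon>(2) lin_closed[OF \<epsilon>(1)] in \<open>auto simp: Ker_def\<close>)
  then have f: "lin (P 1) N (\<lambda>x. h (\<epsilon> (d 0 x)))" using lin_comp h by blast
  have "(\<lambda>x\<in>carr (P 1). h (\<epsilon> (d 0 x))) \<in> cocycles1 P d N"
    unfolding cocycles1_def
  proof (intro CollectI conjI ballI)
    show "(\<lambda>x\<in>carr (P 1). h (\<epsilon> (d 0 x))) \<in> Hom (P 1) N" using lin_restrict[OF l(2) f] .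
    fix x assume "x \<in> carr (P 2)"
    then have "d 1 x \<in> carr (P 1)" "d 0 (d 1 x) = 0" using d1 by (auto simp: Ker_def)
    then show "(\<lambda>x\<in>carr (P 1). h (\<epsilon> (d 0 x))) (d 1 x) = 0"
      using lin_0[OF l(1) \<epsilon>(1)] lin_0[OF lK h] by simp
  qed
  then obtain u where u: "u \<in> Hom (P 0) N"
    "(\<lambda>x\<in>carr (P 1). h (\<epsilon> (d 0 x))) = compose (carr (P 1)) u (d 0)"
    using co unfolding coboundaries1_def by blast
  have ul: "lin (P 0) N u" using u(1) Hom_lin by blast
  have ud: "h (\<epsilon> (d 0 y)) = u (d 0 y)" if "y \<in> carr (P 1)" for y
    using fun_cong[OF u(2), of y] that by (simp add: compose_def)
  have hu: "h (\<epsilon> x) = u x" if "x \<in> carr (P 0)" "e x = 0" for x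
  proof -
    have "x \<in> d 0 ` carr (P 1)" using that d0(2) by (auto simp: Ker_def)
    then show ?thesis using ud by blast
  qed
  \<comment> \<open>\<open>lft\<close> is a mere choice of preimages under \<open>e\<close> and need
    not be linear. The formula for \<open>H\<close> gives the same value for every preimage
    \<open>q\<close> of \<open>g z\<close>, so linearity follows by using sums and multiples of
    preimages.\<close>
  define lft where "lft z = (SOME q. q \<in> carr (P 0) \<and> e q = g z)" for z
  have lft: "lft z \<in> carr (P 0)" "e (lft z) = g z" if z: "z \<in> carr Z" for z
  proof -
    have "g z \<in> e ` carr (P 0)" using z e(2) lin_closed[OF g(1)] by simp
    then have "\<exists>q. q \<in> carr (P 0) \<and> e q = g z" by fastforce
    then show "lft z \<in> carr (P 0)" "e (lft z) = g z" unfolding lft_def by (rule someI2_ex, simp)+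
  qed
  define H where "H z = h (z - \<epsilon> (lft z)) + u (lft z)" for z
  have zK: "z - \<epsilon> q \<in> carr ?K" if "z \<in> carr Z" "q \<in> carr (P 0)" "e q = g z" for z q
    using that \<epsilon> lin_closed[OF \<epsilon>(1)] unfolding Kc
    by (auto simp: lin_diff[OF l(3) g(1)] lm_diff[OF l(3)])
  have H: "H z = h (z - \<epsilon> q) + u q" if z: "z \<in> carr Z" and q: "q \<in> carr (P 0)" "e q = g z" for z q
  proof -
    let ?q = "lft z"
    have q': "?q \<in> carr (P 0)" "e ?q = g z" using lft z by auto
    have dq: "q - ?q \<in> carr (P 0)" "e (q - ?q) = 0"
      using q q' by (auto simp: lm_diff[OF l(1)] lin_diff[OF l(1) e(1)])
    have "(z - \<epsilon> q) + \<epsilon> (q - ?q) = z - \<epsilon> ?q" using q q' by (simp add: lin_diff[OF l(1) \<epsilon>(1)])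
    moreover have "\<epsilon> (q - ?q) \<in> carr ?K" unfolding Kc using dq \<epsilon> lin_closed[OF \<epsilon>(1)] by auto
    ultimately have "h (z - \<epsilon> ?q) = h (z - \<epsilon> q) + h (\<epsilon> (q - ?q))"
      using lin_add[OF h zK[OF z q]] by metis
    also have "h (\<epsilon> (q - ?q)) = u q - u ?q" using hu[OF dq] q q' by (simp add: lin_diff[OF l(1) ul])
    finally show ?thesis unfolding H_def by (simp only: add.assoc diff_add_cancel)
  qed
  have "lin Z N H"
  proof (rule linI)
    fix z assume z: "z \<in> carr Z"
    show "H z \<in> carr N"
      unfolding H_def using zK[OF z lft[OF z]] lft[OF z] lin_closed[OF h] lin_closed[OF ul]
        lm_add[OF l(5)] by blast
    fix r
    have 1: "act (P 0) r (lft z) \<in> carr (P 0)" "e (act (P 0) r (lft z)) = g (act Z r z)"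
      using lft[OF z] lm_act[OF l(1)] lin_act[OF e(1)] lin_act[OF g(1) z] by auto
    have "act Z r z - \<epsilon> (act (P 0) r (lft z)) = act Z r (z - \<epsilon> (lft z))"
      using z lft[OF z] lin_closed[OF \<epsilon>(1)] by (simp add: act_diff[OF l(3)] lin_act[OF \<epsilon>(1)])
    then have "H (act Z r z) = h (act Z r (z - \<epsilon> (lft z))) + act N r (u (lft z))"
      using H[OF lm_act[OF l(3) z] 1] lft[OF z] by (simp add: lin_act[OF ul])
    also have "h (act Z r (z - \<epsilon> (lft z))) = act N r (h (z - \<epsilon> (lft z)))"
      using lin_act[OF h zK[OF z lft[OF z]], of r] by simp
    also have "act N r (h (z - \<epsilon> (lft z))) + act N r (u (lft z)) = act N r (H z)"
      unfolding H_def
      using act_add[OF l(5) lin_closed[OF h zK[OF z lft[OF z]]] lin_closed[OF ul lft(1)[OF z]]]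
      by simp
    finally show "H (act Z r z) = act N r (H z)" .
  next
    fix z w assume zw: "z \<in> carr Z" "w \<in> carr Z"
    note z = lft[OF zw(1)] and w = lft[OF zw(2)]
    have 1: "lft z + lft w \<in> carr (P 0)" "e (lft z + lft w) = g (z + w)"
      using z w lm_add[OF l(1)] lin_add[OF e(1)] lin_add[OF g(1) zw] by auto
    have 2: "z + w - \<epsilon> (lft z + lft w) = (z - \<epsilon> (lft z)) + (w - \<epsilon> (lft w))"
      by (simp only: lin_add[OF \<epsilon>(1) z(1) w(1)] add_diff_add)
    have "h (z + w - \<epsilon> (lft z + lft w)) = h (z - \<epsilon> (lft z)) + h (w - \<epsilon> (lft w))"
      unfolding 2 using lin_add[OF h zK[OF zw(1) z] zK[OF zw(2) w]] .
    then show "H (z + w) = H z + H w"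
      using H[OF lm_add[OF l(3) zw] 1] z w by (simp add: H_def lin_add[OF ul])
  qed
  moreover have "H x = h x" if x: "x \<in> Ker Z g" for x
  proof -
    have "H x = h (x - \<epsilon> 0) + u 0"
      using x lm_zero[OF l(1)] lin_0[OF l(1) e(1)] by (intro H) (auto simp: Ker_def)
    then show ?thesis using lin_0[OF l(1) \<epsilon>(1)] lin_0[OF l(1) ul] by simp
  qed
  ultimately show thesis using that by blast
qed

lemma Ext1_trivial_extend_pow:
  fixes M N Z :: "('r, 'k) rmod"
  assumes ext: "trivial_group (Ext1 M N)" and R: "M \<in> mod_R" "N \<in> mod_R" "Z \<in> mod_R"
    and g: "lin Z M g" "g ` carr Z = carr M"
  shows "lin (Z\<lparr>carr := Ker Z g\<rparr>) (pow_mod N m) h \<Longrightarrow> \<exists>H. lin Z (pow_mod N m) H \<and>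
    (\<forall>x\<in>Ker Z g. H x = h x)"
proof (induction m arbitrary: h)
  case 0
  have "H x = h x" if "x \<in> Ker Z g" "H = (\<lambda>x. 0)" for H x
    using lin_closed[OF 0, of x] that by (simp add: zero_mod_def)
  then show ?case using lin_zero[OF zero_mod(1)] by force
next
  case (Suc m)
  then have h: "lin (Z\<lparr>carr := Ker Z g\<rparr>) (ds N (pow_mod N m)) h" by simp
  obtain F where F: "lin Z N F" "\<And>x. x \<in> Ker Z g \<Longrightarrow> F x = vfst (h x)"
    using Ext1_trivial_extend[OF ext R g lin_comp[OF h lin_vfst]] by blast
  obtain G where G: "lin Z (pow_mod N m) G" "\<forall>x\<in>Ker Z g. G x = vsnd (h x)"
    using Suc.IH[OF lin_comp[OF h lin_vsnd]] by blast
  show ?case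
    using lin_vpair[OF F(1) G(1)] F(2) G(2) by (intro exI[of _ "\<lambda>x. vpair (F x) (G x)"]) auto
qed

text \<open>The map \<open>h\<close> on the kernel of \<open>g\<close> extends to all of \<open>M\<close>, and the kernel of the extension still
  maps onto \<open>\<theta> j\<close>.\<close>

lemma factor_list_swap:
  fixes M :: "('r, 'k) rmod"
  assumes "factor_list \<theta> (j # i # js) M" "trivial_group (Ext1 (\<theta> j) (\<theta> i))"
    and R: "\<theta> j \<in> mod_R" "\<theta> i \<in> mod_R" "M \<in> mod_R"
  shows "factor_list \<theta> (i # j # js) M"
proof -
  obtain g h where g: "lin M (\<theta> j) g" "g ` carr M = carr (\<theta> j)"
    and h: "lin (M\<lparr>carr := Ker M g\<rparr>) (\<theta> i) h" "h ` Ker M g = carr (\<theta> i)"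
    and fl: "factor_list \<theta> js (M\<lparr>carr := Ker (M\<lparr>carr := Ker M g\<rparr>) h\<rparr>)"
    using assms(1) by auto
  obtain H where H: "lin M (\<theta> i) H" "\<And>x. x \<in> Ker M g \<Longrightarrow> H x = h x"
    using Ext1_trivial_extend[OF assms(2) R g h(1)] by blast
  have l: "left_module M" using R mod_R_left_module by blast
  have Ks: "Ker M g \<subseteq> carr M" "Ker M H \<subseteq> carr M" by (auto simp: Ker_def)
  have hit: "\<exists>x\<in>Ker M g. H x = y" if "y \<in> carr (\<theta> i)" for y
  proof -
    have "y \<in> h ` Ker M g" using that h(2) by simp
    then show ?thesis using H(2) by fastforce
  qed
  have "H ` carr M = carr (\<theta> i)"
  proof
    show "carr (\<theta> i) \<subseteq> H ` carr M" using hit Ks by fastforce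
  qed (use lin_closed[OF H(1)] in auto)
  \<comment> \<open>A preimage \<open>m\<close> of \<open>y\<close> is moved into
    \<open>Ker H\<close> by subtracting an element of \<open>Ker g\<close> with the same
    \<open>H\<close>-value, which exists because \<open>h\<close> is onto
    \<open>\<theta> i\<close>.\<close>
  moreover have "g ` Ker M H = carr (\<theta> j)"
  proof
    show "carr (\<theta> j) \<subseteq> g ` Ker M H"
    proof
      fix y assume "y \<in> carr (\<theta> j)"
      then obtain m where m: "m \<in> carr M" "g m = y" using g(2) by (metis imageE)
      obtain x where x: "x \<in> Ker M g" "H x = H m" using hit[OF lin_closed[OF H(1) m(1)]] by blast
      have xM: "x \<in> carr M" "g x = 0" using x(1) by (auto simp: Ker_def)
      then have "m - x \<in> Ker M H" "g (m - x) = y"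
        using m x by (auto simp: Ker_def lm_diff[OF l] lin_diff[OF l H(1)] lin_diff[OF l g(1)])
      then show "y \<in> g ` Ker M H" by blast
    qed
  qed (use lin_closed[OF g(1)] Ks in auto)
  \<comment> \<open>Both orders end in the common kernel of \<open>g\<close> and \<open>H\<close>,
    so the remaining factors \<open>js\<close> are untouched.\<close>
  moreover have "Ker (M\<lparr>carr := Ker M H\<rparr>) g = Ker (M\<lparr>carr := Ker M g\<rparr>) h"
    using H(2) by (auto simp: Ker_def)
  ultimately show ?thesis
    unfolding factor_list.simps using H(1) lin_sub[OF Ks(2) g(1)] fl
    by (intro exI[of _ H] conjI exI[of _ g]) simp_all
qed

text \<open>The top factor \<open>a\<close> sinks past factors of smaller index until it meets one
  that is not smaller. Lists run from the top down, so an increasing list has the large indices at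
  the bottom.\<close>

lemma factor_list_insort:
  fixes M :: "('r, 'k) rmod"
  assumes "factor_list \<theta> (a # xs) M" "\<And>i. i \<in> set xs \<Longrightarrow> i \<le> a \<Longrightarrow> trivial_group (Ext1 (\<theta> a) (\<theta> i))"
    and R: "\<And>i. i \<in> set (a # xs) \<Longrightarrow> \<theta> i \<in> mod_R" "M \<in> mod_R"
  shows "factor_list \<theta> (insort a xs) M"
  using assms
proof (induction xs arbitrary: M)
  case (Cons x xs)
  show ?case
  proof (cases "a \<le> x")
    case False
    then have "factor_list \<theta> (x # a # xs) M"
      using factor_list_swap[OF Cons.prems(1) Cons.prems(2)[of x]] Cons.prems(3,4) by simp
    then obtain g where g: "lin M (\<theta> x) g" "g ` carr M = carr (\<theta> x)"
      "factor_list \<theta> (a # xs) (M\<lparr>carr := Ker M g\<rparr>)" by auto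
    have "factor_list \<theta> (insort a xs) (M\<lparr>carr := Ker M g\<rparr>)"
      using g Cons.prems mod_R_Ker[OF Cons.prems(4) _ g(1)] by (intro Cons.IH) auto
    then show ?thesis using g False by auto
  qed (use Cons.prems in simp)
qed simp

lemma factor_list_sort:
  fixes M :: "('r, 'k) rmod"
  assumes "factor_list \<theta> xs M"
    "\<And>i j. i \<in> set xs \<Longrightarrow> j \<in> set xs \<Longrightarrow> i \<le> j \<Longrightarrow> trivial_group (Ext1 (\<theta> j) (\<theta> i))"
    and R: "\<And>i. i \<in> set xs \<Longrightarrow> \<theta> i \<in> mod_R" "M \<in> mod_R"
  shows "factor_list \<theta> (sort xs) M"
  using assms
proof (induction xs arbitrary: M)
  case (Cons x xs)
  then obtain g where g: "lin M (\<theta> x) g" "g ` carr M = carr (\<theta> x)"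
    "factor_list \<theta> xs (M\<lparr>carr := Ker M g\<rparr>)" by auto
  have "factor_list \<theta> (sort xs) (M\<lparr>carr := Ker M g\<rparr>)"
    using g Cons.prems mod_R_Ker[OF Cons.prems(4) _ g(1)] by (intro Cons.IH) auto
  then have "factor_list \<theta> (x # sort xs) M" using g by auto
  then have "factor_list \<theta> (insort x (sort xs)) M"
    by (rule factor_list_insort) (use Cons.prems in auto)
  then show ?case by simp
qed simp

lemma factor_list_projective_dimension:
  fixes M :: "('r, 'k) rmod"
  assumes "factor_list \<theta> js M" "\<And>j. j \<in> set js \<Longrightarrow> \<theta> j \<in> mod_R \<and> projective ((\<Omega> ^^ s) (\<theta> j))"
    "M \<in> mod_R"
  shows "projective ((\<Omega> ^^ s) M)"
  using assms
proof (induction js arbitrary: M)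
  case Nil
  then show ?case by (simp add: projective_syzygy_funpow projective_zero)
next
  case (Cons j js)
  then obtain g where g: "lin M (\<theta> j) g" "g ` carr M = carr (\<theta> j)"
    "factor_list \<theta> js (M\<lparr>carr := Ker M g\<rparr>)" by auto
  have s: "ses (M\<lparr>carr := Ker M g\<rparr>) M (\<theta> j)" using ses_Ker Cons.prems g by simp
  have "projective ((\<Omega> ^^ s) (M\<lparr>carr := Ker M g\<rparr>))"
    using Cons.IH[OF g(3)] Cons.prems(2) ses_mod_R(1)[OF s] by simp
  then show ?case using ses_projective_dimension[OF s] Cons.prems(2) by simp
qed

text \<open>Self-extensions of \<open>\<theta> i\<close> being trivial, the projection of
  \<open>Ker g\<close> onto the lower copies extends to \<open>M\<close>; paired with
  \<open>g\<close> it maps onto the full power. The kernel is filtered by the factors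
  \<open>js\<close> below, so its \<open>s\<close>-th syzygy is projective.\<close>

lemma factor_list_replicate:
  fixes M :: "('r, 'k) rmod"
  assumes "factor_list \<theta> (replicate m i @ js) M"
    "\<And>j. j \<in> set js \<Longrightarrow> \<theta> j \<in> mod_R \<and> projective ((\<Omega> ^^ s) (\<theta> j))" "M \<in> mod_R"
    "\<theta> i \<in> mod_R" "trivial_group (Ext1 (\<theta> i) (\<theta> i))"
  shows "\<exists>g. lin M (pow_mod (\<theta> i) m) g \<and> g ` carr M = carr (pow_mod (\<theta> i) m) \<and>
    projective ((\<Omega> ^^ s) (M\<lparr>carr := Ker M g\<rparr>))"
  using assms(1,3)
proof (induction m arbitrary: M)
  case 0
  have "Ker M (\<lambda>x. 0 :: nat \<Rightarrow> 'k) = carr M" by (auto simp: Ker_def)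
  then have "M\<lparr>carr := Ker M (\<lambda>x. 0 :: nat \<Rightarrow> 'k)\<rparr> = M" by simp
  moreover have "projective ((\<Omega> ^^ s) M)" using factor_list_projective_dimension 0 assms(2) by simp
  moreover have "(\<lambda>x. 0) ` carr M = carr zero_mod"
    using lm_zero[OF mod_R_left_module[OF 0(2)]] by (auto simp: zero_mod_def)
  ultimately show ?case using lin_zero[OF zero_mod(1), of M]
    by (intro exI[of _ "\<lambda>x. 0 :: nat \<Rightarrow> 'k"] conjI) (simp_all only: pow_mod.simps)
next
  case (Suc m)
  let ?T = "\<theta> i"
  obtain g where g: "lin M ?T g" "g ` carr M = carr ?T"
    "factor_list \<theta> (replicate m i @ js) (M\<lparr>carr := Ker M g\<rparr>)" using Suc.prems by auto
  let ?K = "M\<lparr>carr := Ker M g\<rparr>"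
  have K: "?K \<in> mod_R" using mod_R_Ker Suc.prems assms(4) g by blast
  obtain h where h: "lin ?K (pow_mod ?T m) h" "h ` Ker M g = carr (pow_mod ?T m)"
    "projective ((\<Omega> ^^ s) (M\<lparr>carr := Ker ?K h\<rparr>))" using Suc.IH[OF g(3) K] by auto
  obtain H where H: "lin M (pow_mod ?T m) H" "\<forall>x\<in>Ker M g. H x = h x"
    using Ext1_trivial_extend_pow[OF assms(5,4,4) Suc.prems(2) g(1,2) h(1)] by blast
  let ?f = "\<lambda>x. vpair (g x) (H x)"
  have l: "left_module M" using Suc.prems mod_R_left_module by blast
  have lP: "left_module (pow_mod ?T m)" using assms(4) mod_R_pow mod_R_left_module by blast
  have "lin M (ds ?T (pow_mod ?T m)) ?f" using lin_vpair g(1) H(1) by blast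
  moreover have "?f ` carr M = carr (ds ?T (pow_mod ?T m))"
  proof
    show "carr (ds ?T (pow_mod ?T m)) \<subseteq> ?f ` carr M"
    proof
      fix y assume "y \<in> carr (ds ?T (pow_mod ?T m))"
      then have y: "vfst y \<in> carr ?T" "vsnd y \<in> carr (pow_mod ?T m)" by auto
      obtain w where w: "w \<in> carr M" "g w = vfst y" using g(2) y(1) by (metis imageE)
      \<comment> \<open>The second coordinate is corrected by an element of \<open>Ker g\<close>,
        which leaves the first unchanged.\<close>
      have "vsnd y - H w \<in> h ` Ker M g" using h(2) y(2) lin_closed[OF H(1) w(1)] lm_diff[OF lP]
        by simp
      then obtain x where x: "x \<in> Ker M g" "vsnd y - H w = h x" by blast
      then have xM: "x \<in> carr M" "g x = 0" "H x = vsnd y - H w" using H(2) by (auto simp: Ker_def)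
      then have "?f (w + x) = y"
        using w by (auto intro!: vpair_eqI simp: lin_add[OF g(1)] lin_add[OF H(1)])
      then show "y \<in> ?f ` carr M" using lm_add[OF l w(1) xM(1)] by blast
    qed
  qed (use lin_closed[OF g(1)] lin_closed[OF H(1)] in auto)
  moreover have "Ker M ?f = Ker ?K h" using H(2) by (auto simp: Ker_def)
  ultimately show ?case using h(3) by (intro exI[of _ ?f]) simp
qed

text \<open>The factors \<open>xs\<close> above the block are removed one at a time without changing
  the stable class of the syzygy of order \<open>s + 1\<close>. The factors \<open>js\<close> below
  it are removed together as a kernel, and for these the order \<open>Suc s\<close> is called
  for.\<close>

lemma factor_list_stable:
  fixes M :: "('r, 'k) rmod"
  assumes "factor_list \<theta> (xs @ replicate m i @ js) M"
    "\<And>j. j \<in> set (xs @ js) \<Longrightarrow> \<theta> j \<in> mod_R \<and> projective ((\<Omega> ^^ s) (\<theta> j))" "M \<in> mod_R"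
    "\<theta> i \<in> mod_R" "trivial_group (Ext1 (\<theta> i) (\<theta> i))"
  shows "(\<Omega> ^^ Suc s) M \<simeq> pow_mod ((\<Omega> ^^ Suc s) (\<theta> i)) m"
  using assms(1-3)
proof (induction xs arbitrary: M)
  case Nil
  then obtain g where g: "lin M (pow_mod (\<theta> i) m) g" "g ` carr M = carr (pow_mod (\<theta> i) m)"
    "projective ((\<Omega> ^^ s) (M\<lparr>carr := Ker M g\<rparr>))"
    using factor_list_replicate[of \<theta> m i js M s] assms(4,5) by auto
  have "(\<Omega> ^^ Suc s) M \<simeq> (\<Omega> ^^ Suc s) (pow_mod (\<theta> i) m)"
    using ses_stable_right[OF ses_Ker[OF Nil(3) mod_R_pow[OF assms(4)] g(1,2)] g(3)] .
  also have "(\<Omega> ^^ Suc s) (pow_mod (\<theta> i) m) \<simeq> pow_mod ((\<Omega> ^^ Suc s) (\<theta> i)) m"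
    using stably_iso_syzygy_funpow_pow assms(4) by blast
  finally show ?case .
next
  case (Cons j xs)
  then obtain g where g: "lin M (\<theta> j) g" "g ` carr M = carr (\<theta> j)"
    "factor_list \<theta> (xs @ replicate m i @ js) (M\<lparr>carr := Ker M g\<rparr>)" by auto
  have j: "\<theta> j \<in> mod_R" "projective ((\<Omega> ^^ s) (\<theta> j))" using Cons.prems(2) by auto
  have s: "ses (M\<lparr>carr := Ker M g\<rparr>) M (\<theta> j)" using ses_Ker[OF Cons.prems(3) j(1) g(1,2)] .
  have "(\<Omega> ^^ Suc s) M \<simeq> (\<Omega> ^^ Suc s) (M\<lparr>carr := Ker M g\<rparr>)"
    using ses_stable_left[OF s, of "Suc s"] projective_syzygy[OF j(2)] by simp
  also have "(\<Omega> ^^ Suc s) (M\<lparr>carr := Ker M g\<rparr>) \<simeq> pow_mod ((\<Omega> ^^ Suc s) (\<theta> i)) m"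
    using Cons.IH[OF g(3)] Cons.prems(2) ses_mod_R(1)[OF s] by simp
  finally show ?case .
qed

section \<open>Passage from filtrations to sorted lists of factors\<close>

lemma filtered_factor_list:
  fixes M :: "('r, 'k) rmod"
  assumes "M \<in> \<F> t \<theta>"
  obtains js where "set js \<subseteq> {1..t}" "factor_list \<theta> js M"
proof -
  have M: "M \<in> mod_R" and l: "left_module M" using assms mod_R_left_module
    by (auto simp: filtered_modules_def)
  show thesis
  proof (cases "zero_module M")
    case True
    then show ?thesis using that[of "[]"] by simp
  next
    case False
    then obtain m C where C: "C 0 = {0}" "C m = carr M" "\<And>i. i \<le> m \<Longrightarrow> submodule M (C i)"
      "\<And>i. i < m \<Longrightarrow> C i \<subseteq> C (Suc i) \<and> (\<exists>j\<in>{1..t}. quotient_iso (M\<lparr>carr := C (Suc i)\<rparr>) (C i) (\<theta> j))"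
      using assms unfolding filtered_modules_def by blast
    have "\<exists>js. set js \<subseteq> {1..t} \<and> factor_list \<theta> js (M\<lparr>carr := C i\<rparr>)" if "i \<le> m" for i
      using that
    proof (induction i)
      case 0
      then show ?case using C(1) by (intro exI[of _ "[]"]) (simp add: zero_module_def)
    next
      case (Suc i)
      then obtain js where js: "set js \<subseteq> {1..t}" "factor_list \<theta> js (M\<lparr>carr := C i\<rparr>)" by auto
      obtain j where j: "j \<in> {1..t}" "quotient_iso (M\<lparr>carr := C (Suc i)\<rparr>) (C i) (\<theta> j)"
        using C(4)[of i] Suc.prems by auto
      have "submodule (M\<lparr>carr := C (Suc i)\<rparr>) (C i)"
        using submodule_sub_iff[OF C(3)[OF Suc.prems]] C(3)[of i] C(4)[of i] Suc.prems by simp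
      then obtain g where g: "lin (M\<lparr>carr := C (Suc i)\<rparr>) (\<theta> j) g" "g ` C (Suc i) = carr (\<theta> j)"
        "Ker (M\<lparr>carr := C (Suc i)\<rparr>) g = C i"
        using quotient_iso_epi[OF submodule_left_module[OF l C(3)[OF Suc.prems]] _ j(2)] by auto
      have "factor_list \<theta> (j # js) (M\<lparr>carr := C (Suc i)\<rparr>)"
        using g js(2) by auto
      then show ?case using js(1) j(1) by (intro exI[of _ "j # js"]) simp
    qed
    from this[of m] show ?thesis using C(2) that by auto
  qed
qed

lemma sorted_split:
  fixes xs :: "nat list"
  shows "sorted xs \<Longrightarrow> xs = filter (\<lambda>x. x < i) xs @ replicate (count_list xs i) i @ filter (\<lambda>x. x >
    i) xs"
proof (induction xs)
  case (Cons x xs)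
  then have IH: "xs = filter (\<lambda>x. x < i) xs @ replicate (count_list xs i) i @ filter (\<lambda>x. x > i) xs"
    and x: "\<forall>y\<in>set xs. x \<le> y" by auto
  consider "x < i" | "x = i" | "x > i" by linarith
  then show ?case
  proof cases
    case 2
    then have "filter (\<lambda>x. x < i) xs = []" using x by (auto simp: filter_empty_conv)
    then show ?thesis using IH 2 by simp
  next
    case 3
    then have "filter (\<lambda>x. x < i) xs = []" "count_list xs i = 0"
      using x by (auto simp: filter_empty_conv count_list_0_iff)
    then show ?thesis using IH 3 by simp
  qed (use IH in simp)
qed simp

text \<open>For \<open>m = 0\<close> the stable isomorphism yields projectivity of the syzygy of
  order \<open>s + 1\<close> only. The second conclusion uses that then no factor has index
  \<open>i0\<close>, which gives order \<open>s\<close>.\<close>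

lemma filtered_stable:
  fixes M :: "('r, 'k) rmod"
  assumes M: "M \<in> \<F> t \<theta>" and R: "\<And>i. i \<in> {1..t} \<Longrightarrow> \<theta> i \<in> mod_R"
    and ext: "\<And>i j. i \<in> {1..t} \<Longrightarrow> j \<in> {1..t} \<Longrightarrow> i \<le> j \<Longrightarrow> trivial_group (Ext1 (\<theta> j) (\<theta> i))"
    and i0: "i0 \<in> {1..t}" and pr: "\<And>j. j \<in> {1..t} \<Longrightarrow> j \<noteq> i0 \<Longrightarrow> projective ((\<Omega> ^^ s) (\<theta> j))"
  obtains m where "(\<Omega> ^^ Suc s) M \<simeq> pow_mod ((\<Omega> ^^ Suc s) (\<theta> i0)) m"
    "m = 0 \<Longrightarrow> projective ((\<Omega> ^^ s) M)"
proof -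
  have MR: "M \<in> mod_R" using M by (simp add: filtered_modules_def)
  obtain js where js: "set js \<subseteq> {1..t}" "factor_list \<theta> js M" using filtered_factor_list[OF M] .
  let ?s = "sort js"
  have jt: "j \<in> {1..t}" if "j \<in> set js" for j using js(1) that by blast
  have s: "factor_list \<theta> ?s M" by (rule factor_list_sort[OF js(2) ext[OF jt jt] R[OF jt] MR])
  have st: "set ?s \<subseteq> {1..t}" using js by simp
  let ?m = "count_list ?s i0"
  have "factor_list \<theta> (filter (\<lambda>x. x < i0) ?s @ replicate ?m i0 @ filter (\<lambda>x. x > i0) ?s) M"
    using s sorted_split[of ?s i0] by simp
  then have "(\<Omega> ^^ Suc s) M \<simeq> pow_mod ((\<Omega> ^^ Suc s) (\<theta> i0)) ?m"
    using MR R[OF i0] ext[OF i0 i0] js R pr by (intro factor_list_stable) auto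
  moreover have "projective ((\<Omega> ^^ s) M)" if "?m = 0"
  proof -
    have "i0 \<notin> set ?s" using that by (simp add: count_list_0_iff)
    then have "\<theta> j \<in> mod_R \<and> projective ((\<Omega> ^^ s) (\<theta> j))" if "j \<in> set js" for j
      using R[OF jt[OF that]] pr[OF jt[OF that]] that by auto
    then show ?thesis by (rule factor_list_projective_dimension[OF js(2) _ MR])
  qed
  ultimately show thesis by (rule that)
qed

end

section \<open>Chains of subgroups of finitely generated abelian groups\<close>

text \<open>Over the integers, \<open>frag.subspace\<close> means subgroup and
  \<open>frag.span\<close> the subgroup generated.\<close>

interpretation frag: module frag_cmul
  by unfold_locales (simp_all add: frag_cmul_distrib frag_cmul_distrib2)

text \<open>The union of the chain is an ideal of the integers, generated by its least positive
  element, which already lies in some member \<open>I n\<close>. A chain of zero ideals is served by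
  \<open>d = 0\<close>.\<close>

lemma int_ideal_chain:
  fixes I :: "nat \<Rightarrow> int set"
  assumes "\<And>m. 0 \<in> I m" "\<And>m a b. a \<in> I m \<Longrightarrow> b \<in> I m \<Longrightarrow> a + b \<in> I m" "\<And>m a k. a \<in> I m \<Longrightarrow> k * a \<in> I m"
    and mono: "\<And>m n. m \<le> n \<Longrightarrow> I m \<subseteq> I n"
  shows "\<exists>n d. d \<in> I n \<and> (\<forall>m. \<forall>a\<in>I m. d dvd a)"
proof (cases "\<exists>m. \<exists>a\<in>I m. a \<noteq> 0")
  case False
  then have "\<forall>m. \<forall>a\<in>I m. (0::int) dvd a" by simp
  then show ?thesis using assms(1) by blast
next
  case True
  then obtain m a where a: "a \<in> I m" "a \<noteq> 0" by blast
  define Q where "Q k \<longleftrightarrow> k > 0 \<and> (\<exists>m. int k \<in> I m)" for k :: nat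
  have "-1 * a \<in> I m" using assms(3) a by blast
  then have "int (nat \<bar>a\<bar>) \<in> I m" using a by (cases "a \<ge> 0") auto
  then have "Q (nat \<bar>a\<bar>)" using a unfolding Q_def by auto
  define k where "k = (LEAST k. Q k)"
  have k: "Q k" and least: "\<And>j. Q j \<Longrightarrow> k \<le> j"
    unfolding k_def using \<open>Q (nat \<bar>a\<bar>)\<close> by (auto intro: LeastI Least_le)
  obtain n where n: "int k \<in> I n" "k > 0" using k unfolding Q_def by blast
  have "int k dvd b" if b: "b \<in> I m" for b m
  proof (rule ccontr)
    assume nd: "\<not> int k dvd b"
    let ?N = "max m n"
    have "b \<in> I ?N" "int k \<in> I ?N" using b n mono[of m ?N] mono[of n ?N] by auto
    then have "b + - (b div int k) * int k \<in> I ?N" using assms(2,3) by blast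
    then have r: "b mod int k \<in> I ?N" by (simp add: minus_div_mult_eq_mod)
    have "0 \<le> b mod int k" "b mod int k < int k" "b mod int k \<noteq> 0"
      using n(2) nd by (auto simp: dvd_eq_mod_eq_0)
    then have "Q (nat (b mod int k))" "nat (b mod int k) < k" using r unfolding Q_def by auto
    then show False using least by fastforce
  qed
  then show ?thesis using n by blast
qed

text \<open>The ascending chain condition for finitely generated abelian groups, by induction on the
  generators: the coefficients that can occur at the new generator \<open>g\<close> form a chain of
  ideals, and what remains lies in the span of the others.\<close>

lemma frag_subgroup_chain:
  fixes H :: "nat \<Rightarrow> ('a \<Rightarrow>\<^sub>0 int) set"
  assumes F: "finite F" and sub: "\<And>m. frag.subspace (H m)" and mono: "\<And>m n. m \<le> n \<Longrightarrow> H m \<subseteq> H n"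
  shows "\<exists>n. \<forall>m\<ge>n. H m \<inter> frag.span F \<subseteq> H n"
  using F
proof (induction F)
  case empty
  then show ?case using frag.subspace_0[OF sub] by auto
next
  case (insert g F)
  then obtain n1 where n1: "\<And>m. m \<ge> n1 \<Longrightarrow> H m \<inter> frag.span F \<subseteq> H n1" by blast
  define I where "I m = {a. \<exists>x\<in>frag.span F. frag_cmul a g + x \<in> H m}" for m
  have "\<exists>n d. d \<in> I n \<and> (\<forall>m. \<forall>a\<in>I m. d dvd a)"
  proof (rule int_ideal_chain)
    fix m
    show "0 \<in> I m" unfolding I_def using frag.span_zero frag.subspace_0[OF sub] by force
  next
    fix m a b assume "a \<in> I m" "b \<in> I m"
    then obtain x y where xy: "x \<in> frag.span F" "y \<in> frag.span F" "frag_cmul a g + x \<in> H m"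
      "frag_cmul b g + y \<in> H m"
      unfolding I_def by blast
    have "frag_cmul (a + b) g + (x + y) = (frag_cmul a g + x) + (frag_cmul b g + y)"
      by (simp add: frag_cmul_distrib)
    then show "a + b \<in> I m"
      unfolding I_def using xy frag.subspace_add[OF sub] frag.span_add
      by (metis (mono_tags, lifting) mem_Collect_eq)
  next
    fix m a k assume "a \<in> I m"
    then obtain x where x: "x \<in> frag.span F" "frag_cmul a g + x \<in> H m" unfolding I_def by blast
    have "frag_cmul (k * a) g + frag_cmul k x = frag_cmul k (frag_cmul a g + x)"
      by (simp add: frag_cmul_distrib2)
    then show "k * a \<in> I m"
      unfolding I_def using x frag.subspace_scale[OF sub] frag.span_scale
      by (metis (mono_tags, lifting) mem_Collect_eq)
  next
    fix m n :: nat assume "m \<le> n"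
    then show "I m \<subseteq> I n" unfolding I_def using mono by blast
  qed
  then obtain n2 d where d: "d \<in> I n2" "\<And>m a. a \<in> I m \<Longrightarrow> d dvd a" by blast
  obtain x0 where x0: "x0 \<in> frag.span F" "frag_cmul d g + x0 \<in> H n2" using d(1) unfolding I_def
    by blast
  let ?n = "max n1 n2"
  have "h \<in> H ?n" if m: "m \<ge> ?n" and h: "h \<in> H m" "h \<in> frag.span (insert g F)" for m h
  proof -
    obtain k where k: "h - frag_cmul k g \<in> frag.span F" using h(2) frag.span_breakdown_eq by blast
    then have "k \<in> I m" unfolding I_def using h(1) by (auto intro!: bexI[of _ "h - frag_cmul k g"])
    then have "d dvd k" by (rule d(2))
    then obtain q where q: "k = d * q" by (rule dvdE)
    \<comment> \<open>This multiple of the chosen element of \<open>H n2\<close> matches the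
      multiple \<open>k\<close> of \<open>g\<close> in \<open>h\<close>, so the difference lies in
      the span of \<open>F\<close>, where the chain is already stationary.\<close>
    let ?y = "frag_cmul q (frag_cmul d g + x0)"
    have y: "?y \<in> H n2" using frag.subspace_scale[OF sub x0(2)] .
    have "h - ?y = (h - frag_cmul k g) - frag_cmul q x0"
      by (simp add: q frag_cmul_distrib2 mult.commute)
    then have "h - ?y \<in> frag.span F" using k x0(1) frag.span_diff frag.span_scale by metis
    moreover have "h - ?y \<in> H m" using h(1) y mono[of n2 m] m frag.subspace_diff[OF sub] by auto
    ultimately have "h - ?y \<in> H n1" using n1[of m] m by auto
    then have "h - ?y \<in> H ?n" "?y \<in> H ?n" using y mono[of n1 ?n] mono[of n2 ?n] by auto
    then have "(h - ?y) + ?y \<in> H ?n" using frag.subspace_add[OF sub] by blast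
    then show ?thesis by simp
  qed
  then show ?case by blast
qed

section \<open>The Igusa--Todorov group\<close>

context finite_dimensional_algebra
begin

abbreviation Rel :: "(('r, 'k) rmod \<Rightarrow>\<^sub>0 int) set" where
  "Rel \<equiv> IT_relations"

abbreviation frag_syzygy :: "(('r, 'k) rmod \<Rightarrow>\<^sub>0 int) \<Rightarrow> (('r, 'k) rmod \<Rightarrow>\<^sub>0 int)" (\<open>\<omega>\<close>) where
  "\<omega> \<equiv> frag_extend (\<lambda>M. frag_of (\<Omega> M))"

abbreviation rel_generators :: "(('r, 'k) rmod \<Rightarrow>\<^sub>0 int) set" where
  "rel_generators \<equiv> {frag_of C - (frag_of A + frag_of B) | A B C.
           A \<in> mod_R \<and> B \<in> mod_R \<and> C \<in> mod_R \<and> C \<cong>\<^sub>R A \<oplus>\<^sub>R B} \<union> {frag_of P | P. projective P}"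

lemma rel_generators_carrier: "rel_generators \<subseteq> carrier free_mod"
proof -
  have "frag_of C - (frag_of A + frag_of B) \<in> carrier free_mod"
    if "A \<in> mod_R" "B \<in> mod_R" "C \<in> mod_R" for A B C :: "('r, 'k) rmod"
  proof -
    have "Poly_Mapping.keys (frag_of C - (frag_of A + frag_of B)) \<subseteq> {C} \<union> ({A} \<union> {B})"
      using keys_diff[of "frag_of C" "frag_of A + frag_of B"] keys_add[of "frag_of A" "frag_of B"]
      by auto
    then show ?thesis using that by auto
  qed
  then show ?thesis using projective_mod_R by auto
qed

lemma Rel_subgroup: "subgroup Rel free_mod"
  unfolding IT_relations_def by (rule group.generate_is_subgroup[OF group_free_Abelian_group
    rel_generators_carrier])

lemma Rel_0: "0 \<in> Rel"
  using subgroup.one_closed[OF Rel_subgroup] by simp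

lemma Rel_add: "a \<in> Rel \<Longrightarrow> b \<in> Rel \<Longrightarrow> a + b \<in> Rel"
  using subgroup.m_closed[OF Rel_subgroup] by fastforce

lemma Rel_carrier: "a \<in> Rel \<Longrightarrow> Poly_Mapping.keys a \<subseteq> mod_R"
  using subsetD[OF subgroup.subset[OF Rel_subgroup]] by simp

lemma Rel_uminus: "a \<in> Rel \<Longrightarrow> - a \<in> Rel"
  using subgroup.m_inv_closed[OF Rel_subgroup] Rel_carrier by fastforce

lemma Rel_diff: "a \<in> Rel \<Longrightarrow> b \<in> Rel \<Longrightarrow> a - b \<in> Rel"
  using Rel_add[of a "- b"] Rel_uminus by simp

lemma Rel_diff_iff: "a - b \<in> Rel \<Longrightarrow> a \<in> Rel \<longleftrightarrow> b \<in> Rel"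
  using Rel_add[of "a - b" b] Rel_diff[of a "a - b"] by auto

lemma Rel_diff_trans: "a - b \<in> Rel \<Longrightarrow> b - c \<in> Rel \<Longrightarrow> a - c \<in> Rel"
  using Rel_add[of "a - b" "b - c"] by simp

lemma Rel_frag_cmul: "a \<in> Rel \<Longrightarrow> frag_cmul k a \<in> Rel"
proof (induction k rule: int_induct[of _ 0])
  case (step1 i)
  then show ?case using Rel_add by (simp add: frag_cmul_distrib)
next
  case (step2 i)
  then show ?case using Rel_diff by (simp add: frag_cmul_diff_distrib)
qed (simp add: Rel_0)

lemma Rel_projective: "projective P \<Longrightarrow> frag_of P \<in> Rel"
  unfolding IT_relations_def by (rule generate.incl) blast

lemma Rel_ds:
  assumes "A \<in> mod_R" "B \<in> mod_R" "C \<in> mod_R" "C \<cong>\<^sub>R ds A B"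
  shows "frag_of C - (frag_of A + frag_of B) \<in> Rel"
proof -
  have "C \<cong>\<^sub>R A \<oplus>\<^sub>R B" using mod_iso_direct_sum mod_R_left_module assms by blast
  then show ?thesis unfolding IT_relations_def using assms by (intro generate.incl) blast
qed

text \<open>The module \<open>ds M P\<close> decomposes in two ways, and the projective terms are
  themselves relations.\<close>

lemma Rel_stably_iso:
  assumes "M \<simeq> N" shows "frag_of M - frag_of N \<in> Rel"
proof -
  obtain P Q where 1: "M \<in> mod_R" "N \<in> mod_R" "projective P" "projective Q" "ds M P \<cong>\<^sub>R ds N Q"
    using assms by (auto simp: stably_iso_def)
  let ?D = "ds M P"
  have PQ: "P \<in> mod_R" "Q \<in> mod_R" using 1 projective_mod_R by auto
  have D: "?D \<in> mod_R" using 1 PQ mod_R_ds by blast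
  have a: "frag_of ?D - (frag_of M + frag_of P) \<in> Rel"
    using Rel_ds 1 PQ D mod_iso_refl mod_R_left_module by blast
  have b: "frag_of ?D - (frag_of N + frag_of Q) \<in> Rel" using Rel_ds 1 PQ D by blast
  have "(frag_of ?D - (frag_of N + frag_of Q)) - (frag_of ?D - (frag_of M + frag_of P)) + frag_of
    Q - frag_of P \<in> Rel"
    using Rel_add[OF Rel_diff[OF b a] Rel_projective[OF 1(4)]] Rel_projective[OF 1(3)] Rel_diff
    by blast
  then show ?thesis by (simp add: algebra_simps)
qed

text \<open>This makes the endomorphism induced by the syzygy well defined: the syzygy of a sum is
  the sum of the syzygies up to projectives, and that of a projective is projective.\<close>

lemma Rel_frag_syzygy:
  assumes "c \<in> Rel" shows "\<omega> c \<in> Rel"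
proof -
  have gen: "\<omega> h \<in> Rel" if h: "h \<in> rel_generators" for h
  proof -
    from h consider A B C where "h = frag_of C - (frag_of A + frag_of B)" "A \<in> mod_R" "B \<in> mod_R"
      "C \<in> mod_R" "C \<cong>\<^sub>R A \<oplus>\<^sub>R B"
      | P where "h = frag_of P" "projective P" by blast
    then show ?thesis
    proof cases
      case 1
      then have "C \<cong>\<^sub>R ds A B" using mod_iso_direct_sum mod_R_left_module by blast
      then have "\<Omega> C \<simeq> \<Omega> (ds A B)" using stably_iso_syzygy iso_stably_iso 1 mod_R_ds by blast
      also have "\<Omega> (ds A B) \<simeq> ds (\<Omega> A) (\<Omega> B)" using stably_iso_syzygy_ds 1 by blast
      finally have a: "frag_of (\<Omega> C) - frag_of (ds (\<Omega> A) (\<Omega> B)) \<in> Rel" by (rule Rel_stably_iso)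
      have "frag_of (ds (\<Omega> A) (\<Omega> B)) - (frag_of (\<Omega> A) + frag_of (\<Omega> B)) \<in> Rel"
        using 1 by (intro Rel_ds syzygy_mod_R mod_R_ds mod_iso_refl mod_R_left_module) auto
      then show ?thesis using Rel_diff_trans[OF a] 1 by (simp add: frag_extend_diff frag_extend_add)
    next
      case 2
      then show ?thesis using Rel_projective[OF projective_syzygy] by simp
    qed
  qed
  have "c \<in> generate free_mod rel_generators" using assms by (simp add: IT_relations_def)
  then show ?thesis
  proof induction
    case one
    then show ?case by (simp add: Rel_0)
  next
    case (incl h)
    then show ?case by (rule gen)
  next
    case (inv h)
    have "Poly_Mapping.keys h \<subseteq> mod_R" using subsetD[OF rel_generators_carrier inv] by simp
    then show ?case using Rel_uminus[OF gen[OF inv]] by (simp add: frag_extend_minus)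
  next
    case (eng h1 h2)
    then show ?case using Rel_add by (simp add: frag_extend_add)
  qed
qed

lemma frag_syzygy_funpow_add: "(\<omega> ^^ n) (a + b) = (\<omega> ^^ n) a + (\<omega> ^^ n) b"
  and frag_syzygy_funpow_diff: "(\<omega> ^^ n) (a - b) = (\<omega> ^^ n) a - (\<omega> ^^ n) b"
  and frag_syzygy_funpow_cmul: "(\<omega> ^^ n) (frag_cmul k a) = frag_cmul k ((\<omega> ^^ n) a)"
  and frag_syzygy_funpow_0: "(\<omega> ^^ n) 0 = 0"
  by (induction n) (simp_all add: frag_extend_add frag_extend_diff frag_extend_cmul)

lemma frag_syzygy_funpow_of: "(\<omega> ^^ n) (frag_of M) = frag_of ((\<Omega> ^^ n) M)"
  by (induction n) simp_all

lemma Rel_frag_syzygy_funpow: "c \<in> Rel \<Longrightarrow> (\<omega> ^^ n) c \<in> Rel"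
  by (induction n) (auto intro: Rel_frag_syzygy)

lemma frag_syzygy_carrier:
  assumes "Poly_Mapping.keys c \<subseteq> mod_R" shows "Poly_Mapping.keys (\<omega> c) \<subseteq> mod_R"
  using assms
proof (induction c rule: frag_induction)
  case (diff a b)
  then show ?case using keys_diff[of "\<omega> a" "\<omega> b"] by (auto simp: frag_extend_diff)
qed (auto simp: syzygy_mod_R)

lemma frag_syzygy_funpow_carrier: "Poly_Mapping.keys c \<subseteq> mod_R \<Longrightarrow>
  Poly_Mapping.keys ((\<omega> ^^ n) c) \<subseteq> mod_R"
  by (induction n) (auto simp: frag_syzygy_carrier)

section \<open>The induced endomorphism on cosets\<close>

abbreviation coset :: "(('r, 'k) rmod \<Rightarrow>\<^sub>0 int) \<Rightarrow> (('r, 'k) rmod \<Rightarrow>\<^sub>0 int) set" where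
  "coset c \<equiv> Rel #>\<^bsub>free_mod\<^esub> c"

lemma mem_coset: "x \<in> coset c \<longleftrightarrow> x - c \<in> Rel"
proof
  assume "x - c \<in> Rel"
  then have "(x - c) + c \<in> coset c" unfolding r_coset_def by force
  then show "x \<in> coset c" by simp
qed (auto simp: r_coset_def)

lemma coset_eq_iff: "coset a = coset b \<longleftrightarrow> a - b \<in> Rel"
proof
  assume "coset a = coset b"
  moreover have "a \<in> coset a" by (simp add: mem_coset Rel_0)
  ultimately show "a - b \<in> Rel" using mem_coset by simp
next
  assume ab: "a - b \<in> Rel"
  then have ba: "b - a \<in> Rel" using Rel_uminus by fastforce
  show "coset a = coset b"
    using Rel_diff_trans[OF _ ab] Rel_diff_trans[OF _ ba] by (auto simp: mem_coset)
qed

lemma IT_Omega_coset: "IT_Omega (coset c) = coset (\<omega> c)"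
proof -
  have "coset (\<omega> x) = coset (\<omega> c)" if "x \<in> coset c" for x
    using Rel_frag_syzygy[of "x - c"] that by (simp add: coset_eq_iff mem_coset frag_extend_diff)
  moreover have "c \<in> coset c" by (simp add: mem_coset Rel_0)
  ultimately show ?thesis unfolding IT_Omega_def by blast
qed

lemma IT_Omega_funpow_coset: "(IT_Omega ^^ n) (coset c) = coset ((\<omega> ^^ n) c)"
  by (induction n) (simp_all add: IT_Omega_coset)

lemma Rel_normal: "Rel \<lhd> free_mod"
  using comm_group.normal_iff_subgroup[OF abelian_free_Abelian_group] Rel_subgroup by blast

text \<open>A lift of \<open>IT_span M\<close> to the free group. Working with representatives
  replaces equalities of cosets by membership of differences in \<open>Rel\<close>.\<close>

definition summand_frags :: "('r, 'k) rmod \<Rightarrow> (('r, 'k) rmod \<Rightarrow>\<^sub>0 int) set" where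
  "summand_frags M = generate free_mod {frag_of N | N. indecomposable N \<and> direct_summand N M}"

lemma summand_frags_subgroup: "subgroup (summand_frags M) free_mod"
  unfolding summand_frags_def
  by (rule group.generate_is_subgroup[OF group_free_Abelian_group]) (auto simp:
    indecomposable_mod_R)

lemma summand_frags_carrier: "c \<in> summand_frags M \<Longrightarrow> Poly_Mapping.keys c \<subseteq> mod_R"
  using subsetD[OF subgroup.subset[OF summand_frags_subgroup]] by simp

lemma summand_frags_0: "0 \<in> summand_frags M"
  using subgroup.one_closed[OF summand_frags_subgroup] by simp

lemma summand_frags_add: "a \<in> summand_frags M \<Longrightarrow> b \<in> summand_frags M \<Longrightarrow> a + b \<in> summand_frags M"
  using subgroup.m_closed[OF summand_frags_subgroup] by fastforce

lemma summand_frags_diff: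
  assumes "a \<in> summand_frags M" "b \<in> summand_frags M" shows "a - b \<in> summand_frags M"
proof -
  have "- b \<in> summand_frags M"
    using subgroup.m_inv_closed[OF summand_frags_subgroup assms(2)] summand_frags_carrier[OF
      assms(2)] by simp
  then show ?thesis using summand_frags_add[OF assms(1)] by fastforce
qed

lemma IT_span_coset: "IT_span M = coset ` summand_frags M"
proof -
  have frag_carrier: "{frag_of N | N. indecomposable N \<and> direct_summand N M} \<subseteq> carrier free_mod"
    by (auto simp: indecomposable_mod_R)
  have "group_hom free_mod IT_group coset"
    using normal.r_coset_hom_Mod[OF Rel_normal] normal.factorgroup_is_group[OF Rel_normal]
    by (auto simp: IT_group_def group_hom_def group_hom_axioms_def)
  from group_hom.generate_img[OF this, of "{frag_of N | N. indecomposable N \<and> direct_summand N M}"]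
    frag_carrier
  have "generate IT_group (coset ` {frag_of N | N. indecomposable N \<and>
    direct_summand N M}) = coset ` summand_frags M"
    unfolding summand_frags_def by blast
  moreover have "coset ` {frag_of N | N. indecomposable N \<and> direct_summand N M} =
      {IT_class N | N. indecomposable N \<and> direct_summand N M}"
    by (auto simp: IT_class_def)
  ultimately show ?thesis unfolding IT_span_def by simp
qed

definition syzygy_injective :: "('r, 'k) rmod \<Rightarrow> nat \<Rightarrow> bool" where
  "syzygy_injective M m \<longleftrightarrow> (\<forall>c\<in>summand_frags M. (\<omega> ^^ Suc m) c \<in> Rel \<longrightarrow> (\<omega> ^^ m) c \<in> Rel)"

text \<open>The target is by definition the image of the source and \<open>IT_Omega\<close> respects
  sums, so only injectivity is at stake; for a homomorphism this is triviality of the kernel,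
  expressed here through representatives.\<close>

lemma IT_Omega_iso_iff:
  "IT_Omega \<in> iso (IT_group\<lparr>carrier := (IT_Omega ^^ m) ` IT_span M\<rparr>)
      (IT_group\<lparr>carrier := (IT_Omega ^^ Suc m) ` IT_span M\<rparr>) \<longleftrightarrow> syzygy_injective M m"
proof -
  let ?A = "(IT_Omega ^^ m) ` IT_span M"
  have A: "?A = (\<lambda>c. coset ((\<omega> ^^ m) c)) ` summand_frags M"
    by (simp add: IT_span_coset image_image IT_Omega_funpow_coset)
  have B: "(IT_Omega ^^ Suc m) ` IT_span M = IT_Omega ` ?A" by (simp add: image_comp)
  have mult: "IT_Omega (x \<otimes>\<^bsub>IT_group\<^esub> y) = IT_Omega x \<otimes>\<^bsub>IT_group\<^esub> IT_Omega y"
    if xy: "x \<in> ?A" "y \<in> ?A" for x y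
  proof -
    obtain a b where ab: "a \<in> summand_frags M" "b \<in> summand_frags M" "x = coset ((\<omega> ^^ m) a)"
      "y = coset ((\<omega> ^^ m) b)"
      using xy unfolding A by blast
    have c: "Poly_Mapping.keys ((\<omega> ^^ m) a) \<subseteq> mod_R" "Poly_Mapping.keys ((\<omega> ^^ m) b) \<subseteq> mod_R"
      using ab summand_frags_carrier frag_syzygy_funpow_carrier by blast+
    have "coset u \<otimes>\<^bsub>IT_group\<^esub> coset v = coset (u + v)" if "Poly_Mapping.keys u \<subseteq> mod_R"
      "Poly_Mapping.keys v \<subseteq> mod_R" for u v
      using normal.rcos_sum[OF Rel_normal, of u v] that by (simp add: IT_group_def FactGroup_def)
    then show ?thesis using c frag_syzygy_carrier ab by (simp add: IT_Omega_coset frag_extend_add)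
  qed
  have "IT_Omega \<in> iso (IT_group\<lparr>carrier := ?A\<rparr>) (IT_group\<lparr>carrier := IT_Omega ` ?A\<rparr>) \<longleftrightarrow>
    inj_on IT_Omega ?A"
    using mult by (auto simp: iso_def hom_def bij_betw_def)
  also have "\<dots> \<longleftrightarrow> syzygy_injective M m"
  proof
    assume inj: "inj_on IT_Omega ?A"
    show "syzygy_injective M m" unfolding syzygy_injective_def
    proof (intro ballI impI)
      fix c assume c: "c \<in> summand_frags M" "(\<omega> ^^ Suc m) c \<in> Rel"
      then have "IT_Omega (coset ((\<omega> ^^ m) c)) = IT_Omega (coset ((\<omega> ^^ m) 0))"
        by (simp add: IT_Omega_coset coset_eq_iff frag_syzygy_funpow_0)
      then have "coset ((\<omega> ^^ m) c) = coset ((\<omega> ^^ m) 0)"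
        using inj_onD[OF inj] c(1) summand_frags_0 unfolding A by blast
      then show "(\<omega> ^^ m) c \<in> Rel" by (simp add: coset_eq_iff frag_syzygy_funpow_0)
    qed
  next
    assume st: "syzygy_injective M m"
    show "inj_on IT_Omega ?A"
    proof (rule inj_onI)
      fix x y assume xy: "x \<in> ?A" "y \<in> ?A" and eq: "IT_Omega x = IT_Omega y"
      obtain a where a: "a \<in> summand_frags M" "x = coset ((\<omega> ^^ m) a)"
        using xy(1) unfolding A by blast
      obtain b where b: "b \<in> summand_frags M" "y = coset ((\<omega> ^^ m) b)"
        using xy(2) unfolding A by blast
      have "(\<omega> ^^ Suc m) (a - b) \<in> Rel"
        using eq unfolding a(2) b(2) by (simp only: IT_Omega_coset coset_eq_iff
          frag_syzygy_funpow_diff) simp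
      then have "(\<omega> ^^ m) (a - b) \<in> Rel"
        using st summand_frags_diff[OF a(1) b(1)] unfolding syzygy_injective_def by blast
      then show "x = y" using a(2) b(2) by (simp add: coset_eq_iff frag_syzygy_funpow_diff)
    qed
  qed
  finally show ?thesis unfolding B .
qed

lemma Phi_Least: "\<Phi> M = (LEAST n. \<forall>m\<ge>n. syzygy_injective M m)"
  unfolding IT_Phi_def IT_Omega_iso_iff ..

section \<open>Existence of the index \<Phi>\<close>

lemma iso_ds_retract:
  fixes A B C :: "('r, 'k) rmod"
  assumes "A \<in> mod_R" "B \<in> mod_R" "C \<in> mod_R" "C \<cong>\<^sub>R ds A B"
  shows "retract A C" "retract B C"
proof -
  have D: "ds A B \<in> mod_R" using assms mod_R_ds by blast
  have "ds A B \<cong>\<^sub>R C"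
    using mod_iso_sym[OF mod_R_left_module[OF assms(3)] mod_R_left_module[OF D] assms(4)] .
  then have "retract (ds A B) C" using retract_iso[OF D _ assms(3)] by blast
  then show "retract A C" "retract B C" using retract_ds[OF assms(1,2)] retract_trans by blast+
qed

text \<open>The exchange argument along a decomposition of \<open>M\<close>. A summand may have many
  copies in \<open>nat \<Rightarrow> 'k\<close>, so finiteness concerns representatives of
  isomorphism classes; modulo \<open>Rel\<close> these give finitely many generators of
  \<open>summand_frags M\<close>.\<close>

lemma finitely_many_indecomposable_retracts:
  fixes M :: "('r, 'k) rmod"
  assumes "M \<in> mod_R"
  shows "\<exists>F :: ('r, 'k) rmod set. finite F \<and> F \<subseteq> mod_R \<and>
    (\<forall>Z :: ('r, 'k) rmod. indecomposable Z \<and> retract Z M \<longrightarrow> (\<exists>N\<in>F. Z \<cong>\<^sub>R N))"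
  using assms
proof (induction rule: mod_R_induct)
  case (zero Z)
  then have "\<not> (indecomposable N \<and> retract N Z)" for N
    using retract_zero by (auto simp: indecomposable_def)
  then show ?case by (intro exI[of _ "{}"]) auto
next
  case (indecomposable Z)
  then show ?case
    using retract_indecomposable_iso[OF _ indecomposable]
    by (intro exI[of _ "{Z}"]) (auto simp: indecomposable_def)
next
  case (sum A B C)
  then obtain F G :: "('r, 'k) rmod set" where F: "finite F" "F \<subseteq> mod_R"
    "\<forall>Z. indecomposable Z \<and> retract Z A \<longrightarrow> (\<exists>N\<in>F. Z \<cong>\<^sub>R N)"
    and G: "finite G" "G \<subseteq> mod_R" "\<forall>Z. indecomposable Z \<and> retract Z B \<longrightarrow> (\<exists>N\<in>G. Z \<cong>\<^sub>R N)" by blast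
  have "\<exists>N\<in>F \<union> G. Z \<cong>\<^sub>R N" if Z: "indecomposable Z" "retract Z C" for Z
  proof -
    have "retract C (ds A B)" using sum mod_R_ds by (intro retract_iso)
    then have "retract Z A \<or> retract Z B"
      using indecomposable_retract_ds[OF Z(1) sum(1,2)] retract_trans Z(2) by blast
    then show ?thesis using F G Z(1) by blast
  qed
  then show ?case using F G by (intro exI[of _ "F \<union> G"]) auto
qed

text \<open>Instead of ranks, the existence of \<open>\<Phi>\<close> uses that the kernels of the powers of \<open>\<omega>\<close> form an
  ascending chain; hence torsion in the Igusa--Todorov group does not matter.\<close>

lemma syzygy_injective_eventually:
  assumes M: "M \<in> mod_R"
  shows "\<exists>n. \<forall>m\<ge>n. syzygy_injective M m"
proof -
  obtain F :: "('r, 'k) rmod set" where F: "finite F" "F \<subseteq> mod_R"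
    "\<And>Z. indecomposable Z \<Longrightarrow> retract Z M \<Longrightarrow> \<exists>N\<in>F. Z \<cong>\<^sub>R N"
    using finitely_many_indecomposable_retracts[OF M] by blast
  have gen: "\<exists>x\<in>frag.span (frag_of ` F). frag_of N - x \<in> Rel"
    if N: "indecomposable N" "direct_summand N M" for N
  proof -
    have "retract N M" using N(2) direct_summand_iff_retract[OF M] by blast
    then obtain N' where N': "N' \<in> F" "N \<cong>\<^sub>R N'" using F(3) N(1) by blast
    have "frag_of N - frag_of N' \<in> Rel"
      using Rel_stably_iso[OF iso_stably_iso[OF indecomposable_mod_R[OF N(1)] subsetD[OF F(2)
        N'(1)] N'(2)]] .
    then show ?thesis by (rule bexI[OF _ frag.span_base[OF imageI[OF N'(1)]]])
  qed
  have rep: "\<exists>x\<in>frag.span (frag_of ` F). c - x \<in> Rel" if "c \<in> summand_frags M" for c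
    using that unfolding summand_frags_def
  proof (induction c rule: generate.induct)
    case one
    show ?case by (rule bexI[OF _ frag.span_zero]) (simp add: Rel_0)
  next
    case (incl h)
    then show ?case using gen by blast
  next
    case (inv h)
    then obtain N where N: "h = frag_of N" "indecomposable N" "direct_summand N M" by blast
    then obtain x where x: "x \<in> frag.span (frag_of ` F)" "h - x \<in> Rel" using gen by blast
    have "- h - (- x) \<in> Rel" using Rel_uminus[OF x(2)] by simp
    moreover have "inv\<^bsub>free_mod\<^esub> h = - h"
      using indecomposable_mod_R[OF N(2)] unfolding N(1) by (intro inv_free_Abelian_group) simp
    ultimately show ?case using frag.span_neg[OF x(1)] by metis
  next
    case (eng a b)
    then obtain x y where xy: "x \<in> frag.span (frag_of ` F)" "a - x \<in> Rel"
      "y \<in> frag.span (frag_of ` F)" "b - y \<in> Rel"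
      by blast
    have "(a + b) - (x + y) \<in> Rel" using Rel_add[OF xy(2,4)] by (simp add: algebra_simps)
    then show ?case using xy frag.span_add by (intro bexI[of _ "x + y"]) auto
  qed
  \<comment> \<open>\<open>H m\<close> is the kernel of the \<open>m\<close>-th power of the induced
    map, pulled back to the free group. It contains \<open>Rel\<close>, so an element of
    \<open>summand_frags M\<close> may be replaced by a combination of the finitely many
    representatives.\<close>
  define H where "H m = {c. (\<omega> ^^ m) c \<in> Rel}" for m
  have sub: "frag.subspace (H m)" for m
    unfolding frag.subspace_def H_def
    by (auto simp: frag_syzygy_funpow_0 frag_syzygy_funpow_add frag_syzygy_funpow_cmul Rel_0
      Rel_add Rel_frag_cmul)
  have mono: "H m \<subseteq> H n" if "m \<le> n" for m n
  proof
    fix c assume "c \<in> H m"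
    then have "(\<omega> ^^ (n - m)) ((\<omega> ^^ m) c) \<in> Rel" unfolding H_def using Rel_frag_syzygy_funpow
      by blast
    then have "(\<omega> ^^ (n - m + m)) c \<in> Rel" by (simp add: funpow_add)
    then show "c \<in> H n" using that by (simp add: H_def)
  qed
  have RelH: "Rel \<subseteq> H m" for m unfolding H_def using Rel_frag_syzygy_funpow by blast
  obtain n where n: "\<And>m. m \<ge> n \<Longrightarrow> H m \<inter> frag.span (frag_of ` F) \<subseteq> H n"
    using frag_subgroup_chain[of "frag_of ` F" H] F(1) sub mono by blast
  have "syzygy_injective M m" if m: "m \<ge> n" for m
    unfolding syzygy_injective_def
  proof (intro ballI impI)
    fix c assume c: "c \<in> summand_frags M" "(\<omega> ^^ Suc m) c \<in> Rel"
    obtain x where x: "x \<in> frag.span (frag_of ` F)" "c - x \<in> Rel" using rep c(1) by blast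
    have "c \<in> H (Suc m)" using c(2) unfolding H_def by blast
    moreover have "c - x \<in> H (Suc m)" "c - x \<in> H m" using x(2) RelH by auto
    ultimately have "c - (c - x) \<in> H (Suc m)" using frag.subspace_diff[OF sub] by blast
    then have "x \<in> H n" using n[of "Suc m"] m x(1) by auto
    then have "x \<in> H m" using mono m by blast
    then have "(c - x) + x \<in> H m" using \<open>c - x \<in> H m\<close> frag.subspace_add[OF sub] by blast
    then show "(\<omega> ^^ m) c \<in> Rel" by (simp add: H_def)
  qed
  then show ?thesis by blast
qed

text \<open>\<open>\<Phi>\<close> is a \<open>LEAST\<close>, so its defining property becomes
  available only once some bound is known to exist.\<close>

lemma syzygy_injective_Phi: "M \<in> mod_R \<Longrightarrow> m \<ge> \<Phi> M \<Longrightarrow> syzygy_injective M m"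
  unfolding Phi_Least using LeastI_ex[OF syzygy_injective_eventually] by blast

section \<open>Comparison of Igusa--Todorov functions\<close>

text \<open>When \<open>X\<close> is decomposed into indecomposables, the projective ones vanish in
  the quotient and the others are summands of \<open>Y\<close>.\<close>

lemma in_add_frag:
  assumes "in_add X Y" shows "\<exists>y\<in>summand_frags Y. frag_of X - y \<in> Rel"
proof -
  have Y: "Y \<in> mod_R" using assms by (simp add: in_add_def)
  have "X \<in> mod_R" using assms in_add_mod_R by blast
  then show ?thesis
    using assms
  proof (induction rule: mod_R_induct)
    case (zero Z)
    then show ?case using Rel_projective[OF projective_zero] summand_frags_0 by force
  next
    case (indecomposable Z)
    then consider "retract Z Y" | "projective Z" using in_add_indecomposable by blast
    then show ?case
    proof cases
      case 1
      then have "frag_of Z \<in> summand_frags Y"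
        unfolding summand_frags_def using indecomposable direct_summand_iff_retract[OF Y]
        by (intro generate.incl) blast
      then show ?thesis using Rel_0 by force
    next
      case 2
      then show ?thesis using Rel_projective summand_frags_0 by force
    qed
  next
    case (sum A B C)
    have "in_add A Y" "in_add B Y"
      using iso_ds_retract[OF sum(1-4)] in_add_retract sum.prems by blast+
    then obtain a b where ab: "a \<in> summand_frags Y" "frag_of A - a \<in> Rel" "b \<in> summand_frags Y"
      "frag_of B - b \<in> Rel"
      using sum.IH by blast
    have "frag_of C - (frag_of A + frag_of B) + ((frag_of A - a) + (frag_of B - b)) \<in> Rel"
      using Rel_add[OF Rel_ds[OF sum(1-4)] Rel_add[OF ab(2,4)]] .
    then have "frag_of C - (a + b) \<in> Rel" by (simp add: algebra_simps)
    then show ?case using summand_frags_add ab by blast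
  qed
qed

lemma in_add_syzygy_summand:
  assumes "retract N M" "in_add ((\<Omega> ^^ n) M) Y" shows "in_add ((\<Omega> ^^ n) N) Y"
proof -
  have NM: "N \<in> mod_R" "M \<in> mod_R" using assms(1) by (auto simp: retract_def)
  obtain L where L: "L \<in> mod_R" "M \<cong>\<^sub>R ds N L" using retract_complement[OF assms(1)] .
  have "ds ((\<Omega> ^^ n) N) ((\<Omega> ^^ n) L) \<simeq> (\<Omega> ^^ n) (ds N L)"
    using stably_iso_sym stably_iso_syzygy_funpow_ds NM L by blast
  also have "(\<Omega> ^^ n) (ds N L) \<simeq> (\<Omega> ^^ n) M"
    using stably_iso_syzygy_funpow[OF stably_iso_sym[OF iso_stably_iso[OF NM(2) mod_R_ds[OF NM(1)
      L(1)] L(2)]]] .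
  finally have "in_add (ds ((\<Omega> ^^ n) N) ((\<Omega> ^^ n) L)) Y" using in_add_stably_iso assms(2) by blast
  then show ?thesis using in_add_retract retract_ds(1) syzygy_funpow_mod_R NM L by blast
qed

text \<open>Modulo \<open>Rel\<close>, the map \<open>\<omega> ^^ n\<close> sends
  \<open>summand_frags M\<close> into \<open>summand_frags Y\<close> by \<open>in_add_frag\<close>;
  injectivity of a further step on the latter is inherited by the image.\<close>

lemma syzygy_injective_shift:
  assumes M: "M \<in> mod_R" and add: "in_add ((\<Omega> ^^ n) M) Y" and Y: "syzygy_injective Y m"
  shows "syzygy_injective M (m + n)"
proof -
  have Y': "Y \<in> mod_R" using add by (simp add: in_add_def)
  have gen: "\<exists>y\<in>summand_frags Y. frag_of ((\<Omega> ^^ n) N) - y \<in> Rel"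
    if "indecomposable N" "direct_summand N M" for N
    using in_add_frag[OF in_add_syzygy_summand[OF _ add]] direct_summand_iff_retract[OF M] that
    by blast
  have rep: "\<exists>y\<in>summand_frags Y. (\<omega> ^^ n) c - y \<in> Rel" if "c \<in> summand_frags M" for c
    using that unfolding summand_frags_def[of M]
  proof (induction c rule: generate.induct)
    case one
    then show ?case using summand_frags_0 Rel_0 frag_syzygy_funpow_0 by force
  next
    case (incl h)
    then show ?case using gen frag_syzygy_funpow_of by auto
  next
    case (inv h)
    then obtain N where N: "h = frag_of N" "indecomposable N" "direct_summand N M" by blast
    obtain y where y: "y \<in> summand_frags Y" "(\<omega> ^^ n) h - y \<in> Rel"
      using gen[OF N(2,3)] unfolding N(1) frag_syzygy_funpow_of by blast
    have "- ((\<omega> ^^ n) h - y) \<in> Rel" using y(2) by (rule Rel_uminus)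
    then have "(\<omega> ^^ n) (0 - h) - (0 - y) \<in> Rel"
      by (simp only: frag_syzygy_funpow_diff frag_syzygy_funpow_0) (simp add: algebra_simps)
    moreover have "inv\<^bsub>free_mod\<^esub> h = 0 - h"
      using inv_free_Abelian_group[of h mod_R] indecomposable_mod_R[OF N(2)] unfolding N(1) by simp
    ultimately show ?case using summand_frags_diff[OF summand_frags_0 y(1)] by metis
  next
    case (eng a b)
    then obtain x y where xy: "x \<in> summand_frags Y" "(\<omega> ^^ n) a - x \<in> Rel" "y \<in> summand_frags Y"
      "(\<omega> ^^ n) b - y \<in> Rel"
      by blast
    have "(\<omega> ^^ n) (a + b) - (x + y) \<in> Rel"
      using Rel_add[OF xy(2,4)] by (simp add: frag_syzygy_funpow_add algebra_simps)
    then show ?case using xy summand_frags_add by (intro bexI[of _ "x + y"]) auto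
  qed
  show ?thesis
    unfolding syzygy_injective_def
  proof (intro ballI impI)
    fix c assume c: "c \<in> summand_frags M" "(\<omega> ^^ Suc (m + n)) c \<in> Rel"
    obtain y where y: "y \<in> summand_frags Y" "(\<omega> ^^ n) c - y \<in> Rel" using rep c(1) by blast
    have eq: "(\<omega> ^^ k) ((\<omega> ^^ n) c) \<in> Rel \<longleftrightarrow> (\<omega> ^^ k) y \<in> Rel" for k
      using Rel_frag_syzygy_funpow[OF y(2), of k]
      by (intro Rel_diff_iff) (simp add: frag_syzygy_funpow_diff)
    have "(\<omega> ^^ Suc m) ((\<omega> ^^ n) c) \<in> Rel" using c(2) by (simp add: funpow_add)
    then have "(\<omega> ^^ m) y \<in> Rel" using eq Y y(1) unfolding syzygy_injective_def by blast
    then show "(\<omega> ^^ (m + n)) c \<in> Rel" using eq by (simp add: funpow_add)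
  qed
qed

lemma Phi_le:
  assumes M: "M \<in> mod_R" and add: "in_add ((\<Omega> ^^ n) M) Y"
  shows "\<Phi> M \<le> \<Phi> Y + n"
proof -
  have Y: "Y \<in> mod_R" using add by (simp add: in_add_def)
  have "syzygy_injective M m" if "m \<ge> \<Phi> Y + n" for m
    using syzygy_injective_shift[OF M add syzygy_injective_Phi[OF Y, of "m - n"]] that by simp
  then show ?thesis unfolding Phi_Least[of M] by (intro Least_le) blast
qed

text \<open>The bound \<open>q\<close> for summands of \<open>W\<close> passes to the additive
  closure: finite projective dimension is inherited by the indecomposable pieces, each of which is
  projective or a summand of \<open>W\<close>, and the bound survives direct sums.\<close>

lemma in_add_projective_dimension:
  assumes "in_add X W" "projective ((\<Omega> ^^ k) X)"
    and W: "\<And>Z. retract Z W \<Longrightarrow> projective ((\<Omega> ^^ k) Z) \<Longrightarrow> projective ((\<Omega> ^^ q) Z)"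
  shows "projective ((\<Omega> ^^ q) X)"
proof -
  have "X \<in> mod_R" using assms in_add_mod_R by blast
  then show ?thesis
    using assms(1,2)
  proof (induction rule: mod_R_induct)
    case (zero Z)
    then show ?case using projective_syzygy_funpow projective_zero by blast
  next
    case (indecomposable Z)
    then show ?case using in_add_indecomposable W projective_syzygy_funpow by blast
  next
    case (sum A B C)
    note r = iso_ds_retract[OF sum(1-4)]
    then have "projective ((\<Omega> ^^ q) A)" "projective ((\<Omega> ^^ q) B)"
      using sum.IH in_add_retract retract_pd_mono sum.prems by blast+
    then have p: "projective (ds ((\<Omega> ^^ q) A) ((\<Omega> ^^ q) B))" by (rule projective_ds)
    have "(\<Omega> ^^ q) C \<simeq> (\<Omega> ^^ q) (ds A B)"
      using stably_iso_syzygy_funpow[OF iso_stably_iso[OF sum(3) mod_R_ds[OF sum(1,2)] sum(4)]] .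
    also have "(\<Omega> ^^ q) (ds A B) \<simeq> ds ((\<Omega> ^^ q) A) ((\<Omega> ^^ q) B)"
      using stably_iso_syzygy_funpow_ds sum(1,2) .
    finally show ?case using projective_stably_iso p by blast
  qed
qed

text \<open>With \<open>a = \<Phi> M\<close> and \<open>b = \<Phi> Y\<close>, a summand
  \<open>N\<close> of the \<open>a\<close>-th syzygy of \<open>M\<close> reaches the additive
  closure of the \<open>b\<close>-th syzygy of \<open>Y\<close> after \<open>c = b + n - a\<close>
  further steps. A finite \<open>pd N\<close> is then at most \<open>c + q\<close>, and
  \<open>a + c + q = n + b + q\<close>.\<close>

lemma Psi_le:
  assumes M: "M \<in> mod_R" and add: "in_add ((\<Omega> ^^ n) M) Y"
  shows "\<Psi> M \<le> enat n + \<Psi> Y"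
proof -
  define a where "a = \<Phi> M"
  define b where "b = \<Phi> Y"
  have Y: "Y \<in> mod_R" using add by (simp add: in_add_def)
  have ab: "a \<le> b + n" unfolding a_def b_def using Phi_le[OF M add] .
  let ?W = "(\<Omega> ^^ b) Y"
  have W: "?W \<in> mod_R" using Y syzygy_funpow_mod_R by blast
  have aM: "(\<Omega> ^^ a) M \<in> mod_R" using M syzygy_funpow_mod_R by blast
  show ?thesis
  proof (cases "pfd {N. direct_summand N ?W}")
    case infinity
    then show ?thesis by (simp add: IT_Psi_def b_def)
  next
    case (enat q)
    \<comment> \<open>No truncation occurs, since \<open>a \<le> b + n\<close> by the comparison of
      the values of \<Phi>.\<close>
    define c where "c = b + n - a"
    have "pd N \<le> enat (c + q)" if N: "direct_summand N ((\<Omega> ^^ a) M)" "pd N < \<infinity>" for N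
    proof -
      have r: "retract N ((\<Omega> ^^ a) M)" using N direct_summand_iff_retract[OF aM] by blast
      then have NR: "N \<in> mod_R" by (simp add: retract_def)
      obtain k where k: "projective ((\<Omega> ^^ k) N)" using N(2) pd_less_infinity_iff[OF NR] by blast
      have "(\<Omega> ^^ c) ((\<Omega> ^^ a) M) = (\<Omega> ^^ b) ((\<Omega> ^^ n) M)"
        using ab by (simp add: c_def flip: funpow_add[unfolded comp_def, THEN fun_cong])
      then have "in_add ((\<Omega> ^^ c) ((\<Omega> ^^ a) M)) ?W" using in_add_syzygy_funpow[OF add] by simp
      then have 1: "in_add ((\<Omega> ^^ c) N) ?W" using in_add_syzygy_summand r by blast
      have "(\<Omega> ^^ k) ((\<Omega> ^^ c) N) = (\<Omega> ^^ c) ((\<Omega> ^^ k) N)"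
        by (metis add.commute comp_apply funpow_add)
      then have 2: "projective ((\<Omega> ^^ k) ((\<Omega> ^^ c) N))" using projective_syzygy_funpow[OF k] by simp
      have "projective ((\<Omega> ^^ q) ((\<Omega> ^^ c) N))"
      proof (rule in_add_projective_dimension[OF 1 2])
        fix Z assume Z: "retract Z ?W" "projective ((\<Omega> ^^ k) Z)"
        then have ZR: "Z \<in> mod_R" by (simp add: retract_def)
        have "pd Z < \<infinity>" using pd_less_infinity_iff[OF ZR] Z by blast
        moreover have "direct_summand Z ?W" using Z direct_summand_iff_retract[OF W] by blast
        ultimately have "pd Z \<le> enat q"
          unfolding enat[symmetric] pfd_def by (intro Sup_upper) blast
        then show "projective ((\<Omega> ^^ q) Z)" using pd_le_iff[OF ZR] by blast
      qed
      then have "projective ((\<Omega> ^^ (c + q)) N)" by (metis add.commute comp_apply funpow_add)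
      then show ?thesis using pd_le_iff[OF NR] by blast
    qed
    then have "pfd {N. direct_summand N ((\<Omega> ^^ a) M)} \<le> enat (c + q)"
      unfolding pfd_def by (intro Sup_least) auto
    then have "\<Psi> M \<le> enat a + enat (c + q)"
      unfolding IT_Psi_def a_def[symmetric] by (rule add_left_mono)
    also have "\<dots> = enat n + \<Psi> Y"
      using ab enat by (simp add: IT_Psi_def b_def[symmetric] c_def)
    finally show ?thesis .
  qed
qed

end

theorem theorem4p7:
  fixes scale :: "'k::alg_closed_field \<Rightarrow> 'r::ring_1 \<Rightarrow> 'r"
    and \<theta> :: "nat \<Rightarrow> ('r, 'k) rmod"
    and t i0 s :: nat
  assumes "finite_dimensional_algebra scale"
    and "stratifying_system t \<theta>"
    and "infinite_pd_indices t \<theta> = {i0}"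
    and "enat s = (if t > 1 then Max {pd (\<theta> j) | j. j \<in> {1..t} \<and> j \<noteq> i0} else 0)"
  shows "pfd (\<F> t \<theta>) \<le> enat s \<and>
         \<Psi>d (\<F> t \<theta>) \<le> 1 + enat s + \<Psi> ((\<Omega> ^^ (s + 1)) (\<theta> i0))"
proof -
  interpret finite_dimensional_algebra scale by (rule assms(1))
  have R: "\<theta> i \<in> mod_R" if "i \<in> {1..t}" for i
    using assms(2) that unfolding stratifying_system_def indecomposable_def by blast
  have ext: "trivial_group (Ext1 (\<theta> j) (\<theta> i))" if "i \<in> {1..t}" "j \<in> {1..t}" "i \<le> j" for i j
    using assms(2) that unfolding stratifying_system_def by blast
  have i0: "i0 \<in> {1..t}" "pd (\<theta> i0) = \<infinity>"
    using assms(3) unfolding infinite_pd_indices_def by blast+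
  have pr: "projective ((\<Omega> ^^ s) (\<theta> j))" if j: "j \<in> {1..t}" "j \<noteq> i0" for j
  proof -
    \<comment> \<open>An index different from \<open>i0\<close> exists, so \<open>s\<close> is the
      maximum and not the default value \<open>0\<close>.\<close>
    have "t > 1" using j i0(1) by auto
    then have "enat s = Max {pd (\<theta> j) | j. j \<in> {1..t} \<and> j \<noteq> i0}" using assms(4) by simp
    moreover have "finite {pd (\<theta> j) | j. j \<in> {1..t} \<and> j \<noteq> i0}" by simp
    ultimately have "pd (\<theta> j) \<le> enat s" using j by (auto intro: Max_ge)
    then show ?thesis using pd_le_iff[OF R[OF j(1)]] by blast
  qed
  let ?Y = "(\<Omega> ^^ Suc s) (\<theta> i0)"
  have Y: "?Y \<in> mod_R" using R[OF i0(1)] syzygy_funpow_mod_R by blast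
  have "pfd (\<F> t \<theta>) \<le> enat s"
    unfolding pfd_def
  proof (rule Sup_least)
    fix x assume "x \<in> {pd M | M. M \<in> \<F> t \<theta> \<and> pd M < \<infinity>}"
    then obtain M where M: "x = pd M" "M \<in> \<F> t \<theta>" "pd M < \<infinity>" by blast
    have MR: "M \<in> mod_R" using M(2) by (simp add: filtered_modules_def)
    obtain k where k: "projective ((\<Omega> ^^ k) M)" using M(3) pd_less_infinity_iff[OF MR] by blast
    obtain m where m: "(\<Omega> ^^ Suc s) M \<simeq> pow_mod ?Y m" "m = 0 \<Longrightarrow> projective ((\<Omega> ^^ s) M)"
      using filtered_stable[OF M(2) R ext i0(1) pr] by blast
    \<comment> \<open>A nonzero power contains \<open>?Y\<close> as a retract, so finite projective
      dimension of \<open>M\<close> would pass to \<open>?Y\<close> and then, \<open>Suc s\<close>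
      steps back, to \<open>\<theta> i0\<close>.\<close>
    have "m = 0"
    proof (rule ccontr)
      assume "m \<noteq> 0"
      then obtain m' where m': "m = Suc m'" by (cases m) auto
      have "(\<Omega> ^^ k) (pow_mod ?Y m) \<simeq> (\<Omega> ^^ k) ((\<Omega> ^^ Suc s) M)"
        using stably_iso_syzygy_funpow[OF stably_iso_sym[OF m(1)]] .
      moreover have "(\<Omega> ^^ k) ((\<Omega> ^^ Suc s) M) = (\<Omega> ^^ Suc s) ((\<Omega> ^^ k) M)"
        by (metis add.commute comp_apply funpow_add)
      ultimately have "projective ((\<Omega> ^^ k) (pow_mod ?Y m))"
        using projective_stably_iso projective_syzygy_funpow[OF k] by metis
      moreover have "retract ?Y (pow_mod ?Y m)" using retract_ds(1)[OF Y mod_R_pow[OF Y]] m' by simp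
      ultimately have "projective ((\<Omega> ^^ k) ?Y)" using retract_pd_mono by blast
      then have "projective ((\<Omega> ^^ (k + Suc s)) (\<theta> i0))" by (simp only: funpow_add comp_apply)
      then have "pd (\<theta> i0) < \<infinity>" using pd_less_infinity_iff[OF R[OF i0(1)]] by blast
      then show False using i0(2) by simp
    qed
    then show "x \<le> enat s" using m(2) pd_le_iff[OF MR] M(1) by blast
  qed
  moreover have "\<Psi>d (\<F> t \<theta>) \<le> 1 + enat s + \<Psi> ((\<Omega> ^^ (s + 1)) (\<theta> i0))"
    unfolding Psi_dim_def
  proof (rule Sup_least)
    fix x assume "x \<in> \<Psi> ` \<F> t \<theta>"
    then obtain M where M: "x = \<Psi> M" "M \<in> \<F> t \<theta>" by blast
    have MR: "M \<in> mod_R" using M(2) by (simp add: filtered_modules_def)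
    obtain m where "(\<Omega> ^^ Suc s) M \<simeq> pow_mod ?Y m"
      using filtered_stable[OF M(2) R ext i0(1) pr] by blast
    then have "in_add ((\<Omega> ^^ Suc s) M) ?Y" using in_add_stably_iso in_add_pow[OF Y] by blast
    \<comment> \<open>The comparison is made at \<open>n = s + 1\<close>, the order at which the
      copies of \<open>\<theta> i0\<close> alone determine the syzygy stably; this is the summand
      \<open>1 + s\<close> of the bound.\<close>
    then have "\<Psi> M \<le> enat (Suc s) + \<Psi> ?Y" using Psi_le[OF MR] by blast
    then show "x \<le> 1 + enat s + \<Psi> ((\<Omega> ^^ (s + 1)) (\<theta> i0))"
      using M(1) by (simp add: one_enat_def)
  qed
  ultimately show ?thesis ..
qed

end
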